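(* Let $\chi$ be a character of $\Gamma=\mathbb{Z}\omega$, and let $\alpha\in\mathbb{R}$ be a fixed real number with $\chi(m\omega)=e^{2i\pi\alpha m}$ for all $m\in\mathbb{Z}$. Then the $(\mathbb{Z}\omega,\chi)$-theta Fock-Bargmann space $\mathcal{F}^2_{\Gamma,\chi}(\mathbb{C}^g)$ is a reproducing kernel Hilbert space, and the set of functions $$e^{\alpha,\nu}_{n,\mathbf{k}}(z,z'):=e^{\frac{\nu}{2}z^2+2i\pi(\alpha+n)z}\,z'^{\mathbf{k}},$$ for varying $n\in\mathbb{Z}$ and varying multi-index $\mathbf{k}=(k_2,\dots,k_g)$ of nonnegative integers, constitutes an orthogonal basis of $\mathcal{F}^2_{\Gamma,\chi}(\mathbb{C}^g)$, with $$\left\|e^{\alpha,\nu}_{n,\mathbf{k}}\right\|_\Gamma^2=\sqrt{2\pi\nu}\left(\frac{1}{2\nu}\right)^{g}\left(\frac{1}{\nu}\right)^{|\mathbf{k}|}\mathbf{k}!\;e^{\frac{2\pi^2}{\nu}(n+\alpha)^2}.$$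
   Context: Let $g\ge 2$ and let $H$ be a positive definite Hermitian form on $\mathbb{C}^g$, linear in the first variable and conjugate-linear in the second. Let $\omega\in\mathbb{C}^g\setminus\{0\}$, $\Gamma=\mathbb{Z}\omega$, and $\nu=H(\omega,\omega)>0$. Let $V^{\perp}$ be the $H$-orthogonal complement of $\mathbb{C}\omega$, let $\widetilde H$ be the restriction of $H$ to $V^\perp$, and fix a basis $\omega_2,\dots,\omega_g$ of $V^{\perp}$ with $H(\omega_i,\omega_j)=\delta_{ij}\nu$. A vector $u=z\omega+\widetilde u$, $\widetilde u=z_2\omega_2+\cdots+z_g\omega_g\in V^\perp$, is identified with its coordinates $(z,z')\in\mathbb{C}\times\mathbb{C}^{g-1}$, $z'=(z_2,\dots,z_g)$; thus $H(u,u)=\nu|z|^2+\widetilde H(\widetilde u,\widetilde u)$. The symbol $d\lambda$ denotes Lebesgue measure in these coordinates. Let $\chi:\Gamma\to\mathbb{C}$ with $|\chi(\gamma)|=1$ for all $\gamma\in\Gamma$. The space $\mathcal{F}^2_{\Gamma,\chi}(\mathbb{C}^g)$ (the $(\mathbb{Z}\omega,\chi)$-theta Fock-Bargmann space) consists of all holomorphic $f:\mathbb{C}^g\to\mathbb{C}$ such that $$f(u+\gamma)=\chi(\gamma)e^{H(u+\frac{\gamma}{2},\gamma)}f(u),\qquad u\in\mathbb{C}^g,\ \gamma\in\Gamma,$$ and $\|f\|_\Gamma^2:=\langle f,f\rangle_\Gamma<+\infty$, where $$\langle f,h\rangle_\Gamma=\int_{\Lambda(\Gamma)}f(u)\overline{h(u)}e^{-H(u,u)}\,d\lambda(u)$$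 and $\Lambda(\Gamma)=([0,1]\times\mathbb{R})\times V^{\perp}$ is the fundamental domain ($z=x+iy$ with $x\in[0,1]$, $y\in\mathbb{R}$). The space is equipped with the inner product $\langle\cdot,\cdot\rangle_\Gamma$. A character of $\Gamma$ is a group homomorphism from $\Gamma$ to the unit circle. For $\mathbf{k}=(k_2,\dots,k_g)$: $z'^{\mathbf{k}}=z_2^{k_2}\cdots z_g^{k_g}$, $|\mathbf{k}|=k_2+\cdots+k_g$, $\mathbf{k}!=k_2!\cdots k_g!$. An orthogonal basis is an orthogonal family of nonzero vectors whose linear span is dense.
   Formalization: The squared norm is proved with an extra factor (2π)^{g-1}: for Lebesgue measure dλ each z_j contributes πk_j!/ν^{k_j+1}, so the printed value is false for all g≥2 (g=2, ν=1, α=n=0, k=0: true π√(π/2), printed √(2π)/4). *)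

theory Defs
  imports "HOL-Analysis.Analysis"
begin

text \<open>Spaces of complex functions are given by a carrier set of genuine functions (not classes
  modulo null sets) together with a form \<open>ip\<close>, linear in the first and conjugate-linear in the
  second argument.\<close>

definition fun_inner_product_space ::
    "('a \<Rightarrow> complex) set \<Rightarrow> (('a \<Rightarrow> complex) \<Rightarrow> ('a \<Rightarrow> complex) \<Rightarrow> complex) \<Rightarrow> bool" where
  "fun_inner_product_space F ip \<longleftrightarrow>
     (\<lambda>_. 0) \<in> F \<and>
     (\<forall>f\<in>F. \<forall>h\<in>F. (\<lambda>x. f x + h x) \<in> F) \<and>
     (\<forall>c. \<forall>f\<in>F. (\<lambda>x. c * f x) \<in> F) \<and>
     (\<forall>f\<in>F. \<forall>h\<in>F. \<forall>k\<in>F. ip (\<lambda>x. f x + h x) k = ip f k + ip h k) \<and>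
     (\<forall>c. \<forall>f\<in>F. \<forall>h\<in>F. ip (\<lambda>x. c * f x) h = c * ip f h) \<and>
     (\<forall>f\<in>F. \<forall>h\<in>F. ip h f = cnj (ip f h)) \<and>
     (\<forall>f\<in>F. f \<noteq> (\<lambda>_. 0) \<longrightarrow> 0 < Re (ip f f))"

definition ip_norm ::
    "(('a \<Rightarrow> complex) \<Rightarrow> ('a \<Rightarrow> complex) \<Rightarrow> complex) \<Rightarrow> ('a \<Rightarrow> complex) \<Rightarrow> real" where
  "ip_norm ip f = sqrt (Re (ip f f))"

definition fun_hilbert_space ::
    "('a \<Rightarrow> complex) set \<Rightarrow> (('a \<Rightarrow> complex) \<Rightarrow> ('a \<Rightarrow> complex) \<Rightarrow> complex) \<Rightarrow> bool" where
  "fun_hilbert_space F ip \<longleftrightarrow>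
     fun_inner_product_space F ip \<and>
     (\<forall>X :: nat \<Rightarrow> 'a \<Rightarrow> complex.
        (\<forall>n. X n \<in> F) \<longrightarrow>
        (\<forall>\<epsilon>>0. \<exists>N. \<forall>m\<ge>N. \<forall>n\<ge>N. ip_norm ip (\<lambda>x. X m x - X n x) < \<epsilon>) \<longrightarrow>
        (\<exists>f\<in>F. (\<lambda>n. ip_norm ip (\<lambda>x. X n x - f x)) \<longlonglongrightarrow> 0))"

definition reproducing_kernel_hilbert_space ::
    "('a \<Rightarrow> complex) set \<Rightarrow> (('a \<Rightarrow> complex) \<Rightarrow> ('a \<Rightarrow> complex) \<Rightarrow> complex) \<Rightarrow> bool" where
  "reproducing_kernel_hilbert_space F ip \<longleftrightarrow>
     fun_hilbert_space F ip \<and>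
     (\<exists>K :: 'a \<Rightarrow> 'a \<Rightarrow> complex. \<forall>x. K x \<in> F \<and> (\<forall>f\<in>F. f x = ip f (K x)))"

definition fun_orthogonal_basis ::
    "('a \<Rightarrow> complex) set \<Rightarrow> (('a \<Rightarrow> complex) \<Rightarrow> ('a \<Rightarrow> complex) \<Rightarrow> complex) \<Rightarrow>
     ('i \<Rightarrow> 'a \<Rightarrow> complex) \<Rightarrow> bool" where
  "fun_orthogonal_basis F ip e \<longleftrightarrow>
     (\<forall>i. e i \<in> F \<and> e i \<noteq> (\<lambda>_. 0)) \<and>
     (\<forall>i j. i \<noteq> j \<longrightarrow> ip (e i) (e j) = 0) \<and>
     (\<forall>f\<in>F. \<forall>\<epsilon>>0. \<exists>A c. finite A \<and> ip_norm ip (\<lambda>x. f x - (\<Sum>i\<in>A. c i * e i x)) < \<epsilon>)"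

text \<open>Conjugate-linearity in the second variable and reality of \<open>H u u\<close> follow from the
  first three clauses.\<close>

definition positive_definite_hermitian :: "(complex^'g \<Rightarrow> complex^'g \<Rightarrow> complex) \<Rightarrow> bool" where
  "positive_definite_hermitian H \<longleftrightarrow>
     (\<forall>u v w. H (u + v) w = H u w + H v w) \<and>
     (\<forall>c u v. H (c *s u) v = c * H u v) \<and>
     (\<forall>u v. H v u = cnj (H u v)) \<and>
     (\<forall>u. u \<noteq> 0 \<longrightarrow> 0 < Re (H u u))"

definition rank_one_lattice :: "complex^'g \<Rightarrow> (complex^'g) set" where
  "rank_one_lattice \<omega> = range (\<lambda>m::int. of_int m *s \<omega>)"

definition unitary_character :: "(complex^'g) set \<Rightarrow> (complex^'g \<Rightarrow> complex) \<Rightarrow> bool" where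
  "unitary_character \<Gamma> chi \<longleftrightarrow>
     (\<forall>\<gamma>\<in>\<Gamma>. cmod (chi \<gamma>) = 1) \<and> (\<forall>\<gamma>\<in>\<Gamma>. \<forall>\<delta>\<in>\<Gamma>. chi (\<gamma> + \<delta>) = chi \<gamma> * chi \<delta>)"

text \<open>The index set \<open>{2..g}\<close> is rendered by a finite type \<open>'m\<close> with \<open>g - 1\<close> elements; \<open>b i\<close> is
  the basis vector \<open>\<omega>\<^sub>i\<close> of the orthogonal complement of \<open>\<omega>\<close>.\<close>

definition adapted_basis ::
    "(complex^'g \<Rightarrow> complex^'g \<Rightarrow> complex) \<Rightarrow> complex^'g \<Rightarrow> real \<Rightarrow> ('m::finite \<Rightarrow> complex^'g) \<Rightarrow> bool"
  where
  "adapted_basis H \<omega> \<nu> b \<longleftrightarrow>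
     inj b \<and> vec.independent (range b) \<and> vec.span (range b) = {u. H u \<omega> = 0} \<and>
     (\<forall>i j. H (b i) (b j) = (if i = j then of_real \<nu> else 0))"

definition point_of_coords ::
    "complex^'g \<Rightarrow> ('m::finite \<Rightarrow> complex^'g) \<Rightarrow> complex \<times> (complex^'m) \<Rightarrow> complex^'g" where
  "point_of_coords \<omega> b = (\<lambda>(z, z'). z *s \<omega> + (\<Sum>i\<in>UNIV. (z' $ i) *s b i))"

definition coords_of_point ::
    "complex^'g \<Rightarrow> ('m::finite \<Rightarrow> complex^'g) \<Rightarrow> complex^'g \<Rightarrow> complex \<times> (complex^'m)" where
  "coords_of_point \<omega> b = inv (point_of_coords \<omega> b)"

definition holomorphic_several :: "(complex^'g \<Rightarrow> complex) \<Rightarrow> bool" where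
  "holomorphic_several f \<longleftrightarrow>
     (\<forall>u. \<exists>D. (f has_derivative D) (at u) \<and> (\<forall>c v. D (c *s v) = c * D v))"

definition theta_domain :: "(complex \<times> (complex^'m)) set" where
  "theta_domain = {z. Re z \<in> {0..1}} \<times> UNIV"

definition theta_integrand ::
    "(complex^'g \<Rightarrow> complex^'g \<Rightarrow> complex) \<Rightarrow> complex^'g \<Rightarrow> ('m::finite \<Rightarrow> complex^'g) \<Rightarrow>
     (complex^'g \<Rightarrow> complex) \<Rightarrow> (complex^'g \<Rightarrow> complex) \<Rightarrow> complex \<times> (complex^'m) \<Rightarrow> complex" where
  "theta_integrand H \<omega> b f h p =
     (let u = point_of_coords \<omega> b p in f u * cnj (h u) * exp (- H u u))"

text \<open>The measure \<open>lborel\<close> on \<open>\<complex> \<times> \<complex>\<^sup>g\<^sup>-\<^sup>1\<close> is the unnormalised Lebesgue measure in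
  the real and imaginary parts of all coordinates, so that the integral of
  \<open>\<bar>z\<bar>\<^sup>2\<^sup>k exp (- \<nu> \<bar>z\<bar>\<^sup>2)\<close> over one complex coordinate is \<open>\<pi> k! / \<nu>\<^sup>k\<^sup>+\<^sup>1\<close>.\<close>

definition theta_inner ::
    "(complex^'g \<Rightarrow> complex^'g \<Rightarrow> complex) \<Rightarrow> complex^'g \<Rightarrow> ('m::finite \<Rightarrow> complex^'g) \<Rightarrow>
     (complex^'g \<Rightarrow> complex) \<Rightarrow> (complex^'g \<Rightarrow> complex) \<Rightarrow> complex" where
  "theta_inner H \<omega> b f h = (LINT p:theta_domain|lborel. theta_integrand H \<omega> b f h p)"

text \<open>Finiteness of the norm has to be stated as integrability, since the Bochner integral of a
  non-integrable function is \<open>0\<close>.\<close>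

definition theta_FB_space ::
    "(complex^'g \<Rightarrow> complex^'g \<Rightarrow> complex) \<Rightarrow> complex^'g \<Rightarrow> ('m::finite \<Rightarrow> complex^'g) \<Rightarrow>
     (complex^'g \<Rightarrow> complex) \<Rightarrow> (complex^'g \<Rightarrow> complex) set" where
  "theta_FB_space H \<omega> b chi =
     {f. holomorphic_several f \<and>
         (\<forall>u. \<forall>\<gamma>\<in>rank_one_lattice \<omega>.
            f (u + \<gamma>) = chi \<gamma> * exp (H (u + (1/2) *s \<gamma>) \<gamma>) * f u) \<and>
         set_integrable lborel theta_domain (theta_integrand H \<omega> b f f)}"

definition theta_basis ::
    "complex^'g \<Rightarrow> ('m::finite \<Rightarrow> complex^'g) \<Rightarrow> real \<Rightarrow> real \<Rightarrow> int \<times> ('m \<Rightarrow> nat) \<Rightarrow>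
     complex^'g \<Rightarrow> complex" where
  "theta_basis \<omega> b \<alpha> \<nu> = (\<lambda>(n, k) u.
     let (z, z') = coords_of_point \<omega> b u in
       exp (of_real (\<nu> / 2) * z^2 + 2 * \<i> * of_real pi * of_real (\<alpha> + of_int n) * z) *
       (\<Prod>i\<in>UNIV. (z' $ i) ^ k i))"

definition multi_degree :: "('m::finite \<Rightarrow> nat) \<Rightarrow> nat" where
  "multi_degree k = (\<Sum>i\<in>UNIV. k i)"

definition multi_fact :: "('m::finite \<Rightarrow> nat) \<Rightarrow> nat" where
  "multi_fact k = (\<Prod>i\<in>UNIV. fact (k i))"

end

theory Submission
  imports Defs "HOL-Complex_Analysis.Complex_Analysis" "HOL-Probability.Distributions"
begin

text \<open>In the coordinates \<open>(z, w)\<close> with \<open>z = x + i y\<close>, a quasi-periodic entire function is a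
  function that has period 1 in \<open>z\<close>, multiplied by \<open>exp (\<nu> z\<^sup>2 / 2 + 2 \<pi> i \<alpha> z)\<close>.
  The basis functions multiply this factor by a character \<open>exp (2 \<pi> i n z)\<close> and a monomial in
  \<open>w\<close>. They are orthogonal for two reasons: a rotation of one coordinate of \<open>w\<close> preserves the
  measure but multiplies the integrand by a number other than 1 if the monomials differ, and
  different characters integrate to zero over a period in \<open>x\<close>. In the absolute
  squares the factor in \<open>z\<close> and the weight in \<open>z\<close> combine to
  \<open>exp (- 2 \<nu> y\<^sup>2 - 4 \<pi> (\<alpha> + n) y)\<close>, so that the norms are products of a Gaussian integral in \<open>y\<close> and one radial integral for each coordinate of \<open>w\<close>.

  The value \<open>f(u)\<^sup>2\<close> is the mean of \<open>f\<^sup>2\<close> over a ball around \<open>u\<close>. As the weighted density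
  \<open>\<bar>f\<bar>\<^sup>2 exp (- H)\<close> is periodic, this bounds \<open>f(u)\<close> by the norm of \<open>f\<close>, locally uniformly in
  \<open>u\<close> (\<open>pointwise_bound\<close>). A Cauchy sequence therefore converges locally uniformly; Cauchy's
  estimate on complex lines makes the derivatives converge too, so the limit is holomorphic, and
  Fatou's lemma turns pointwise convergence into convergence in norm (\<open>fun_hilbert_space_F\<close>).

  For totality, let \<open>f\<close> be orthogonal to all basis functions with a given \<open>n\<close>. The exponential
  series and dominated convergence make \<open>f\<close> orthogonal to the product of the factor in \<open>z\<close> with
  \<open>exp (\<nu> \<langle>w, a\<rangle>)\<close>, for every \<open>a\<close>. The substitution \<open>w = v + a\<close> followed by an average over
  \<open>v \<mapsto> cis \<theta> v\<close> replaces \<open>f(z, w)\<close> in this integral by \<open>f(z, a)\<close>; this is the reproducing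
  property of the Fock kernel, and it follows from the mean value property alone. What remains
  says that the \<open>n\<close>-th Fourier coefficient of the periodic part of \<open>f(\<cdot>, a)\<close>, which does not
  depend on \<open>y\<close>, is zero (\<open>orthogonal_e_coefficient\<close>). As this holds for all \<open>n\<close> and \<open>a\<close>,
  \<open>f = 0\<close> by uniqueness of Fourier coefficients.

  The rest is Hilbert space theory. In a complete space with bounded point evaluations, the
  theorem of Riesz and Fischer gives the density of the span of a total orthogonal family when it
  is applied to the coefficients of \<open>f\<close>, and the reproducing kernel at \<open>x\<close> when it is applied to
  the values of the family at \<open>x\<close> (\<open>rkhs_and_basis\<close>).\<close>

section \<open>Orthogonal families in Hilbert spaces of functions\<close>

locale fun_ips =
  fixes F :: "('a \<Rightarrow> complex) set"
    and ip :: "('a \<Rightarrow> complex) \<Rightarrow> ('a \<Rightarrow> complex) \<Rightarrow> complex"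
  assumes fun_ips: "fun_inner_product_space F ip"
begin

lemma zero_mem: "(\<lambda>_. 0) \<in> F"
  and add_mem: "f \<in> F \<Longrightarrow> h \<in> F \<Longrightarrow> (\<lambda>x. f x + h x) \<in> F"
  and scale_mem: "f \<in> F \<Longrightarrow> (\<lambda>x. c * f x) \<in> F"
  and ip_add_left: "f \<in> F \<Longrightarrow> h \<in> F \<Longrightarrow> k \<in> F \<Longrightarrow> ip (\<lambda>x. f x + h x) k = ip f k + ip h k"
  and ip_scale_left: "f \<in> F \<Longrightarrow> h \<in> F \<Longrightarrow> ip (\<lambda>x. c * f x) h = c * ip f h"
  and ip_cnj: "f \<in> F \<Longrightarrow> h \<in> F \<Longrightarrow> ip h f = cnj (ip f h)"
  and ip_pos: "f \<in> F \<Longrightarrow> f \<noteq> (\<lambda>_. 0) \<Longrightarrow> 0 < Re (ip f f)"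
proof -
  note laws = fun_ips[unfolded fun_inner_product_space_def]
  show "(\<lambda>_. 0) \<in> F" by (rule laws[THEN conjunct1])
  note laws = laws[THEN conjunct2]
  show "f \<in> F \<Longrightarrow> h \<in> F \<Longrightarrow> (\<lambda>x. f x + h x) \<in> F"
    by (rule laws[THEN conjunct1, rule_format])
  note laws = laws[THEN conjunct2]
  show "f \<in> F \<Longrightarrow> (\<lambda>x. c * f x) \<in> F"
    by (rule laws[THEN conjunct1, rule_format])
  note laws = laws[THEN conjunct2]
  show "f \<in> F \<Longrightarrow> h \<in> F \<Longrightarrow> k \<in> F \<Longrightarrow> ip (\<lambda>x. f x + h x) k = ip f k + ip h k"
    by (rule laws[THEN conjunct1, rule_format])
  note laws = laws[THEN conjunct2]
  show "f \<in> F \<Longrightarrow> h \<in> F \<Longrightarrow> ip (\<lambda>x. c * f x) h = c * ip f h"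
    by (rule laws[THEN conjunct1, rule_format])
  note laws = laws[THEN conjunct2]
  show "f \<in> F \<Longrightarrow> h \<in> F \<Longrightarrow> ip h f = cnj (ip f h)"
    by (rule laws[THEN conjunct1, rule_format])
  show "f \<in> F \<Longrightarrow> f \<noteq> (\<lambda>_. 0) \<Longrightarrow> 0 < Re (ip f f)"
    by (rule laws[THEN conjunct2, rule_format])
qed

lemma ip_zero_left: "h \<in> F \<Longrightarrow> ip (\<lambda>_. 0) h = 0"
  using ip_scale_left[of "\<lambda>_. 0" h 0] zero_mem by simp

lemma diff_scale_mem: "f \<in> F \<Longrightarrow> h \<in> F \<Longrightarrow> (\<lambda>x. f x - c * h x) \<in> F"
  using add_mem[OF _ scale_mem[of h "-c"], of f] by simp

lemma ip_diff_scale_left: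
  "f \<in> F \<Longrightarrow> h \<in> F \<Longrightarrow> k \<in> F \<Longrightarrow> ip (\<lambda>x. f x - c * h x) k = ip f k - c * ip h k"
  using ip_add_left[OF _ scale_mem[of h "-c"], of f k] ip_scale_left[of h k "-c"] by simp

lemma diff_mem: "f \<in> F \<Longrightarrow> h \<in> F \<Longrightarrow> (\<lambda>x. f x - h x) \<in> F"
  using diff_scale_mem[of f h 1] by simp

lemma ip_diff_left:
  "f \<in> F \<Longrightarrow> h \<in> F \<Longrightarrow> k \<in> F \<Longrightarrow> ip (\<lambda>x. f x - h x) k = ip f k - ip h k"
  using ip_diff_scale_left[of f h k 1] by simp

lemma ip_diff_right:
  "f \<in> F \<Longrightarrow> h \<in> F \<Longrightarrow> k \<in> F \<Longrightarrow> ip k (\<lambda>x. f x - h x) = ip k f - ip k h"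
  using ip_cnj[OF diff_mem[of f h], of k] ip_cnj[of f k] ip_cnj[of h k] by (simp add: ip_diff_left)

lemma ip_diff_scale_right:
  "f \<in> F \<Longrightarrow> h \<in> F \<Longrightarrow> k \<in> F \<Longrightarrow> ip k (\<lambda>x. f x - c * h x) = ip k f - cnj c * ip k h"
  using ip_cnj[OF diff_scale_mem[of f h c], of k] ip_cnj[of f k] ip_cnj[of h k] by (simp add: ip_diff_scale_left)

lemma sum_mem:
  assumes "finite A" "\<And>i. i \<in> A \<Longrightarrow> f i \<in> F"
  shows "(\<lambda>x. \<Sum>i\<in>A. c i * f i x) \<in> F"
  using assms
proof (induction A rule: finite_induct)
  case (insert a A)
  then show ?case using add_mem[OF scale_mem[of "f a" "c a"] insert.IH] by simp
qed (simp add: zero_mem)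

lemma ip_sum_left:
  assumes "finite A" "\<And>i. i \<in> A \<Longrightarrow> f i \<in> F" "h \<in> F"
  shows "ip (\<lambda>x. \<Sum>i\<in>A. c i * f i x) h = (\<Sum>i\<in>A. c i * ip (f i) h)"
  using assms
proof (induction A rule: finite_induct)
  case (insert a A)
  then show ?case
    using ip_add_left[OF scale_mem[of "f a" "c a"] sum_mem[of A f c] \<open>h \<in> F\<close>] ip_scale_left[of "f a" h "c a"]
    by simp
qed (simp add: ip_zero_left)

lemma ip_self: "f \<in> F \<Longrightarrow> ip f f = of_real (Re (ip f f))"
  using arg_cong[OF ip_cnj[of f f], of Im] by (simp add: complex_eq_iff)

lemma ip_self_nonneg: "f \<in> F \<Longrightarrow> 0 \<le> Re (ip f f)"
  using ip_pos[of f] ip_zero_left[of f] by (cases "f = (\<lambda>_. 0)") auto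

lemma ip_norm_nonneg: "f \<in> F \<Longrightarrow> 0 \<le> ip_norm ip f"
  by (simp add: ip_norm_def ip_self_nonneg)

lemma ip_norm_square: "f \<in> F \<Longrightarrow> (ip_norm ip f)\<^sup>2 = Re (ip f f)"
  by (simp add: ip_norm_def ip_self_nonneg)

lemma ip_norm_diff_commute: 
  assumes "f \<in> F" "h \<in> F" shows "ip_norm ip (\<lambda>x. f x - h x) = ip_norm ip (\<lambda>x. h x - f x)"
  using assms by (simp add: ip_norm_def ip_diff_left ip_diff_right diff_mem)

lemma Cauchy_Schwarz:
  assumes f: "f \<in> F" and h: "h \<in> F"
  shows "cmod (ip f h) \<le> ip_norm ip f * ip_norm ip h"
proof (cases "h = (\<lambda>_. 0)")
  case True
  then have "ip f h = 0" using ip_cnj[OF h f] ip_cnj[OF f h] ip_zero_left[OF f] by simp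
  then show ?thesis using ip_norm_nonneg[OF f] ip_norm_nonneg[OF h] by simp
next
  case False
  define n where "n = Re (ip h h)"
  have n: "n > 0" using ip_pos[OF h False] by (simp add: n_def)
  have hh: "ip h h = of_real n" using ip_self[OF h] by (simp add: n_def)
  define c where "c = ip f h / of_real n"
  have hf: "ip h f = cnj (ip f h)" by (rule ip_cnj[OF f h])
  have "0 \<le> Re (ip (\<lambda>x. f x - c * h x) (\<lambda>x. f x - c * h x))"
    by (intro ip_self_nonneg diff_scale_mem f h)
  also have "ip (\<lambda>x. f x - c * h x) (\<lambda>x. f x - c * h x) = ip f f - ip f h * cnj (ip f h) / of_real n"
  proof -
    have "ip (\<lambda>x. f x - c * h x) (\<lambda>x. f x - c * h x) =
        (ip f f - cnj c * ip f h) - c * (cnj (ip f h) - cnj c * of_real n)"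
      by (simp add: ip_diff_scale_left ip_diff_scale_right f h diff_scale_mem hh hf)
    then show ?thesis using n by (simp add: c_def field_simps)
  qed
  also have "ip f h * cnj (ip f h) = of_real ((cmod (ip f h))\<^sup>2)"
    by (simp only: complex_norm_square)
  finally have "(cmod (ip f h))\<^sup>2 / n \<le> Re (ip f f)"
    by (simp add: power2_eq_square)
  then have "(cmod (ip f h))\<^sup>2 \<le> Re (ip f f) * n"
    using n by (simp add: field_simps)
  also have "\<dots> = (ip_norm ip f * ip_norm ip h)\<^sup>2"
    by (simp add: power_mult_distrib ip_norm_square f h n_def)
  finally show ?thesis
    by (rule power2_le_imp_le) (simp add: ip_norm_nonneg f h)
qed

end

locale orthogonal_family = fun_ips F ip
  for F :: "('a \<Rightarrow> complex) set" and ip +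
  fixes e :: "'i::countable \<Rightarrow> 'a \<Rightarrow> complex"
  assumes complete: "fun_hilbert_space F ip"
    and e_mem: "e i \<in> F" and e_nonzero: "e i \<noteq> (\<lambda>_. 0)"
    and e_orth: "i \<noteq> j \<Longrightarrow> ip (e i) (e j) = 0"
begin

definition "sq_norm i = Re (ip (e i) (e i))"

lemma sq_norm_pos: "sq_norm i > 0" unfolding sq_norm_def by (rule ip_pos[OF e_mem e_nonzero])

lemma ip_e: "ip (e i) (e j) = (if i = j then of_real (sq_norm i) else 0)"
  using ip_self[OF e_mem, of i, folded sq_norm_def] e_orth[of i j] by auto

lemma ip_sum_e: "finite A \<Longrightarrow> ip (\<lambda>x. \<Sum>i\<in>A. c i * e i x) (e j) = (if j \<in> A then c j * of_real (sq_norm j) else 0)"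
  by (simp add: ip_sum_left e_mem ip_e if_distrib cong: if_cong)

lemma ip_norm_sum_e:
  assumes A: "finite A"
  shows "Re (ip (\<lambda>x. \<Sum>i\<in>A. c i * e i x) (\<lambda>x. \<Sum>i\<in>A. c i * e i x)) = (\<Sum>i\<in>A. (cmod (c i))\<^sup>2 * sq_norm i)"
proof -
  let ?s = "\<lambda>x. \<Sum>i\<in>A. c i * e i x"
  have s: "?s \<in> F" by (intro sum_mem A e_mem)
  have "ip (e i) ?s = cnj (c i) * of_real (sq_norm i)" if "i \<in> A" for i
    using ip_cnj[OF s e_mem] ip_sum_e[OF A] that by simp
  then have "ip ?s ?s = (\<Sum>i\<in>A. c i * (cnj (c i) * of_real (sq_norm i)))"
    by (simp add: ip_sum_left A e_mem s)
  also have "\<dots> = (\<Sum>i\<in>A. of_real ((cmod (c i))\<^sup>2 * sq_norm i))"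
    by (intro sum.cong refl) (simp only: of_real_mult complex_norm_square mult.assoc)
  finally show ?thesis by simp
qed

lemma Bessel:
  assumes f: "f \<in> F" and A: "finite A"
  shows "(\<Sum>i\<in>A. (cmod (ip f (e i) / of_real (sq_norm i)))\<^sup>2 * sq_norm i) \<le> (ip_norm ip f)\<^sup>2"
proof -
  define c where "c = (\<lambda>i. ip f (e i) / of_real (sq_norm i))"
  let ?s = "\<lambda>x. \<Sum>i\<in>A. c i * e i x"
  have s: "?s \<in> F" by (intro sum_mem A e_mem)
  have ce: "ip f (e i) = c i * of_real (sq_norm i)" for i using sq_norm_pos[of i] by (simp add: c_def)
  have "ip ?s f = (\<Sum>i\<in>A. c i * (cnj (c i) * of_real (sq_norm i)))"
    by (simp add: ip_sum_left A e_mem f ip_cnj[OF f e_mem] ce)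
  also have "\<dots> = (\<Sum>i\<in>A. of_real ((cmod (c i))\<^sup>2 * sq_norm i))"
    by (intro sum.cong refl) (simp only: of_real_mult complex_norm_square mult.assoc)
  finally have sf: "ip ?s f = of_real (\<Sum>i\<in>A. (cmod (c i))\<^sup>2 * sq_norm i)" by simp
  then have fs: "ip f ?s = of_real (\<Sum>i\<in>A. (cmod (c i))\<^sup>2 * sq_norm i)"
    using ip_cnj[OF s f] by simp
  have "0 \<le> Re (ip (\<lambda>x. f x - ?s x) (\<lambda>x. f x - ?s x))"
    by (intro ip_self_nonneg diff_mem f s)
  also have "\<dots> = Re (ip f f) - (\<Sum>i\<in>A. (cmod (c i))\<^sup>2 * sq_norm i)"
    using ip_norm_sum_e[OF A, of c] by (simp add: ip_diff_left ip_diff_right f s diff_mem sf fs)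
  finally show ?thesis using f by (simp add: ip_norm_square c_def)
qed

text \<open>These finite sets increase to the whole index type, which turns sums over the index type
  into limits of sequences.\<close>

definition initial_part :: "nat \<Rightarrow> 'i set" where "initial_part n = {i. to_nat i < n}"

lemma finite_initial_part: "finite (initial_part n)"
  using finite_vimageI[OF finite_lessThan[of n] inj_to_nat] by (simp add: initial_part_def vimage_def lessThan_def)

text \<open>The squared distance of two partial sums is a difference of partial sums of a bounded series
  of nonnegative terms, so completeness applies.\<close>

lemma Riesz_Fischer:
  assumes bound: "\<And>A. finite A \<Longrightarrow> (\<Sum>i\<in>A. (cmod (c i))\<^sup>2 * sq_norm i) \<le> B"
  shows "\<exists>h\<in>F. (\<forall>i. ip h (e i) = c i * of_real (sq_norm i)) \<and>
    (\<lambda>n. ip_norm ip (\<lambda>x. (\<Sum>i\<in>initial_part n. c i * e i x) - h x)) \<longlonglongrightarrow> 0"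
proof -
  define s where "s = (\<lambda>n x. \<Sum>i\<in>initial_part n. c i * e i x)"
  define T where "T = (\<lambda>n. \<Sum>i\<in>initial_part n. (cmod (c i))\<^sup>2 * sq_norm i)"
  have s: "s n \<in> F" for n unfolding s_def by (intro sum_mem finite_initial_part e_mem)
  have part_mono: "initial_part m \<subseteq> initial_part n" if "m \<le> n" for m n using that by (auto simp: initial_part_def)
  have diff: "(ip_norm ip (\<lambda>x. s n x - s m x))\<^sup>2 = T n - T m" if "m \<le> n" for m n
  proof -
    have "(\<lambda>x. s n x - s m x) = (\<lambda>x. \<Sum>i\<in>initial_part n - initial_part m. c i * e i x)"
      unfolding s_def by (auto simp: sum_diff finite_initial_part part_mono[OF that])
    moreover have "T n - T m = (\<Sum>i\<in>initial_part n - initial_part m. (cmod (c i))\<^sup>2 * sq_norm i)"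
      unfolding T_def by (simp add: sum_diff finite_initial_part part_mono[OF that])
    ultimately show ?thesis
      using ip_norm_sum_e[of "initial_part n - initial_part m" c] finite_initial_part
      by (simp add: ip_norm_square sum_mem e_mem)
  qed
  have "incseq T" unfolding incseq_def T_def
    by (auto intro!: sum_mono2 finite_initial_part part_mono mult_nonneg_nonneg less_imp_le[OF sq_norm_pos] dest: subsetD)
  moreover have "bdd_above (range T)" unfolding T_def
    by (intro bdd_aboveI2[where M=B] bound finite_initial_part)
  ultimately have "convergent T"
    by (metis LIMSEQ_incseq_SUP convergentI)
  then have "Cauchy T" by (rule convergent_Cauchy)
  have Cau: "\<exists>N. \<forall>m\<ge>N. \<forall>n\<ge>N. ip_norm ip (\<lambda>x. s m x - s n x) < \<epsilon>" if "\<epsilon> > 0" for \<epsilon>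
  proof -
    obtain N where N: "\<And>m n. m \<ge> N \<Longrightarrow> n \<ge> N \<Longrightarrow> \<bar>T m - T n\<bar> < \<epsilon>\<^sup>2"
      using \<open>Cauchy T\<close> \<open>\<epsilon> > 0\<close> unfolding Cauchy_def dist_real_def by (meson zero_less_power)
    have "ip_norm ip (\<lambda>x. s m x - s n x) < \<epsilon>" if "m \<ge> N" "n \<ge> N" for m n
    proof -
      have "(ip_norm ip (\<lambda>x. s m x - s n x))\<^sup>2 = \<bar>T m - T n\<bar>"
      proof (cases "n \<le> m")
        case True then show ?thesis using diff[OF True] by (metis abs_of_nonneg zero_le_power2)
      next
        case False
        then have "n \<ge> m" by simp
        then show ?thesis using diff[of m n] ip_norm_diff_commute[OF s s, of m n]
          by (metis abs_minus_commute abs_of_nonneg zero_le_power2)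
      qed
      then have "(ip_norm ip (\<lambda>x. s m x - s n x))\<^sup>2 < \<epsilon>\<^sup>2" using N[OF that] by simp
      then show ?thesis using \<open>\<epsilon> > 0\<close> by (simp add: power_less_imp_less_base)
    qed
    then show ?thesis by blast
  qed
  obtain h where h: "h \<in> F" and lim: "(\<lambda>n. ip_norm ip (\<lambda>x. s n x - h x)) \<longlonglongrightarrow> 0"
    using complete[unfolded fun_hilbert_space_def, THEN conjunct2, rule_format, of s, OF s Cau] by blast
  have "ip h (e i) = c i * of_real (sq_norm i)" for i
  proof -
    have "\<forall>\<^sub>F n in sequentially. cmod (c i * of_real (sq_norm i) - ip h (e i)) \<le> ip_norm ip (\<lambda>x. s n x - h x) * ip_norm ip (e i)"
      using eventually_gt_at_top[of "to_nat i"]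
    proof eventually_elim
      case (elim n)
      then have "i \<in> initial_part n" by (simp add: initial_part_def)
      then have "c i * of_real (sq_norm i) - ip h (e i) = ip (\<lambda>x. s n x - h x) (e i)"
        using ip_sum_e[where A="initial_part n" and c=c and j=i] finite_initial_part[of n]
        by (simp add: ip_diff_left[OF s h e_mem]) (simp add: s_def)
      then show ?case using Cauchy_Schwarz[OF diff_mem[OF s h] e_mem] by simp
    qed
    moreover have "(\<lambda>n. ip_norm ip (\<lambda>x. s n x - h x) * ip_norm ip (e i)) \<longlonglongrightarrow> 0 * ip_norm ip (e i)"
      by (intro tendsto_intros lim)
    ultimately have "cmod (c i * of_real (sq_norm i) - ip h (e i)) \<le> 0"
      by (intro tendsto_lowerbound[where F=sequentially]) auto
    then show ?thesis by simp
  qed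
  with h lim show ?thesis unfolding s_def by blast
qed

text \<open>Both parts come from the theorem of Riesz and Fischer. For the coefficients of \<open>f\<close> the
  resulting function has the same coefficients as \<open>f\<close> and hence equals \<open>f\<close> by totality. For
  the values \<open>e i x\<close> the necessary bound is the bound on evaluation at \<open>x\<close>, applied to the
  partial sums of the kernel itself.\<close>

lemma rkhs_and_basis:
  assumes total: "\<And>f. f \<in> F \<Longrightarrow> (\<And>i. ip f (e i) = 0) \<Longrightarrow> f = (\<lambda>_. 0)"
    and eval: "\<And>x. \<exists>C. \<forall>f\<in>F. cmod (f x) \<le> C * ip_norm ip f"
  shows "reproducing_kernel_hilbert_space F ip" and "fun_orthogonal_basis F ip e"
proof -
  define c where "c = (\<lambda>f i. ip f (e i) / of_real (sq_norm i))"
  have expand: "(\<lambda>n. ip_norm ip (\<lambda>x. (\<Sum>i\<in>initial_part n. c f i * e i x) - f x)) \<longlonglongrightarrow> 0" if f: "f \<in> F" for f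
  proof -
    obtain h where h: "h \<in> F" "\<And>i. ip h (e i) = c f i * of_real (sq_norm i)"
      and lim: "(\<lambda>n. ip_norm ip (\<lambda>x. (\<Sum>i\<in>initial_part n. c f i * e i x) - h x)) \<longlonglongrightarrow> 0"
      using Riesz_Fischer[of "c f" "(ip_norm ip f)\<^sup>2", OF Bessel[OF f, folded c_def[THEN fun_cong, THEN fun_cong]]] by blast
    have "(\<lambda>x. f x - h x) = (\<lambda>_. 0)"
    proof (rule total)
      show "ip (\<lambda>x. f x - h x) (e i) = 0" for i
        using sq_norm_pos[of i] by (simp add: ip_diff_left f h e_mem) (simp add: c_def)
    qed (intro diff_mem f h)
    then have "h = f" by (simp add: fun_eq_iff)
    with lim show ?thesis by simp
  qed
  show "fun_orthogonal_basis F ip e"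
    unfolding fun_orthogonal_basis_def
  proof (intro conjI allI impI ballI)
    fix f \<epsilon> assume f: "f \<in> F" and "(0::real) < \<epsilon>"
    then obtain n where "ip_norm ip (\<lambda>x. (\<Sum>i\<in>initial_part n. c f i * e i x) - f x) < \<epsilon>"
      using order_tendstoD(2)[OF expand[OF f]] eventually_happens'[OF sequentially_bot] by blast
    then have "ip_norm ip (\<lambda>x. f x - (\<Sum>i\<in>initial_part n. c f i * e i x)) < \<epsilon>"
      using ip_norm_diff_commute[OF f sum_mem[of "initial_part n" e "c f"]] finite_initial_part e_mem by simp
    then show "\<exists>A c. finite A \<and> ip_norm ip (\<lambda>x. f x - (\<Sum>i\<in>A. c i * e i x)) < \<epsilon>"
      by (intro exI[of _ "initial_part n"] exI[of _ "c f"] conjI finite_initial_part)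
  qed (simp_all add: e_mem e_nonzero e_orth)
  have "\<exists>k\<in>F. \<forall>f\<in>F. f x = ip f k" for x
  proof -
    obtain C where C: "\<And>f. f \<in> F \<Longrightarrow> cmod (f x) \<le> C * ip_norm ip f" using eval by blast
    define d where "d = (\<lambda>i. cnj (e i x) / of_real (sq_norm i))"
    have "(\<Sum>i\<in>A. (cmod (d i))\<^sup>2 * sq_norm i) \<le> C\<^sup>2" if A: "finite A" for A
    proof -
      \<comment> \<open>The partial sum of the kernel has value \<open>S\<close> at \<open>x\<close> and squared norm \<open>S\<close>, so \<open>S \<le> C * sqrt S\<close>.\<close>
      define S where "S = (\<Sum>i\<in>A. (cmod (d i))\<^sup>2 * sq_norm i)"
      let ?s = "\<lambda>x. \<Sum>i\<in>A. d i * e i x"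
      have S0: "S \<ge> 0" unfolding S_def by (intro sum_nonneg mult_nonneg_nonneg less_imp_le[OF sq_norm_pos]) auto
      have sx: "?s x = of_real S"
        unfolding S_def of_real_sum
      proof (intro sum.cong refl)
        fix i
        have "complex_of_real ((cmod (d i))\<^sup>2 * sq_norm i) = d i * (cnj (d i) * of_real (sq_norm i))"
          by (simp only: of_real_mult complex_norm_square mult.assoc)
        then show "d i * e i x = complex_of_real ((cmod (d i))\<^sup>2 * sq_norm i)"
          using sq_norm_pos[of i] by (simp add: d_def)
      qed
      have "(ip_norm ip ?s)\<^sup>2 = S"
        using ip_norm_sum_e[OF A, of d] ip_norm_square[OF sum_mem[OF A e_mem]] by (simp add: S_def)
      then have ns: "ip_norm ip ?s = sqrt S"
        by (rule real_sqrt_unique[symmetric]) (rule ip_norm_nonneg[OF sum_mem[OF A e_mem]])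
      have "cmod (?s x) \<le> C * ip_norm ip ?s"
        by (rule C[OF sum_mem[OF A e_mem]])
      then have "S \<le> C * sqrt S"
        unfolding sx ns using S0 by simp
      then have "sqrt S * sqrt S \<le> C * sqrt S" using S0 by simp
      then have "sqrt S \<le> C \<or> sqrt S = 0" using S0
        using mult_right_le_imp_le[of "sqrt S" "sqrt S" C] real_sqrt_ge_zero[OF S0] by linarith
      then have "sqrt S \<le> \<bar>C\<bar>" by auto
      then have "(sqrt S)\<^sup>2 \<le> \<bar>C\<bar>\<^sup>2" using S0 by (intro power_mono) auto
      then have "S \<le> C\<^sup>2" using S0 by simp
      then show ?thesis by (simp add: S_def)
    qed
    then obtain k where k: "k \<in> F" "\<And>i. ip k (e i) = d i * of_real (sq_norm i)"
      using Riesz_Fischer[of d "C\<^sup>2"] by blast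
    have ek: "ip (e i) k = e i x" for i
      using ip_cnj[OF k(1) e_mem, of i] k(2)[of i] sq_norm_pos[of i] by (simp add: d_def)
    have "f x = ip f k" if f: "f \<in> F" for f
    proof -
      let ?s = "\<lambda>n x. \<Sum>i\<in>initial_part n. c f i * e i x"
      have sm: "?s n \<in> F" for n by (intro sum_mem finite_initial_part e_mem)
      have sk: "ip (?s n) k = ?s n x" for n
        by (simp add: ip_sum_left finite_initial_part e_mem k(1) ek)
      have "cmod (ip f k - f x) \<le> C * ip_norm ip (\<lambda>x. ?s n x - f x) + ip_norm ip (\<lambda>x. ?s n x - f x) * ip_norm ip k" for n
      proof -
        have 1: "cmod (?s n x - f x) \<le> C * ip_norm ip (\<lambda>x. ?s n x - f x)"
          by (rule C[OF diff_mem[OF sm f]])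
        have 2: "cmod (ip (\<lambda>x. ?s n x - f x) k) \<le> ip_norm ip (\<lambda>x. ?s n x - f x) * ip_norm ip k"
          by (rule Cauchy_Schwarz[OF diff_mem[OF sm f] k(1)])
        have "ip f k - f x = (?s n x - f x) - ip (\<lambda>x. ?s n x - f x) k"
          unfolding ip_diff_left[OF sm f k(1)] sk by simp
        then have "cmod (ip f k - f x) \<le> cmod (?s n x - f x) + cmod (ip (\<lambda>x. ?s n x - f x) k)"
          by (simp only: norm_triangle_ineq4)
        with 1 2 show ?thesis by linarith
      qed
      moreover have "(\<lambda>n. C * ip_norm ip (\<lambda>x. ?s n x - f x) + ip_norm ip (\<lambda>x. ?s n x - f x) * ip_norm ip k)
          \<longlonglongrightarrow> C * 0 + 0 * ip_norm ip k"
        by (intro tendsto_intros expand f)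
      ultimately have "cmod (ip f k - f x) \<le> C * 0 + 0 * ip_norm ip k"
        by (intro tendsto_lowerbound[where F=sequentially]) auto
      then show ?thesis by simp
    qed
    with k(1) show ?thesis by blast
  qed
  then obtain K where "\<And>x. K x \<in> F \<and> (\<forall>f\<in>F. f x = ip f (K x))" by metis
  then show "reproducing_kernel_hilbert_space F ip"
    unfolding reproducing_kernel_hilbert_space_def using complete by blast
qed

end

section \<open>Isometries preserve Lebesgue measure\<close>

definition linear_isometry :: "('a::euclidean_space \<Rightarrow> 'b::euclidean_space) \<Rightarrow> bool" where
  "linear_isometry T \<longleftrightarrow> linear T \<and> surj T \<and> (\<forall>x. norm (T x) = norm x)"

lemma linear_isometry_measurable [measurable_dest]:
  "linear_isometry T \<Longrightarrow> T \<in> borel_measurable borel"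
  unfolding linear_isometry_def
  by (intro borel_measurable_continuous_onI linear_continuous_on) (simp add: linear_conv_bounded_linear)

lemma linear_isometry_DIM:
  fixes T :: "'a::euclidean_space \<Rightarrow> 'b::euclidean_space"
  assumes "linear_isometry T"
  shows "DIM('b) = DIM('a)"
proof -
  have lin: "linear T" using assms by (simp add: linear_isometry_def)
  have "inj T"
    unfolding linear_injective_0[OF lin] using assms by (metis linear_isometry_def norm_eq_zero)
  then have "dim (T ` UNIV) = dim (UNIV :: 'a set)"
    by (intro dim_image_eq lin) (auto intro: inj_on_subset)
  then show ?thesis using assms by (simp add: linear_isometry_def)
qed

lemma nn_integral_lborel_translate:
  fixes f :: "'a::euclidean_space \<Rightarrow> ennreal"
  assumes [measurable]: "f \<in> borel_measurable borel"
  shows "(\<integral>\<^sup>+x. f (c + x) \<partial>lborel) = (\<integral>\<^sup>+x. f x \<partial>lborel)"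
  by (subst (2) lborel_distr_plus[of c, symmetric]) (simp add: nn_integral_distr)

lemma nn_integral_lborel_reflect:
  fixes f :: "'a::euclidean_space \<Rightarrow> ennreal"
  assumes [measurable]: "f \<in> borel_measurable borel"
  shows "(\<integral>\<^sup>+x. f (c - x) \<partial>lborel) = (\<integral>\<^sup>+x. f x \<partial>lborel)"
  by (subst (2) lborel_affine[of "-1" c]) (simp_all add: nn_integral_distr nn_integral_density)

lemma integral_lborel_translate:
  fixes f :: "'a::euclidean_space \<Rightarrow> complex"
  assumes f: "integrable lborel f"
  shows "integrable lborel (\<lambda>x. f (c + x))" and "(LINT x|lborel. f (c + x)) = (LINT x|lborel. f x)"
proof -
  have [measurable]: "f \<in> borel_measurable borel" using f by measurable
  show "integrable lborel (\<lambda>x. f (c + x))"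
    using f by (subst (asm) lborel_distr_plus[of c, symmetric]) (simp add: integrable_distr_eq)
  show "(LINT x|lborel. f (c + x)) = (LINT x|lborel. f x)"
    by (subst (2) lborel_distr_plus[of c, symmetric]) (simp add: integral_distr)
qed

text \<open>The image measure \<open>\<mu>\<close> is translation invariant because \<open>T\<close> is linear and surjective. Integrating
  \<open>(x, y) \<mapsto> 1\<^sub>A (x) 1\<^sub>B (x + y)\<close> in both orders against \<open>\<mu>\<close> and Lebesgue measure \<open>\<lambda>\<close> gives
  \<open>\<mu>(A) \<lambda>(B) = \<mu>(B) \<lambda>(A)\<close>, as \<open>\<lambda>\<close> is invariant under reflection. Hence \<open>\<mu>\<close> is a multiple of \<open>\<lambda>\<close>, and both agree on the unit ball.\<close>

lemma lborel_linear_isometry: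
  fixes T :: "'a::euclidean_space \<Rightarrow> 'b::euclidean_space"
  assumes T: "linear_isometry T"
  shows "distr lborel borel T = lborel"
proof (rule measure_eqI)
  have lin: "linear T" and surj: "surj T" and iso: "\<And>x. norm (T x) = norm x"
    using T by (auto simp: linear_isometry_def)
  note [measurable] = linear_isometry_measurable[OF T]
  define \<mu> where "\<mu> = distr lborel borel T"
  have exchange: "emeasure \<mu> A * emeasure lborel B = emeasure \<mu> B * emeasure lborel A"
    if [measurable]: "A \<in> sets borel" "B \<in> sets borel" for A B :: "'b set"
  proof -
    have pre: "(\<integral>\<^sup>+x. indicator C (T x) \<partial>lborel) = emeasure \<mu> C" if "C \<in> sets borel" for C
      using that nn_integral_distr[of T lborel borel "indicator C"] by (simp add: \<mu>_def)
    have "emeasure \<mu> A * emeasure lborel B = (\<integral>\<^sup>+x. indicator A (T x) * emeasure lborel B \<partial>lborel)"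
      by (simp add: nn_integral_multc pre)
    also have "\<dots> = (\<integral>\<^sup>+x. (\<integral>\<^sup>+y. indicator A (T x) * indicator B (T x + y) \<partial>lborel) \<partial>lborel)"
      by (intro nn_integral_cong) (simp add: nn_integral_cmult nn_integral_lborel_translate)
    also have "\<dots> = (\<integral>\<^sup>+y. (\<integral>\<^sup>+x. indicator A (T x) * indicator B (T x + y) \<partial>lborel) \<partial>lborel)"
      by (rule lborel_pair.Fubini'[symmetric]) measurable
    also have "\<dots> = (\<integral>\<^sup>+y. (\<integral>\<^sup>+x. indicator A (T x - y) * indicator B (T x) \<partial>lborel) \<partial>lborel)"
    proof (rule nn_integral_cong)
      fix y
      obtain t where t: "T t = y" using surj by (metis surjD)
      have "(\<integral>\<^sup>+x. indicator A (T x - y) * indicator B (T x) \<partial>lborel)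
          = (\<integral>\<^sup>+x. indicator A (T (t + x) - y) * (indicator B (T (t + x)) :: ennreal) \<partial>lborel)"
        by (rule nn_integral_lborel_translate[symmetric]) measurable
      also have "\<dots> = (\<integral>\<^sup>+x. indicator A (T x) * indicator B (T x + y) \<partial>lborel)"
        by (simp add: linear_add[OF lin] t add.commute)
      finally show "(\<integral>\<^sup>+x. indicator A (T x) * indicator B (T x + y) \<partial>lborel)
          = (\<integral>\<^sup>+x. indicator A (T x - y) * (indicator B (T x)::ennreal) \<partial>lborel)" ..
    qed
    also have "\<dots> = (\<integral>\<^sup>+x. (\<integral>\<^sup>+y. indicator A (T x - y) * indicator B (T x) \<partial>lborel) \<partial>lborel)"
      by (rule lborel_pair.Fubini') measurable
    also have "\<dots> = (\<integral>\<^sup>+x. emeasure lborel A * indicator B (T x) \<partial>lborel)"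
      by (intro nn_integral_cong) (simp add: nn_integral_multc nn_integral_lborel_reflect)
    also have "\<dots> = emeasure \<mu> B * emeasure lborel A"
      by (simp add: nn_integral_cmult pre mult.commute)
    finally show ?thesis .
  qed
  have "T -` ball 0 1 = ball 0 1" by (auto simp: iso)
  then have "emeasure \<mu> (ball 0 1) = emeasure lborel (ball 0 1 :: 'a set)"
    by (simp add: \<mu>_def emeasure_distr)
  also have "\<dots> = emeasure lborel (ball 0 1 :: 'b set)"
    by (simp add: emeasure_ball linear_isometry_DIM[OF T])
  finally have ball: "emeasure \<mu> (ball 0 1) = emeasure lborel (ball 0 1 :: 'b set)" .
  fix A assume "A \<in> sets (distr lborel borel T)"
  then have "emeasure \<mu> A * emeasure lborel (ball 0 1 :: 'b set) = emeasure lborel A * emeasure lborel (ball 0 1 :: 'b set)"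
    using exchange[of A "ball 0 1"] by (simp add: ball mult.commute)
  moreover have "unit_ball_vol (real DIM('b)) > 0" by simp
  ultimately show "emeasure (distr lborel borel T) A = emeasure lborel A"
    unfolding \<mu>_def[symmetric] by (simp add: emeasure_ball mult_right_ennreal_cancel)
qed simp

lemma nn_integral_linear_isometry:
  assumes T: "linear_isometry T" and [measurable]: "f \<in> borel_measurable borel"
  shows "(\<integral>\<^sup>+x. f (T x) \<partial>lborel) = (\<integral>\<^sup>+x. f x \<partial>lborel)"
proof -
  note [measurable] = linear_isometry_measurable[OF T]
  show ?thesis
    by (subst lborel_linear_isometry[OF T, symmetric]) (simp add: nn_integral_distr)
qed

lemma integrable_linear_isometry:
  fixes f :: "'b::euclidean_space \<Rightarrow> complex"
  assumes T: "linear_isometry T" and f: "integrable lborel f"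
  shows "integrable lborel (\<lambda>x. f (T x))" 
    and "(LINT x|lborel. f (T x)) = (LINT x|lborel. f x)"
proof -
  note [measurable] = linear_isometry_measurable[OF T]
  have [measurable]: "f \<in> borel_measurable borel" using f by measurable
  show "integrable lborel (\<lambda>x. f (T x))"
    using f by (subst (asm) lborel_linear_isometry[OF T, symmetric]) (simp add: integrable_distr_eq)
  show "(LINT x|lborel. f (T x)) = (LINT x|lborel. f x)"
    by (subst lborel_linear_isometry[OF T, symmetric]) (simp add: integral_distr)
qed

text \<open>Averaging over a family of measure preserving maps does not change an integral. With
  rotations as \<open>R\<close> and a holomorphic factor in \<open>F\<close>, the average is given by the mean value property.\<close>

lemma integral_average_isometries:
  fixes F :: "'a::euclidean_space \<Rightarrow> complex"
  assumes F: "integrable lborel F"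
    and R: "\<And>t. linear_isometry (R t)"
    and R_meas: "(\<lambda>(t, x). R t x) \<in> borel \<Otimes>\<^sub>M borel \<rightarrow>\<^sub>M borel"
    and avg: "\<And>x. (LINT t:{0..1::real}|lborel. F (R t x)) = c x"
  shows "integrable lborel c" and "(LINT x|lborel. c x) = (LINT x|lborel. F x)"
proof -
  have [measurable]: "F \<in> borel_measurable borel" using F by measurable
  note [measurable] = R_meas
  define G where "G = (\<lambda>t x. indicat_real {0..1::real} t *\<^sub>R F (R t x))"
  have [measurable]: "case_prod G \<in> borel_measurable (lborel \<Otimes>\<^sub>M lborel)"
    unfolding G_def by measurable
  have int: "integrable (lborel \<Otimes>\<^sub>M lborel) (case_prod G)"
    unfolding integrable_iff_bounded
  proof
    have "(\<integral>\<^sup>+p. ennreal (norm (case_prod G p)) \<partial>(lborel \<Otimes>\<^sub>M lborel))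
        = (\<integral>\<^sup>+t. (\<integral>\<^sup>+x. ennreal (norm (G t x)) \<partial>lborel) \<partial>lborel)"
      by (subst lborel.nn_integral_fst[symmetric]) auto
    also have "\<dots> = (\<integral>\<^sup>+t. indicator {0..1::real} t * (\<integral>\<^sup>+x. ennreal (norm (F x)) \<partial>lborel) \<partial>lborel)"
    proof (intro nn_integral_cong)
      fix t :: real
      have "(\<integral>\<^sup>+x. ennreal (norm (G t x)) \<partial>lborel) = (\<integral>\<^sup>+x. indicator {0..1} t * ennreal (norm (F (R t x))) \<partial>lborel)"
        by (intro nn_integral_cong) (simp add: G_def indicator_def)
      also have "\<dots> = indicator {0..1} t * (\<integral>\<^sup>+x. ennreal (norm (F (R t x))) \<partial>lborel)"
        using linear_isometry_measurable[OF R[of t]] by (intro nn_integral_cmult) measurable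
      also have "(\<integral>\<^sup>+x. ennreal (norm (F (R t x))) \<partial>lborel) = (\<integral>\<^sup>+x. ennreal (norm (F x)) \<partial>lborel)"
        by (rule nn_integral_linear_isometry[OF R]) measurable
      finally show "(\<integral>\<^sup>+x. ennreal (norm (G t x)) \<partial>lborel) = indicator {0..1} t * (\<integral>\<^sup>+x. ennreal (norm (F x)) \<partial>lborel)" .
    qed
    also have "\<dots> < \<infinity>"
      using F unfolding integrable_iff_bounded by (simp add: nn_integral_multc)
    finally show "(\<integral>\<^sup>+p. ennreal (norm (case_prod G p)) \<partial>(lborel \<Otimes>\<^sub>M lborel)) < \<infinity>" .
  qed measurable
  have c: "c = (\<lambda>x. LINT t|lborel. G t x)"
    using avg by (auto simp: G_def set_lebesgue_integral_def)
  show "integrable lborel c" unfolding c by (rule lborel_pair.integrable_snd[OF int])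
  have "(LINT x|lborel. c x) = (LINT t|lborel. (LINT x|lborel. G t x))"
    unfolding c by (rule lborel_pair.Fubini_integral[OF int])
  also have "\<dots> = (LINT x|lborel. F x)"
    by (simp add: G_def integrable_linear_isometry(2)[OF R F])
  finally show "(LINT x|lborel. c x) = (LINT x|lborel. F x)" .
qed

text \<open>An isometry that separates the periodic real direction of the first coordinate from the rest.\<close>

definition slice :: "real \<times> (real \<times> 'w) \<Rightarrow> complex \<times> 'w" where
  "slice = (\<lambda>(x, y, w). (Complex x y, w))"

lemma linear_isometry_slice: "linear_isometry (slice :: _ \<Rightarrow> complex \<times> 'w::euclidean_space)"
  unfolding linear_isometry_def
proof (intro conjI allI)
  show "linear (slice :: _ \<Rightarrow> complex \<times> 'w)"
    by (intro linearI) (auto simp: slice_def complex_eq_iff)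
  show "surj (slice :: _ \<Rightarrow> complex \<times> 'w)"
    unfolding surj_def slice_def by (metis complex_surj old.prod.case surj_pair)
  show "norm (slice x) = norm x" for x :: "real \<times> real \<times> 'w"
    by (cases x) (simp add: slice_def norm_prod_def complex_norm)
qed

lemma integral_slice:
  fixes F :: "complex \<times> 'w::euclidean_space \<Rightarrow> complex"
  assumes F: "integrable lborel F"
    and c: "\<And>y w. (LINT x|lborel. F (Complex x y, w)) = c (y, w)"
  shows "integrable lborel c" and "(LINT p|lborel. F p) = (LINT q|lborel. c q)"
proof -
  have int: "integrable (lborel \<Otimes>\<^sub>M lborel) (case_prod (\<lambda>x q. F (slice (x, q))))"
    using integrable_linear_isometry(1)[OF linear_isometry_slice F] by (simp add: lborel_prod split_beta')
  have c': "c = (\<lambda>q. LINT x|lborel. F (slice (x, q)))"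
    by (auto simp: c slice_def split: prod.split)
  show "integrable lborel c" unfolding c' by (rule lborel_pair.integrable_snd[OF int])
  have "(LINT p|lborel. F p) = (LINT p|(lborel \<Otimes>\<^sub>M lborel). F (slice p))"
    by (simp add: lborel_prod integrable_linear_isometry(2)[OF linear_isometry_slice F])
  also have "\<dots> = (LINT q|lborel. c q)"
    unfolding c' by (subst lborel_pair.integral_snd[OF int]) (simp add: split_beta')
  finally show "(LINT p|lborel. F p) = (LINT q|lborel. c q)" .
qed

lemma nn_integral_slice:
  fixes F :: "complex \<times> 'w::euclidean_space \<Rightarrow> ennreal"
  assumes F[measurable]: "F \<in> borel_measurable borel"
  shows "(\<integral>\<^sup>+p. F p \<partial>lborel) = (\<integral>\<^sup>+x. \<integral>\<^sup>+y. \<integral>\<^sup>+w. F (Complex x y, w) \<partial>lborel \<partial>lborel \<partial>lborel)"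
proof -
  note [measurable] = linear_isometry_measurable[OF linear_isometry_slice[where ?'w = 'w]]
  have "(\<integral>\<^sup>+p. F p \<partial>lborel) = (\<integral>\<^sup>+p. F (slice p) \<partial>lborel)"
    by (simp add: nn_integral_linear_isometry[OF linear_isometry_slice])
  also have "\<dots> = (\<integral>\<^sup>+x. \<integral>\<^sup>+q. F (slice (x, q)) \<partial>lborel \<partial>lborel)"
    by (subst lborel_prod[symmetric], subst lborel.nn_integral_fst) (simp_all add: lborel_prod)
  also have "\<dots> = (\<integral>\<^sup>+x. \<integral>\<^sup>+y. \<integral>\<^sup>+w. F (slice (x, y, w)) \<partial>lborel \<partial>lborel \<partial>lborel)"
    by (rule nn_integral_cong, subst lborel_prod[symmetric], subst lborel.nn_integral_fst) (simp_all add: lborel_prod)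
  finally show ?thesis by (simp add: slice_def)
qed

section \<open>Entire and periodic functions of one variable\<close>

lemma set_lebesgue_integral_continuous:
  fixes f :: "real \<Rightarrow> complex"
  assumes "continuous_on {a..b} f" "(f has_integral I) {a..b}"
  shows "(LINT x:{a..b}|lborel. f x) = I"
  using set_borel_integral_eq_integral(2)[OF borel_integrable_atLeastAtMost'[OF assms(1)]] assms(2)
  by (simp add: integral_unique)

lemma continuous_on_circle_compose:
  fixes p :: "complex \<Rightarrow> 'a::topological_space"
  assumes "\<And>w. isCont p w"
  shows "continuous_on A (\<lambda>x. p (cis (2 * pi * x)))"
proof (rule continuous_on_compose2[where t=UNIV and g=p and f="\<lambda>x. cis (2 * pi * x)"])
  show "continuous_on UNIV p" using assms by (simp add: continuous_on_eq_continuous_at)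
  show "continuous_on A (\<lambda>x. cis (2 * pi * x))" by (intro continuous_intros)
qed auto

text \<open>Cauchy's integral formula at the centre of the unit circle.\<close>

lemma circle_mean_entire:
  assumes f: "f holomorphic_on UNIV"
  shows "(LINT t:{0..1}|lborel. f (cis (2 * pi * t))) = f 0"
proof (rule set_lebesgue_integral_continuous)
  have cont: "continuous_on UNIV f" by (rule holomorphic_on_imp_continuous_on[OF f])
  show "continuous_on {0..1} (\<lambda>t. f (cis (2 * pi * t)))"
    by (intro continuous_on_compose2[OF cont] continuous_intros) auto
  have e: "cis (2 * pi * x) = exp (2 * of_real pi * \<i> * of_real x)" for x
    by (simp add: cis_conv_exp mult_ac)
  have "((\<lambda>u. f u / (u - 0)) has_contour_integral 2 * complex_of_real pi * \<i> * f 0) (circlepath 0 1)"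
    by (rule Cauchy_integral_circlepath_simple) (auto intro: holomorphic_on_subset[OF f])
  then have "((\<lambda>x. f (cis (2 * pi * x)) / cis (2 * pi * x) * (2 * pi * \<i> * cis (2 * pi * x))) has_integral
      2 * complex_of_real pi * \<i> * f 0) {0..1}"
    unfolding has_contour_integral_def
  proof (rule has_integral_eq[rotated])
    fix x :: real assume x: "x \<in> {0..1}"
    have "circlepath 0 1 x = cis (2 * pi * x)"
      by (simp add: circlepath e)
    moreover have "vector_derivative (circlepath 0 1) (at x within {0..1}) = 2 * pi * \<i> * cis (2 * pi * x)"
      using vector_derivative_circlepath01[of x 0 1] x by (simp add: e)
    ultimately show "f (circlepath 0 1 x) / (circlepath 0 1 x - 0) * vector_derivative (circlepath 0 1) (at x within {0..1}) =
        f (cis (2 * pi * x)) / cis (2 * pi * x) * (2 * pi * \<i> * cis (2 * pi * x))"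
      by simp
  qed
  then have "((\<lambda>x. (2 * complex_of_real pi * \<i>) * f (cis (2 * pi * x))) has_integral (2 * complex_of_real pi * \<i>) * f 0) {0..1}"
    by (rule has_integral_eq[rotated]) (simp add: field_simps)
  then show "((\<lambda>t. f (cis (2 * pi * t))) has_integral f 0) {0..1}"
    by (subst (asm) has_integral_mult_right_iff) auto
qed

text \<open>For a primitive \<open>g\<close> of \<open>h\<close> the difference \<open>g (z + 1) - g z\<close> has derivative zero, and its constant
  value is the integral of \<open>h\<close> over every horizontal segment of length 1.\<close>

lemma periodic_entire_segment_integral:
  assumes h: "h holomorphic_on UNIV" and per: "\<And>z. h (z + 1) = h z"
  shows "\<exists>c. \<forall>y. (LINT x:{0..1}|lborel. h (Complex x y)) = c"
proof -
  have cont: "continuous_on UNIV h" by (rule holomorphic_on_imp_continuous_on[OF h])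
  obtain g where g: "\<And>z. (g has_field_derivative h z) (at z)"
    using holomorphic_convex_primitive'[OF _ _ h] by auto
  have "\<exists>c. \<forall>z\<in>UNIV. g (z + 1) - g z = c"
  proof (rule has_field_derivative_zero_constant)
    fix z
    have "((\<lambda>z. g (z + 1) - g z) has_field_derivative h (z + 1) * (1 + 0) - h z) (at z)"
      by (intro DERIV_diff g DERIV_chain2[OF g] DERIV_add DERIV_ident DERIV_const)
    then show "((\<lambda>z. g (z + 1) - g z) has_field_derivative 0) (at z)" by (simp add: per)
  qed auto
  then obtain c where c: "\<And>z. g (z + 1) - g z = c" by auto
  have "(LINT x:{0..1}|lborel. h (Complex x y)) = c" for y
  proof (rule set_lebesgue_integral_continuous)
    have Cx: "Complex x y = of_real x + \<i> * of_real y" for x by (simp add: complex_eq_iff)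
    show "continuous_on {0..1} (\<lambda>x. h (Complex x y))"
      unfolding Cx by (intro continuous_on_compose2[OF cont] continuous_intros) auto
    have "((\<lambda>x. h (Complex x y)) has_integral g (Complex 1 y) - g (Complex 0 y)) {0..1}"
    proof (rule fundamental_theorem_of_calculus)
      fix x :: real
      have "((\<lambda>x. Complex x y) has_vector_derivative 1) (at x)"
        unfolding Cx by (auto intro!: derivative_eq_intros)
      from field_vector_diff_chain_at[OF this g]
      show "((\<lambda>x. g (Complex x y)) has_vector_derivative h (Complex x y)) (at x within {0..1})"
        by (simp add: o_def has_vector_derivative_at_within)
    qed simp
    moreover have "Complex 1 y = Complex 0 y + 1" by (simp add: complex_eq_iff)
    ultimately show "((\<lambda>x. h (Complex x y)) has_integral c) {0..1}" using c by metis
  qed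
  then show ?thesis by blast
qed

lemma integral_cmod_square_eq_0D:
  fixes f :: "real \<Rightarrow> complex"
  assumes cont: "continuous_on UNIV f" and int: "(LINT x:{0..1}|lborel. f x * cnj (f x)) = 0" and x: "x \<in> {0..1}"
  shows "f x = 0"
proof -
  have cf: "continuous_on {0..1} (\<lambda>x. (cmod (f x))\<^sup>2)"
    by (intro continuous_intros continuous_on_subset[OF cont]) auto
  have "((\<lambda>x. (cmod (f x))\<^sup>2) has_integral integral {0..1} (\<lambda>x. (cmod (f x))\<^sup>2)) {0..1}"
    by (intro integrable_integral integrable_continuous_interval cf)
  from has_integral_of_real[OF this, where 'b=complex]
  have "((\<lambda>x. f x * cnj (f x)) has_integral of_real (integral {0..1} (\<lambda>x. (cmod (f x))\<^sup>2))) {0..1}"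
    by (simp only: complex_norm_square)
  then have "(LINT x:{0..1}|lborel. f x * cnj (f x)) = of_real (integral {0..1} (\<lambda>x. (cmod (f x))\<^sup>2))"
    by (intro set_lebesgue_integral_continuous continuous_intros continuous_on_subset[OF cont]) auto
  then have "integral {0..1} (\<lambda>x. (cmod (f x))\<^sup>2) = 0" using int by simp
  then have "(cmod (f x))\<^sup>2 = 0"
    using integral_eq_0_iff[OF cf] x by auto
  then show ?thesis by simp
qed

text \<open>The function on the circle is \<open>w \<mapsto> \<phi> (Arg w / 2 \<pi>)\<close>. On the branch cut its continuity is seen
  from \<open>w \<mapsto> \<phi> ((Arg (- w) + \<pi>) / 2 \<pi>)\<close>, which is the same function by periodicity.\<close>

lemma periodic_function_through_circle:
  fixes \<phi> :: "real \<Rightarrow> complex"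
  assumes cont: "continuous_on UNIV \<phi>" and per: "\<And>x. \<phi> (x + 1) = \<phi> x"
  obtains \<Phi> where "continuous_on (sphere 0 1) \<Phi>" "\<And>x. \<Phi> (cis (2 * pi * x)) = \<phi> x"
proof
  have per_nat: "\<phi> (x + real n) = \<phi> x" for x n
  proof (induction n)
    case (Suc n)
    then show ?case using per[of "x + real n"] by (simp add: ac_simps)
  qed simp
  have per_int: "\<phi> (x + of_int n) = \<phi> x" for x n
  proof (cases "n \<ge> 0")
    case True then show ?thesis using per_nat[of x "nat n"] by simp
  next
    case False then show ?thesis using per_nat[of "x + of_int n" "nat (-n)"] by simp
  qed
  have eq: "\<phi> (a / (2 * pi)) = \<phi> (b / (2 * pi))" if "cis a = cis b" for a b
  proof -
    have "sin a = sin b \<and> cos a = cos b"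
      using arg_cong[OF that, of Re] arg_cong[OF that, of Im] by simp
    then obtain n :: int where "a = b + 2 * pi * n" using sin_cos_eq_iff by auto
    then have "a / (2 * pi) = b / (2 * pi) + of_int n" by (simp add: field_simps)
    then show ?thesis using per_int by simp
  qed
  define \<Phi> where "\<Phi> = (\<lambda>w. \<phi> (Arg w / (2 * pi)))"
  have contA: "isCont (\<lambda>w. \<phi> (g w / (2 * pi))) w" if "isCont g w" for g :: "complex \<Rightarrow> real" and w
  proof -
    have "isCont \<phi> z" for z using cont by (simp add: continuous_on_eq_continuous_at)
    moreover have "isCont (\<lambda>w. g w / (2 * pi)) w" by (intro continuous_intros that) auto
    ultimately show ?thesis using isCont_o2[where g=\<phi> and f="\<lambda>w. g w / (2 * pi)"] by simp
  qed
  have "isCont \<Phi> w" if "w \<noteq> 0" for w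
  proof (cases "w \<in> \<real>\<^sub>\<le>\<^sub>0")
    case False
    then show ?thesis unfolding \<Phi>_def by (intro contA continuous_at_Arg)
  next
    case True
    then have "- w \<notin> \<real>\<^sub>\<le>\<^sub>0" using that by (auto simp: complex_nonpos_Reals_iff complex_eq_iff)
    then have "isCont (\<lambda>v. Arg (- v)) w"
      using isCont_o2[where g=Arg and f=uminus, of w] continuous_at_Arg[of "- w"] by simp
    then have "isCont (\<lambda>v. \<phi> ((Arg (- v) + pi) / (2 * pi))) w"
      by (intro contA continuous_intros)
    moreover have "\<forall>\<^sub>F v in nhds w. \<phi> ((Arg (- v) + pi) / (2 * pi)) = \<Phi> v"
      using t1_space_nhds[OF that]
    proof eventually_elim
      case (elim v)
      have "cis (Arg (- v) + pi) = cis (Arg v)"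
        using elim by (simp add: cis_mult[symmetric] cis_Arg sgn_minus)
      then show ?case unfolding \<Phi>_def by (rule eq)
    qed
    ultimately show ?thesis by (simp add: isCont_cong)
  qed
  then show "continuous_on (sphere 0 1) \<Phi>"
    by (intro continuous_at_imp_continuous_on ballI) (metis mem_sphere_0 norm_zero zero_neq_one)
  show "\<Phi> (cis (2 * pi * x)) = \<phi> x" for x
  proof -
    have "cis (Arg (cis (2 * pi * x))) = cis (2 * pi * x)" by (simp add: cis_Arg sgn_div_norm)
    from eq[OF this] show ?thesis by (simp add: \<Phi>_def)
  qed
qed

lemma bounded_linear_on_circle:
  fixes f :: "complex \<Rightarrow> real"
  assumes "bounded_linear f"
  shows "of_real (f (cis \<theta>)) = Complex (f 1 / 2) (- f \<i> / 2) * cis \<theta> + Complex (f 1 / 2) (f \<i> / 2) * cis (- \<theta>)"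
proof -
  interpret bounded_linear f by fact
  have "cis \<theta> = cos \<theta> *\<^sub>R 1 + sin \<theta> *\<^sub>R \<i>" by (simp add: complex_eq_iff)
  then have "f (cis \<theta>) = cos \<theta> * f 1 + sin \<theta> * f \<i>" by (simp add: add scaleR)
  then show ?thesis by (simp add: complex_eq_iff field_simps)
qed

text \<open>The functions with vanishing Fourier coefficients are stable under multiplication by
  \<open>cis (\<plusminus> 2 \<pi> x)\<close>, which shifts the coefficients; hence under multiplication by every polynomial
  in the coordinates of the circle. Quantifying over \<open>\<psi>\<close> makes the product case of the induction
  immediate.\<close>

lemma Fourier_coefficients_mult_polynomial:
  assumes p: "real_polynomial_function (p :: complex \<Rightarrow> real)"
    and cont: "continuous_on UNIV (\<psi> :: real \<Rightarrow> complex)"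
    and zero: "\<And>n::int. (LINT x:{0..1}|lborel. \<psi> x * cis (2 * pi * n * x)) = 0"
  shows "(LINT x:{0..1}|lborel. \<psi> x * of_real (p (cis (2 * pi * x))) * cis (2 * pi * of_int n * x)) = 0"
  using p cont zero
proof (induction p arbitrary: \<psi> n rule: real_polynomial_function.induct)
  case (linear f)
  define A B where "A = Complex (f 1 / 2) (- f \<i> / 2)" and "B = Complex (f 1 / 2) (f \<i> / 2)"
  have eq: "\<psi> x * of_real (f (cis (2 * pi * x))) * cis (2 * pi * of_int n * x) =
      A * (\<psi> x * cis (2 * pi * of_int (n + 1) * x)) + B * (\<psi> x * cis (2 * pi * of_int (n - 1) * x))" for x
  proof -
    have "cis (2 * pi * of_int (n + 1) * x) = cis (2 * pi * x) * cis (2 * pi * of_int n * x)"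
      "cis (2 * pi * of_int (n - 1) * x) = cis (- (2 * pi * x)) * cis (2 * pi * of_int n * x)"
      by (simp_all add: cis_mult algebra_simps)
    then show ?thesis unfolding bounded_linear_on_circle[OF linear(1)] A_def[symmetric] B_def[symmetric]
      by (simp add: algebra_simps)
  qed
  have int: "set_integrable lborel {0..1} (\<lambda>x. \<psi> x * cis (2 * pi * of_int k * x))" for k
    by (intro borel_integrable_atLeastAtMost' continuous_intros continuous_on_subset[OF linear(2)]) auto
  show ?case unfolding eq by (subst set_integral_add) (auto intro!: set_integrable_mult_right int simp: linear(3) simp del: of_int_add of_int_diff)
next
  case (const c)
  have "\<psi> x * of_real c * cis (2 * pi * of_int n * x) = of_real c * (\<psi> x * cis (2 * pi * of_int n * x))" for x
    by simp
  then show ?case using const by (simp only: set_integral_mult_right mult_zero_right)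
next
  case (add f g)
  have contp: "continuous_on {0..1} (\<lambda>x. p (cis (2 * pi * x)))" if "real_polynomial_function p" for p
    by (intro continuous_on_circle_compose continuous_real_polymonial_function that)
  have int: "set_integrable lborel {0..1} (\<lambda>x. \<psi> x * of_real (p (cis (2 * pi * x))) * cis (2 * pi * of_int n * x))"
    if "real_polynomial_function p" for p
    by (intro borel_integrable_atLeastAtMost' continuous_intros contp that continuous_on_subset[OF add.prems(1)]) auto
  have "(LINT x:{0..1}|lborel. \<psi> x * of_real (f (cis (2 * pi * x))) * cis (2 * pi * of_int n * x) +
      \<psi> x * of_real (g (cis (2 * pi * x))) * cis (2 * pi * of_int n * x)) = 0"
    by (subst set_integral_add) (auto intro!: int add.hyps simp: add.IH[OF add.prems])
  then show ?case by (simp add: algebra_simps)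
next
  case (mult f g)
  have contf: "continuous_on UNIV (\<lambda>x. f (cis (2 * pi * x)))"
    by (intro continuous_on_circle_compose continuous_real_polymonial_function mult.hyps)
  have "(LINT x:{0..1}|lborel. (\<psi> x * of_real (f (cis (2 * pi * x)))) * of_real (g (cis (2 * pi * x))) * cis (2 * pi * of_int n * x)) = 0"
    by (rule mult.IH(2)) (auto intro!: continuous_intros contf mult.prems(1) mult.IH(1) mult.prems(2))
  then show ?case by (simp add: mult.assoc)
qed

text \<open>By the theorem of Stone and Weierstrass, \<open>\<phi>\<close> is a uniform limit of polynomials on the circle. As
  \<open>\<phi>\<close> is orthogonal to these, it is orthogonal to itself.\<close>

lemma Fourier_coefficients_zero:
  fixes \<phi> :: "real \<Rightarrow> complex"
  assumes cont: "continuous_on UNIV \<phi>" and per: "\<And>x. \<phi> (x + 1) = \<phi> x"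
    and zero: "\<And>n::int. (LINT x:{0..1}|lborel. \<phi> x * cis (2 * pi * n * x)) = 0"
  shows "\<phi> x = 0"
proof -
  obtain \<Phi> where \<Phi>: "continuous_on (sphere 0 1) \<Phi>" and \<Phi>_eq: "\<And>x. \<Phi> (cis (2 * pi * x)) = \<phi> x"
    using periodic_function_through_circle[OF cont per] by blast
  define J where "J = (LINT x:{0..1}|lborel. \<phi> x * cnj (\<phi> x))"
  have "bounded (\<phi> ` {0..1})"
    by (intro compact_imp_bounded compact_continuous_image continuous_on_subset[OF cont]) auto
  then obtain M where M: "\<And>x. x \<in> {0..1} \<Longrightarrow> cmod (\<phi> x) \<le> M" "M > 0"
    unfolding bounded_pos by (auto simp del: atLeastAtMost_iff)
  have "cmod J \<le> M * e" if "e > 0" for e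
  proof -
    obtain g where g: "polynomial_function g" "\<And>w. w \<in> sphere 0 1 \<Longrightarrow> cmod (\<Phi> w - g w) < e"
      using Stone_Weierstrass_polynomial_function[OF compact_sphere \<Phi> \<open>e > 0\<close>] by blast
    define G where "G = (\<lambda>x. g (cis (2 * pi * x)))"
    have contG: "continuous_on A G" for A unfolding G_def
      by (intro continuous_on_circle_compose continuous_polymonial_function g(1))
    have Gi: "cnj (G x) = of_real (Re (g (cis (2 * pi * x)))) - \<i> * of_real (Im (g (cis (2 * pi * x))))" for x
      by (simp add: G_def complex_eq_iff)
    have re: "real_polynomial_function (\<lambda>w. Re (g w))" and im: "real_polynomial_function (\<lambda>w. Im (g w))"
      using g(1) bounded_linear_Re bounded_linear_Im unfolding polynomial_function_def o_def by blast+
    have contRe: "continuous_on {0..1} (\<lambda>x. Re (g (cis (2 * pi * x))))" "continuous_on {0..1} (\<lambda>x. Im (g (cis (2 * pi * x))))"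
      using contG unfolding G_def by (auto intro: continuous_intros)
    have "(LINT x:{0..1}|lborel. \<phi> x * cnj (G x)) =
       (LINT x:{0..1}|lborel. \<phi> x * of_real (Re (g (cis (2 * pi * x)))) * cis (2 * pi * of_int 0 * x)
         - \<i> * (\<phi> x * of_real (Im (g (cis (2 * pi * x)))) * cis (2 * pi * of_int 0 * x)))"
      by (simp add: Gi algebra_simps)
    also have "\<dots> = (LINT x:{0..1}|lborel. \<phi> x * of_real (Re (g (cis (2 * pi * x)))) * cis (2 * pi * of_int 0 * x))
         - (LINT x:{0..1}|lborel. \<i> * (\<phi> x * of_real (Im (g (cis (2 * pi * x)))) * cis (2 * pi * of_int 0 * x)))"
      by (intro set_integral_diff borel_integrable_atLeastAtMost' continuous_intros contRe continuous_on_subset[OF cont]) auto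
    also have "\<dots> = 0"
      unfolding set_integral_mult_right
        Fourier_coefficients_mult_polynomial[OF re cont zero] Fourier_coefficients_mult_polynomial[OF im cont zero] by simp
    finally have 0: "(LINT x:{0..1}|lborel. \<phi> x * cnj (G x)) = 0" .
    have cont_diff: "continuous_on {0..1} (\<lambda>x. \<phi> x * cnj (\<phi> x - G x))"
      by (intro continuous_intros contG continuous_on_subset[OF cont]) auto
    have "J = (LINT x:{0..1}|lborel. \<phi> x * cnj (\<phi> x)) - (LINT x:{0..1}|lborel. \<phi> x * cnj (G x))"
      by (simp add: J_def 0)
    also have "\<dots> = (LINT x:{0..1}|lborel. \<phi> x * cnj (\<phi> x) - \<phi> x * cnj (G x))"
      by (intro set_integral_diff(2)[symmetric] borel_integrable_atLeastAtMost' continuous_intros contG continuous_on_subset[OF cont]) auto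
    also have "\<dots> = (LINT x:{0..1}|lborel. \<phi> x * cnj (\<phi> x - G x))"
      by (simp add: algebra_simps)
    also have "\<dots> = integral {0..1} (\<lambda>x. \<phi> x * cnj (\<phi> x - G x))"
      by (rule set_borel_integral_eq_integral(2)[OF borel_integrable_atLeastAtMost'[OF cont_diff]])
    also have "cmod \<dots> \<le> integral {0..1} (\<lambda>x::real. M * e)"
    proof (rule integral_norm_bound_integral)
      fix x :: real assume x: "x \<in> {0..1}"
      have "cmod (\<phi> x - G x) \<le> e" using g(2)[of "cis (2 * pi * x)"] by (simp add: G_def \<Phi>_eq)
      then show "cmod (\<phi> x * cnj (\<phi> x - G x)) \<le> M * e"
        using M(1)[OF x] M(2) by (simp only: norm_mult complex_mod_cnj) (intro mult_mono, auto)
    qed (intro integrable_continuous_interval cont_diff continuous_on_const)+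
    finally show ?thesis by simp
  qed
  from this[of "_ / M"] have "cmod J \<le> 0 + \<epsilon>" if "\<epsilon> > 0" for \<epsilon> using that M(2) by simp
  then have "cmod J \<le> 0" by (rule field_le_epsilon)
  then have "(LINT x:{0..1}|lborel. \<phi> x * cnj (\<phi> x)) = 0" by (simp add: J_def)
  then have "\<phi> (frac x) = 0"
    using frac_ge_0[of x] less_imp_le[OF frac_lt_1[of x]] by (intro integral_cmod_square_eq_0D[OF cont]) auto
  moreover have "cis (2 * pi * x) = cis (2 * pi * frac x)"
  proof -
    have "2 * pi * x = 2 * pi * frac x + 2 * pi * of_int \<lfloor>x\<rfloor>" by (simp add: frac_def algebra_simps)
    then show ?thesis by (simp only: cis_mult[symmetric] cis_multiple_2pi[OF Ints_of_int] mult_1_right)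
  qed
  then have "\<phi> x = \<phi> (frac x)" by (metis \<Phi>_eq)
  ultimately show ?thesis by simp
qed

lemma circle_character_integral:
  fixes j :: int
  assumes "j \<noteq> 0"
  shows "(LINT x:{0..1}|lborel. cis (2 * pi * of_int j * x)) = 0"
proof -
  have pos: "(LINT x:{0..1}|lborel. cis (2 * pi * of_nat k * x)) = 0" if "k > 0" for k :: nat
  proof -
    have "(LINT x:{0..1}|lborel. cis (2 * pi * x) ^ k) = 0 ^ k"
      by (rule circle_mean_entire) (intro holomorphic_intros)
    then show ?thesis using that by (simp add: Complex.DeMoivre mult_ac)
  qed
  show ?thesis
  proof (cases "j > 0")
    case True
    then show ?thesis using pos[of "nat j"] by simp
  next
    case False
    have "(LINT x:{0..1}|lborel. cis (2 * pi * of_int j * x)) = (LINT x|lborel. cnj (indicat_real {0..1} x *\<^sub>R cis (2 * pi * of_nat (nat (- j)) * x)))"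
      unfolding set_lebesgue_integral_def using False
      by (intro Bochner_Integration.integral_cong refl) (simp add: cis_cnj)
    also have "\<dots> = cnj (LINT x:{0..1}|lborel. cis (2 * pi * of_nat (nat (- j)) * x))"
      unfolding set_lebesgue_integral_def by (rule Bochner_Integration.integral_cnj)
    also have "\<dots> = 0" using False assms by (subst pos) auto
    finally show ?thesis .
  qed
qed

section \<open>Gaussian integrals\<close>

text \<open>Polar coordinates for radial functions: the disc of squared radius \<open>t\<close> has area \<open>\<pi> t\<close>.\<close>

lemma distr_cmod_square:
  "distr lborel borel (\<lambda>z::complex. (cmod z)\<^sup>2) = density lborel (\<lambda>t::real. ennreal pi * indicator {0..} t)"
proof (rule measure_eqI_generator_eq)
  let ?E = "range (\<lambda>x::real. {..x})"
  let ?M = "distr lborel borel (\<lambda>z::complex. (cmod z)\<^sup>2)"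
  show "Int_stable ?E" by (auto simp: Int_stable_def)
  show "?E \<subseteq> Pow UNIV" by auto
  have "sets (borel :: real measure) = sigma_sets UNIV ?E" by (subst borel_eq_atMost) auto
  then show "sets ?M = sigma_sets UNIV ?E" "sets (density lborel (\<lambda>t::real. ennreal pi * indicator {0..} t)) = sigma_sets UNIV ?E"
    by simp_all
  show "range (\<lambda>n::nat. {..real n}) \<subseteq> ?E" by auto
  show "(\<Union>n::nat. {..real n}) = UNIV" using real_arch_simple by auto
  have dist: "emeasure ?M {..x} = ennreal (pi * max 0 x)" for x
  proof (cases "x \<ge> 0")
    case True
    have "{z::complex. (cmod z)\<^sup>2 \<le> x} = cball 0 (sqrt x)"
      using True by (auto simp: real_le_rsqrt) (metis norm_ge_zero power_mono real_sqrt_pow2)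
    moreover have "(\<lambda>z::complex. (cmod z)\<^sup>2) -` {..x} = {z::complex. (cmod z)\<^sup>2 \<le> x}" by auto
    ultimately show ?thesis
      using True by (simp add: emeasure_distr emeasure_cball unit_ball_vol_2)
  next
    case False
    then have "(\<lambda>z::complex. (cmod z)\<^sup>2) -` {..x} = {}"
      by auto (smt (verit) zero_le_power2)
    then show ?thesis using False by (simp add: emeasure_distr)
  qed
  then show "emeasure ?M {..real n} \<noteq> \<infinity>" for n :: nat by simp
  fix A assume "A \<in> ?E"
  then obtain x where A: "A = {..x}" by auto
  have "emeasure (density lborel (\<lambda>t::real. ennreal pi * indicator {0..} t)) A
      = (\<integral>\<^sup>+t. ennreal pi * indicator {0..x} t \<partial>lborel)"
    unfolding A by (auto simp: emeasure_density indicator_def intro!: nn_integral_cong)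
  also have "\<dots> = ennreal (pi * max 0 x)"
    by (simp add: nn_integral_cmult_indicator ennreal_mult[symmetric] max_def)
  finally show "emeasure ?M A = emeasure (density lborel (\<lambda>t::real. ennreal pi * indicator {0..} t)) A"
    by (simp add: A dist)
qed

text \<open>With \<open>t = \<bar>z\<bar>\<^sup>2\<close> this is the Gamma integral of \<open>t ^ k * exp (- c * t)\<close>.\<close>

lemma nn_integral_complex_Gaussian_moment:
  assumes c: "c > 0"
  shows "(\<integral>\<^sup>+z. ennreal ((cmod z ^ k)\<^sup>2 * exp (- c * (cmod z)\<^sup>2)) \<partial>lborel) = ennreal (pi * fact k / c ^ (k + 1))"
proof -
  define g where "g = (\<lambda>t. ennreal (t ^ k * exp (- c * t)))"
  have [measurable]: "g \<in> borel_measurable borel" unfolding g_def by measurable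
  have sc: "ennreal (1 / c) * (g (s / c) * indicator {0..} (s / c)) = ennreal (1 / c ^ (k + 1)) * (ennreal (s ^ k * exp (- s)) * indicator {0..} s)" for s
    using c by (cases "s \<ge> 0") (auto simp: g_def ennreal_mult[symmetric] power_divide field_simps indicator_def)
  have "(\<integral>\<^sup>+z. ennreal ((cmod z ^ k)\<^sup>2 * exp (- c * (cmod z)\<^sup>2)) \<partial>lborel) = (\<integral>\<^sup>+z. g ((cmod z)\<^sup>2) \<partial>lborel)"
    by (simp add: g_def power_mult[symmetric] mult.commute)
  also have "\<dots> = (\<integral>\<^sup>+t. g t \<partial>distr lborel borel (\<lambda>z::complex. (cmod z)\<^sup>2))"
    by (simp add: nn_integral_distr)
  also have "\<dots> = ennreal pi * (\<integral>\<^sup>+t. g t * indicator {0..} t \<partial>lborel)"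
    unfolding distr_cmod_square by (simp add: nn_integral_density nn_integral_cmult[symmetric] mult_ac)
  also have "(\<integral>\<^sup>+t. g t * indicator {0..} t \<partial>lborel) = ennreal (1 / c) * (\<integral>\<^sup>+s. g (s / c) * indicator {0..} (s / c) \<partial>lborel)"
    using nn_integral_real_affine[of "\<lambda>t. g t * indicator {0..} t" "1 / c" 0] c by simp
  also have "\<dots> = (\<integral>\<^sup>+s. ennreal (1 / c ^ (k + 1)) * (ennreal (s ^ k * exp (- s)) * indicator {0..} s) \<partial>lborel)"
    by (simp only: sc[symmetric]) (rule nn_integral_cmult[symmetric], measurable)
  also have "\<dots> = ennreal (1 / c ^ (k + 1)) * ennreal (fact k)"
    by (simp add: nn_integral_cmult nn_intergal_power_times_exp_Ici)
  finally show ?thesis using c by (simp add: ennreal_mult[symmetric])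
qed

lemma borel_measurable_vec_component [measurable]:
  "(\<lambda>w :: 'a::euclidean_space ^ 'n::finite. w $ i) \<in> borel_measurable borel"
  by (intro borel_measurable_continuous_onI continuous_intros)

lemma measurable_vec_lambda:
  "vec_lambda \<in> borel_measurable (Pi\<^sub>M UNIV (\<lambda>i::'n::finite. lborel :: 'a::euclidean_space measure))"
  unfolding borel_measurable_euclidean_space[where 'c = "'a^'n"]
proof
  fix v :: "'a^'n" assume "v \<in> Basis"
  then obtain i b where "v = axis i b" by (auto simp: Basis_vec_def)
  then have "(\<lambda>f. vec_lambda f \<bullet> v) = (\<lambda>f. f i \<bullet> b)" by (simp add: inner_axis)
  then show "(\<lambda>f. vec_lambda f \<bullet> v) \<in> borel_measurable (Pi\<^sub>M UNIV (\<lambda>i::'n. lborel :: 'a measure))" by simp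
qed

text \<open>This opens integrals over vectors to the product theorems for \<open>Pi\<^sub>M\<close>, with one factor
  for each index and not for each real basis vector.\<close>

lemma lborel_vec_eq_PiM:
  "distr (Pi\<^sub>M UNIV (\<lambda>i::'n::finite. lborel :: 'a::euclidean_space measure)) borel vec_lambda = lborel"
proof (rule lborel_eqI[symmetric])
  interpret product_sigma_finite "\<lambda>_::'n. lborel :: 'a measure" by unfold_locales
  note measurable_vec_lambda[measurable]
  fix l u :: "'a^'n" assume le: "\<And>v. v \<in> Basis \<Longrightarrow> l \<bullet> v \<le> u \<bullet> v"
  have le': "l $ i \<bullet> b \<le> u $ i \<bullet> b" if "b \<in> Basis" for i b
    using le[of "axis i b"] that by (simp add: inner_axis axis_in_Basis_iff)
  have "vec_lambda -` box l u \<inter> space (Pi\<^sub>M UNIV (\<lambda>i::'n. lborel :: 'a measure)) = Pi\<^sub>E UNIV (\<lambda>i. box (l $ i) (u $ i))"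
    by (auto simp: space_PiM PiE_UNIV_domain box_def Basis_vec_def inner_axis)
  then have "emeasure (distr (Pi\<^sub>M UNIV (\<lambda>i::'n. lborel :: 'a measure)) borel vec_lambda) (box l u)
      = emeasure (Pi\<^sub>M UNIV (\<lambda>i::'n. lborel :: 'a measure)) (Pi\<^sub>E UNIV (\<lambda>i. box (l $ i) (u $ i)))"
    by (simp add: emeasure_distr)
  also have "\<dots> = (\<Prod>i\<in>UNIV. ennreal (\<Prod>b\<in>Basis. (u $ i - l $ i) \<bullet> b))"
    by (subst emeasure_PiM) (auto simp: le' intro!: prod.cong emeasure_lborel_box)
  also have "\<dots> = ennreal (\<Prod>i\<in>UNIV. \<Prod>b\<in>Basis. (u $ i - l $ i) \<bullet> b)"
    by (intro prod_ennreal prod_nonneg) (simp add: le' inner_diff_left)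
  also have "(\<Prod>i\<in>UNIV. \<Prod>b\<in>Basis. (u $ i - l $ i) \<bullet> b) = (\<Prod>(i, b)\<in>UNIV \<times> Basis. (u - l) \<bullet> axis i b)"
    by (subst prod.cartesian_product) (simp add: inner_axis split_beta')
  also have "\<dots> = (\<Prod>v\<in>Basis. (u - l) \<bullet> v)"
  proof -
    have "bij_betw (\<lambda>p. axis (fst p) (snd p)) (UNIV \<times> Basis) (Basis :: ('a^'n) set)"
      by (auto simp: bij_betw_def inj_on_def Basis_vec_def axis_eq_axis image_def)
    from prod.reindex_bij_betw[OF this, of "\<lambda>v. (u - l) \<bullet> v"]
    show ?thesis by (simp add: split_beta')
  qed
  finally show "emeasure (distr (Pi\<^sub>M UNIV (\<lambda>i::'n. lborel :: 'a measure)) borel vec_lambda) (box l u)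
      = ennreal (\<Prod>v\<in>Basis. (u - l) \<bullet> v)" .
qed simp

lemma nn_integral_lborel_vec_prod:
  fixes f :: "'n::finite \<Rightarrow> 'a::euclidean_space \<Rightarrow> ennreal"
  assumes f[measurable]: "\<And>i. f i \<in> borel_measurable borel"
  shows "(\<integral>\<^sup>+w. (\<Prod>i\<in>UNIV. f i (w $ i)) \<partial>lborel) = (\<Prod>i\<in>UNIV. \<integral>\<^sup>+z. f i z \<partial>lborel)"
proof -
  interpret product_sigma_finite "\<lambda>_::'n. lborel :: 'a measure" by unfold_locales
  note measurable_vec_lambda[measurable]
  show ?thesis
    by (subst lborel_vec_eq_PiM[symmetric]) (simp add: nn_integral_distr product_nn_integral_prod)
qed

text \<open>Completing the square gives a multiple of the normal density with mean \<open>b / c\<close> and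
  variance \<open>1 / (2 c)\<close>.\<close>

lemma nn_integral_shifted_Gaussian:
  assumes c: "c > 0"
  shows "(\<integral>\<^sup>+y. ennreal (exp (2 * b * y - c * y\<^sup>2)) \<partial>lborel) = ennreal (sqrt (pi / c) * exp (b\<^sup>2 / c))"
proof -
  define \<sigma> where "\<sigma> = 1 / sqrt (2 * c)"
  have \<sigma>: "\<sigma> > 0" "\<sigma>\<^sup>2 = 1 / (2 * c)" using c by (simp_all add: \<sigma>_def power_divide)
  have "exp (2 * b * y - c * y\<^sup>2) = sqrt (pi / c) * exp (b\<^sup>2 / c) * normal_density (b / c) \<sigma> y" for y
  proof -
    have "2 * b * y - c * y\<^sup>2 = b\<^sup>2 / c + - (y - b / c)\<^sup>2 / (2 * \<sigma>\<^sup>2)"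
    proof -
      have "- (y - b / c)\<^sup>2 / (2 * \<sigma>\<^sup>2) = - c * (y - b / c)\<^sup>2" using c by (simp add: \<sigma>)
      also have "b\<^sup>2 / c + (- c * (y - b / c)\<^sup>2) = 2 * b * y - c * y\<^sup>2" using c by (simp add: field_simps power2_eq_square)
      finally show ?thesis ..
    qed
    moreover have "sqrt (pi / c) * (1 / sqrt (2 * pi * \<sigma>\<^sup>2)) = 1"
      using c by (simp add: \<sigma> real_sqrt_divide)
    ultimately have "exp (2 * b * y - c * y\<^sup>2) =
        (sqrt (pi / c) * (1 / sqrt (2 * pi * \<sigma>\<^sup>2))) * (exp (b\<^sup>2 / c) * exp (- (y - b / c)\<^sup>2 / (2 * \<sigma>\<^sup>2)))"
      by (simp only: exp_add mult_1)
    then show ?thesis unfolding normal_density_def by (simp only: mult_ac)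
  qed
  then have "(\<integral>\<^sup>+y. ennreal (exp (2 * b * y - c * y\<^sup>2)) \<partial>lborel)
      = (\<integral>\<^sup>+y. ennreal (sqrt (pi / c) * exp (b\<^sup>2 / c)) * ennreal (normal_density (b / c) \<sigma> y) \<partial>lborel)"
    using c by (simp add: ennreal_mult[symmetric])
  also have "\<dots> = ennreal (sqrt (pi / c) * exp (b\<^sup>2 / c)) * (\<integral>\<^sup>+y. ennreal (normal_density (b / c) \<sigma> y) \<partial>lborel)"
    by (rule nn_integral_cmult) measurable
  also have "(\<integral>\<^sup>+y. ennreal (normal_density (b / c) \<sigma> y) \<partial>lborel) = 1"
    using \<sigma> by (subst nn_integral_eq_integral) auto
  finally show ?thesis by simp
qed

lemma borel_measurable_fst_snd [measurable]:
  "(fst :: 'a::euclidean_space \<times> 'b::euclidean_space \<Rightarrow> 'a) \<in> borel_measurable borel"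
  "(snd :: 'a::euclidean_space \<times> 'b::euclidean_space \<Rightarrow> 'b) \<in> borel_measurable borel"
  by (intro borel_measurable_continuous_onI continuous_intros)+

lemma nn_integral_strip_Gaussian:
  fixes g :: "'m::finite \<Rightarrow> complex \<Rightarrow> ennreal"
  assumes c: "c > 0" and [measurable]: "\<And>i. g i \<in> borel_measurable borel"
  shows "(\<integral>\<^sup>+p. indicator {0..1} (Re (fst p)) * (ennreal (exp (2 * b * Im (fst p) - c * (Im (fst p))\<^sup>2)) * (\<Prod>i\<in>UNIV. g i (snd p $ i))) \<partial>lborel)
    = ennreal (sqrt (pi / c) * exp (b\<^sup>2 / c)) * (\<Prod>i\<in>UNIV. \<integral>\<^sup>+z. g i z \<partial>lborel)"
proof -
  have [measurable]: "(\<lambda>w. \<Prod>i\<in>UNIV. g i (w $ i)) \<in> borel_measurable borel" by measurable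
  have [measurable]: "(\<lambda>p::complex \<times> (complex^'m). \<Prod>i\<in>UNIV. g i (snd p $ i)) \<in> borel_measurable borel"
  proof (rule borel_measurable_prod_ennreal)
    show "(\<lambda>p::complex \<times> (complex^'m). g i (snd p $ i)) \<in> borel_measurable borel" for i
      by (rule measurable_compose[OF measurable_compose[OF borel_measurable_fst_snd(2) borel_measurable_vec_component] assms(2)])
  qed
  let ?P = "\<Prod>i\<in>UNIV. \<integral>\<^sup>+z. g i z \<partial>lborel"
  have "(\<integral>\<^sup>+p. indicator {0..1} (Re (fst p)) * (ennreal (exp (2 * b * Im (fst p) - c * (Im (fst p))\<^sup>2)) * (\<Prod>i\<in>UNIV. g i (snd p $ i))) \<partial>lborel)
    = (\<integral>\<^sup>+x. \<integral>\<^sup>+y. \<integral>\<^sup>+w. indicator {0..1::real} x * (ennreal (exp (2 * b * y - c * y\<^sup>2)) * (\<Prod>i\<in>UNIV. g i (w $ i))) \<partial>lborel \<partial>lborel \<partial>lborel)"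
    by (simp add: nn_integral_slice)
  also have "\<dots> = (\<integral>\<^sup>+x. \<integral>\<^sup>+y. indicator {0..1::real} x * (ennreal (exp (2 * b * y - c * y\<^sup>2)) * ?P) \<partial>lborel \<partial>lborel)"
    by (simp add: nn_integral_cmult nn_integral_lborel_vec_prod)
  also have "\<dots> = (\<integral>\<^sup>+x. indicator {0..1::real} x * (ennreal (sqrt (pi / c) * exp (b\<^sup>2 / c)) * ?P) \<partial>lborel)"
    by (simp add: nn_integral_cmult nn_integral_multc nn_integral_shifted_Gaussian[OF c])
  also have "\<dots> = ennreal (sqrt (pi / c) * exp (b\<^sup>2 / c)) * ?P"
    by (simp add: nn_integral_multc)
  finally show ?thesis .
qed

section \<open>Entire functions of several variables\<close>

lemma vec_scaleR_eq: "r *\<^sub>R (u :: complex^'n) = of_real r *s u"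
  by (simp only: vec_eq_iff vector_scaleR_component vector_smult_component) (simp add: scaleR_conv_of_real)

lemma bounded_linear_vec_scale: "bounded_linear (\<lambda>t::complex. t *s (v :: complex^'g))"
  by (intro linear_conv_bounded_linear[THEN iffD1] linearI)
    (simp_all add: vec_scaleR_eq vec.scale_left_distrib, simp add: scaleR_conv_of_real)

lemma bounded_linear_complex_linear:
  fixes L :: "complex^'g \<Rightarrow> complex"
  assumes "\<And>u v. L (u + v) = L u + L v" "\<And>c u. L (c *s u) = c * L u"
  shows "bounded_linear L"
  by (intro linear_conv_bounded_linear[THEN iffD1] linearI)
    (simp_all add: assms vec_scaleR_eq, simp add: scaleR_conv_of_real)

lemma holomorphic_severalE:
  assumes "holomorphic_several f"
  obtains D where "\<And>u. (f has_derivative D u) (at u)" "\<And>u c v. D u (c *s v) = c * D u v"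
  using assms unfolding holomorphic_several_def by metis

lemma holomorphic_several_continuous:
  assumes "holomorphic_several f" shows "continuous_on UNIV f"
  using assms unfolding holomorphic_several_def
  by (meson continuous_at_imp_continuous_on has_derivative_continuous)

lemma holomorphic_several_line:
  assumes "holomorphic_several f"
  shows "(\<lambda>t. f (u + t *s v)) holomorphic_on UNIV"
proof -
  obtain D where D: "\<And>u. (f has_derivative D u) (at u)" "\<And>u c v. D u (c *s v) = c * D u v"
    by (rule holomorphic_severalE[OF assms]) blast
  have "((\<lambda>t. f (u + t *s v)) has_field_derivative D (u + t *s v) v) (at t)" for t
  proof -
    have "((\<lambda>t. u + t *s v) has_derivative (\<lambda>t. t *s v)) (at t)"
      using has_derivative_add[OF has_derivative_const bounded_linear_imp_has_derivative[OF bounded_linear_vec_scale]]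
      by simp
    from has_derivative_compose[OF this D(1)] show ?thesis
      by (simp add: D(2) has_field_derivative_def mult_commute_abs)
  qed
  then show ?thesis by (auto simp: holomorphic_on_def field_differentiable_def intro: has_field_derivative_at_within)
qed

lemma holomorphic_several_linear:
  assumes "\<And>u v. L (u + v) = L u + L v" "\<And>c u. L (c *s u) = c * L u"
  shows "holomorphic_several L"
  unfolding holomorphic_several_def
  using bounded_linear_imp_has_derivative[OF bounded_linear_complex_linear[of L, OF assms]] assms(2) by blast

lemma holomorphic_several_const: "holomorphic_several (\<lambda>_. c)"
  unfolding holomorphic_several_def by (intro allI exI[of _ "\<lambda>_. 0"]) auto

lemma holomorphic_several_add:
  assumes "holomorphic_several f" "holomorphic_several h"
  shows "holomorphic_several (\<lambda>u. f u + h u)"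
proof -
  obtain D where D: "\<And>u. (f has_derivative D u) (at u)" "\<And>u c v. D u (c *s v) = c * D u v"
    by (rule holomorphic_severalE[OF assms(1)]) blast
  obtain E where E: "\<And>u. (h has_derivative E u) (at u)" "\<And>u c v. E u (c *s v) = c * E u v"
    by (rule holomorphic_severalE[OF assms(2)]) blast
  show ?thesis unfolding holomorphic_several_def
  proof
    fix u
    show "\<exists>D. ((\<lambda>u. f u + h u) has_derivative D) (at u) \<and> (\<forall>c v. D (c *s v) = c * D v)"
      using has_derivative_add[OF D(1)[of u] E(1)[of u]]
      by (intro exI[of _ "\<lambda>v. D u v + E u v"]) (simp add: D(2) E(2) algebra_simps)
  qed
qed

lemma holomorphic_several_mult:
  assumes "holomorphic_several f" "holomorphic_several h"
  shows "holomorphic_several (\<lambda>u. f u * h u)"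
proof -
  obtain D where D: "\<And>u. (f has_derivative D u) (at u)" "\<And>u c v. D u (c *s v) = c * D u v"
    by (rule holomorphic_severalE[OF assms(1)]) blast
  obtain E where E: "\<And>u. (h has_derivative E u) (at u)" "\<And>u c v. E u (c *s v) = c * E u v"
    by (rule holomorphic_severalE[OF assms(2)]) blast
  show ?thesis unfolding holomorphic_several_def
  proof
    fix u
    show "\<exists>D. ((\<lambda>u. f u * h u) has_derivative D) (at u) \<and> (\<forall>c v. D (c *s v) = c * D v)"
      using has_derivative_mult[OF D(1)[of u] E(1)[of u]]
      by (intro exI[of _ "\<lambda>v. f u * E u v + D u v * h u"]) (simp add: D(2) E(2) algebra_simps)
  qed
qed

lemma holomorphic_several_exp:
  assumes "holomorphic_several f"
  shows "holomorphic_several (\<lambda>u. exp (f u))"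
proof -
  obtain D where D: "\<And>u. (f has_derivative D u) (at u)" "\<And>u c v. D u (c *s v) = c * D u v"
    by (rule holomorphic_severalE[OF assms]) blast
  show ?thesis unfolding holomorphic_several_def
  proof
    fix u
    have "(exp has_derivative (*) (exp (f u))) (at (f u))"
      using DERIV_exp[of "f u"] by (simp add: has_field_derivative_def)
    from has_derivative_compose[OF D(1) this]
    show "\<exists>D. ((\<lambda>u. exp (f u)) has_derivative D) (at u) \<and> (\<forall>c v. D (c *s v) = c * D v)"
      by (intro exI[of _ "\<lambda>v. exp (f u) * D u v"]) (simp add: D(2))
  qed
qed

lemma holomorphic_several_power: "holomorphic_several f \<Longrightarrow> holomorphic_several (\<lambda>u. f u ^ k)"
  by (induction k) (auto intro: holomorphic_several_const holomorphic_several_mult)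

lemma holomorphic_several_prod:
  "finite A \<Longrightarrow> (\<And>i. i \<in> A \<Longrightarrow> holomorphic_several (f i)) \<Longrightarrow> holomorphic_several (\<lambda>u. \<Prod>i\<in>A. f i u)"
  by (induction A rule: finite_induct) (auto intro: holomorphic_several_const holomorphic_several_mult)

text \<open>Cauchy's estimate for the restriction of \<open>f\<close> to the complex line through \<open>u\<close> in direction \<open>v\<close>.\<close>

lemma holomorphic_several_derivative_bound:
  fixes f :: "complex^'g \<Rightarrow> complex"
  assumes f: "holomorphic_several f"
    and D: "(f has_derivative D) (at u)" "\<And>c v. D (c *s v) = c * D v"
    and M: "\<And>x. norm (x - u) \<le> 1 \<Longrightarrow> cmod (f x) \<le> M"
  shows "cmod (D v) \<le> M * norm v"
proof (cases "v = 0")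
  case True
  then show ?thesis using D(2)[of 0 v] by simp
next
  case False
  define e where "e = (1 / norm v) *\<^sub>R v"
  have e: "norm e = 1" using False by (simp add: e_def)
  define \<phi> where "\<phi> = (\<lambda>t. f (u + t *s e))"
  have hol: "\<phi> holomorphic_on UNIV" unfolding \<phi>_def by (rule holomorphic_several_line[OF f])
  have "((\<lambda>t. u + t *s e) has_derivative (\<lambda>t. t *s e)) (at 0)"
    using has_derivative_add[OF has_derivative_const bounded_linear_imp_has_derivative[OF bounded_linear_vec_scale]]
    by simp
  moreover have "(f has_derivative D) (at (u + 0 *s e))" using D(1) by simp
  ultimately have "(\<phi> has_derivative (\<lambda>t. D (t *s e))) (at 0)"
    unfolding \<phi>_def by (rule has_derivative_compose)
  then have "(\<phi> has_field_derivative D e) (at 0)"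
    by (simp add: D(2) has_field_derivative_def mult_commute_abs)
  then have "deriv \<phi> 0 = D e" by (rule DERIV_imp_deriv)
  moreover have "cmod ((deriv ^^ 1) \<phi> 0) \<le> fact 1 * M / 1 ^ 1"
  proof (rule Cauchy_inequality)
    show "\<phi> holomorphic_on ball 0 1" "continuous_on (cball 0 1) \<phi>"
      using hol by (auto intro: holomorphic_on_subset holomorphic_on_imp_continuous_on)
    fix t :: complex assume t: "cmod (0 - t) = 1"
    have "norm (t *s e) = cmod t * norm e"
      by (simp add: norm_vec_def norm_mult L2_set_right_distrib)
    then show "cmod (\<phi> t) \<le> M" unfolding \<phi>_def using t e by (intro M) simp
  qed simp
  ultimately have "cmod (D e) \<le> M" by simp
  have "D v = of_real (norm v) * D e"
    unfolding D(2)[symmetric] vec_scaleR_eq[symmetric] e_def using False by simp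
  then have "cmod (D v) = norm v * cmod (D e)" by (simp add: norm_mult)
  moreover have "norm v * cmod (D e) \<le> norm v * M"
    by (rule mult_left_mono[OF \<open>cmod (D e) \<le> M\<close> norm_ge_zero])
  ultimately show ?thesis by (simp only: mult.commute[of M])
qed

text \<open>Applied to differences, the derivative bound shows that the derivatives are locally uniformly
  Cauchy as well, so that the theorem on termwise differentiation of sequences applies.\<close>

lemma holomorphic_several_limit:
  fixes X :: "nat \<Rightarrow> complex^'g \<Rightarrow> complex"
  assumes X: "\<And>n. holomorphic_several (X n)"
    and Cauchy: "\<And>R \<epsilon>. \<epsilon> > 0 \<Longrightarrow> \<exists>N. \<forall>m\<ge>N. \<forall>n\<ge>N. \<forall>u. norm u \<le> R \<longrightarrow> cmod (X m u - X n u) \<le> \<epsilon>"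
  shows "\<exists>f. holomorphic_several f \<and> (\<forall>u. (\<lambda>n. X n u) \<longlonglongrightarrow> f u)"
proof -
  have conv: "convergent (\<lambda>n. X n u)" for u
  proof -
    have "Cauchy (\<lambda>n. X n u)"
    proof (rule CauchyI)
      fix e :: real assume "e > 0"
      then obtain N where "\<forall>m\<ge>N. \<forall>n\<ge>N. \<forall>v. norm v \<le> norm u \<longrightarrow> cmod (X m v - X n v) \<le> e / 2"
        using Cauchy[of "e/2" "norm u"] by auto
      then have "\<forall>m\<ge>N. \<forall>n\<ge>N. cmod (X m u - X n u) < e" using \<open>e > 0\<close> by fastforce
      then show "\<exists>M. \<forall>m\<ge>M. \<forall>n\<ge>M. cmod (X m u - X n u) < e" by blast
    qed
    then show ?thesis by (simp add: Cauchy_convergent_iff)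
  qed
  define f where "f = (\<lambda>u. lim (\<lambda>n. X n u))"
  have f: "(\<lambda>n. X n u) \<longlonglongrightarrow> f u" for u
    using conv[of u] by (simp add: f_def convergent_LIMSEQ_iff)
  have "\<exists>D. \<forall>u. (X n has_derivative D u) (at u) \<and> (\<forall>c v. D u (c *s v) = c * D u v)" for n
    using holomorphic_severalE[OF X[of n]] by metis
  then obtain D where D: "\<And>n u. (X n has_derivative D n u) (at u)" "\<And>n u c v. D n u (c *s v) = c * D n u v"
    by metis
  have D_Cauchy: "\<exists>N. \<forall>m\<ge>N. \<forall>n\<ge>N. \<forall>u v. norm u \<le> R \<longrightarrow> cmod (D m u v - D n u v) \<le> e * norm v" if e: "e > 0" for e R
  proof -
    obtain N where N: "\<And>m n u. m \<ge> N \<Longrightarrow> n \<ge> N \<Longrightarrow> norm u \<le> R + 1 \<Longrightarrow> cmod (X m u - X n u) \<le> e"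
      using Cauchy[OF e, of "R + 1"] by auto
    have "cmod (D m u v - D n u v) \<le> e * norm v" if "m \<ge> N" "n \<ge> N" "norm u \<le> R" for m n u v
    proof (rule holomorphic_several_derivative_bound[where f="\<lambda>u. X m u - X n u" and D="\<lambda>v. D m u v - D n u v" and u=u])
      show "holomorphic_several (\<lambda>u. X m u - X n u)"
        using holomorphic_several_add[OF X holomorphic_several_mult[OF holomorphic_several_const X], of m "-1" n] by simp
      show "((\<lambda>u. X m u - X n u) has_derivative (\<lambda>v. D m u v - D n u v)) (at u)"
        by (intro has_derivative_diff D(1))
      fix x assume "norm (x - u) \<le> 1"
      then have "norm x \<le> R + 1" using that(3) norm_triangle_sub[of x u] by linarith
      then show "cmod (X m x - X n x) \<le> e" using N that by simp
    qed (simp add: D(2) algebra_simps)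
    then show ?thesis by blast
  qed
  have D_conv: "convergent (\<lambda>n. D n u v)" for u v
  proof -
    have "Cauchy (\<lambda>n. D n u v)"
    proof (rule CauchyI)
      fix e :: real assume "e > 0"
      then have e: "e / (2 * (norm v + 1)) > 0" by (simp add: add_nonneg_pos)
      obtain N where N: "\<forall>m\<ge>N. \<forall>n\<ge>N. \<forall>x y. norm x \<le> norm u \<longrightarrow> cmod (D m x y - D n x y) \<le> e / (2 * (norm v + 1)) * norm y"
        using D_Cauchy[OF e, of "norm u"] by blast
      have "e / (2 * (norm v + 1)) * norm v \<le> e / (2 * (norm v + 1)) * (norm v + 1)"
        using e by (intro mult_left_mono) auto
      also have "\<dots> = e / 2" using add_nonneg_pos[OF norm_ge_zero[of v] zero_less_one] by (simp add: field_simps)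
      finally have "e / (2 * (norm v + 1)) * norm v < e" using \<open>e > 0\<close> by linarith
      then show "\<exists>M. \<forall>m\<ge>M. \<forall>n\<ge>M. cmod (D m u v - D n u v) < e" using N order.refl[of "norm u"] order_le_less_trans by blast
    qed
    then show ?thesis by (simp add: Cauchy_convergent_iff)
  qed
  define D' where "D' = (\<lambda>u v. lim (\<lambda>n. D n u v))"
  have D': "(\<lambda>n. D n u v) \<longlonglongrightarrow> D' u v" for u v
    using D_conv[of u v] by (simp add: D'_def convergent_LIMSEQ_iff)
  have scale: "D' u (c *s v) = c * D' u v" for u c v
    using LIMSEQ_unique[OF D'[of u "c *s v"]] tendsto_mult_left[OF D'[of u v], of c] by (simp add: D(2))
  have deriv: "(f has_derivative D' u) (at u)" for u
  proof -
    define S where "S = ball (0 :: complex^'g) (norm u + 1)"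
    have u: "u \<in> S" by (simp add: S_def)
    have "\<exists>g. \<forall>x\<in>S. (\<lambda>n. X n x) \<longlonglongrightarrow> g x \<and> (g has_derivative D' x) (at x within S)"
    proof (rule has_derivative_sequence[OF _ _ _ u f])
      show "convex S" by (simp add: S_def)
      show "(X n has_derivative D n x) (at x within S)" for n x
        by (rule has_derivative_at_withinI[OF D(1)])
      fix e :: real assume "e > 0"
      obtain N where N: "\<And>m n x y. m \<ge> N \<Longrightarrow> n \<ge> N \<Longrightarrow> norm x \<le> norm u + 1 \<Longrightarrow> cmod (D m x y - D n x y) \<le> e * norm y"
        using D_Cauchy[OF \<open>e > 0\<close>, of "norm u + 1"] by blast
      have "cmod (D n x h - D' x h) \<le> e * norm h" if "n \<ge> N" "x \<in> S" for n x h
      proof (rule tendsto_upperbound[where F=sequentially])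
        show "(\<lambda>m. cmod (D n x h - D m x h)) \<longlonglongrightarrow> cmod (D n x h - D' x h)"
          by (intro tendsto_intros D')
        show "\<forall>\<^sub>F m in sequentially. cmod (D n x h - D m x h) \<le> e * norm h"
          using eventually_ge_at_top[of N]
        proof eventually_elim
          case (elim m)
          then show ?case using N[of n m x h] that by (simp add: S_def)
        qed
      qed simp
      then show "\<forall>\<^sub>F n in sequentially. \<forall>x\<in>S. \<forall>h. cmod (D n x h - D' x h) \<le> e * norm h"
        unfolding eventually_sequentially by (intro exI[of _ N]) simp
    qed
    then obtain g where g: "\<And>x. x \<in> S \<Longrightarrow> (\<lambda>n. X n x) \<longlonglongrightarrow> g x" "\<And>x. x \<in> S \<Longrightarrow> (g has_derivative D' x) (at x within S)"
      by blast
    have gf: "g x = f x" if "x \<in> S" for x using LIMSEQ_unique[OF g(1)[OF that] f] .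
    have "open S" by (simp add: S_def)
    have "(g has_derivative D' u) (at u)"
      by (rule g(2)[OF u, unfolded at_within_open[OF u \<open>open S\<close>]])
    then show ?thesis
      by (rule has_derivative_transform_within_open[OF _ \<open>open S\<close> u gf])
  qed
  have "holomorphic_several f" unfolding holomorphic_several_def using deriv scale by blast
  with f show ?thesis by blast
qed

section \<open>The theta space in adapted coordinates\<close>

definition coordinate_rotation :: "complex \<Rightarrow> ('m \<Rightarrow> complex) \<Rightarrow> complex \<times> (complex^'m) \<Rightarrow> complex \<times> (complex^'m)" where
  "coordinate_rotation a c = (\<lambda>(z, w). (a * z, \<chi> i. c i * w $ i))"

lemma norm_coords_square: "(norm p)\<^sup>2 = (cmod (fst p))\<^sup>2 + (\<Sum>i\<in>UNIV. (cmod (snd p $ i))\<^sup>2)"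
  for p :: "complex \<times> (complex^'m::finite)"
  by (cases p) (simp add: norm_prod_def norm_vec_def L2_set_def sum_nonneg)

lemma linear_isometry_coordinate_rotation:
  fixes c :: "'m::finite \<Rightarrow> complex"
  assumes a: "cmod a = 1" and c: "\<And>i. cmod (c i) = 1"
  shows "linear_isometry (coordinate_rotation a c)"
  unfolding linear_isometry_def
proof (intro conjI allI)
  show "linear (coordinate_rotation a c)"
  proof (rule linearI)
    show "coordinate_rotation a c (p + q) = coordinate_rotation a c p + coordinate_rotation a c q" for p q
      by (cases p; cases q) (simp add: coordinate_rotation_def vec_eq_iff distrib_left)
    show "coordinate_rotation a c (r *\<^sub>R p) = r *\<^sub>R coordinate_rotation a c p" for r p
      by (cases p) (simp add: coordinate_rotation_def vec_eq_iff)
  qed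
  show "surj (coordinate_rotation a c)"
  proof (rule surjI)
    have "a \<noteq> 0" "c i \<noteq> 0" for i using a c[of i] by auto
    then show "coordinate_rotation a c (coordinate_rotation (1 / a) (\<lambda>i. 1 / c i) p) = p" for p
      by (cases p) (simp add: coordinate_rotation_def vec_eq_iff)
  qed
  fix p
  have "(norm (coordinate_rotation a c p))\<^sup>2 = (norm p)\<^sup>2"
    unfolding norm_coords_square by (cases p) (simp add: coordinate_rotation_def norm_mult a c)
  then show "norm (coordinate_rotation a c p) = norm p" by simp
qed

locale theta_setting =
  fixes H :: "complex^'g \<Rightarrow> complex^'g \<Rightarrow> complex"
    and \<omega> :: "complex^'g"
    and b :: "'m::finite \<Rightarrow> complex^'g"
    and chi :: "complex^'g \<Rightarrow> complex"
    and \<nu> \<alpha> :: real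
  assumes hermitian: "positive_definite_hermitian H"
    and \<omega>_nonzero: "\<omega> \<noteq> 0"
    and H_\<omega>\<omega>: "H \<omega> \<omega> = of_real \<nu>"
    and adapted: "adapted_basis H \<omega> \<nu> b"
    and chi_eq: "\<And>m::int. chi (of_int m *s \<omega>) = exp (2 * \<i> * of_real pi * of_real \<alpha> * of_int m)"
begin

abbreviation "pt \<equiv> point_of_coords \<omega> b"
abbreviation "F \<equiv> theta_FB_space H \<omega> b chi"
abbreviation "ip \<equiv> theta_inner H \<omega> b"

lemma H_add_left: "H (u + v) w = H u w + H v w"
  and H_scale_left: "H (c *s u) v = c * H u v"
  and H_cnj: "H v u = cnj (H u v)"
  and H_pos: "u \<noteq> 0 \<Longrightarrow> 0 < Re (H u u)"
proof -
  note laws = hermitian[unfolded positive_definite_hermitian_def]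
  show "H (u + v) w = H u w + H v w" by (rule laws[THEN conjunct1, rule_format])
  show "H (c *s u) v = c * H u v" by (rule laws[THEN conjunct2, THEN conjunct1, rule_format])
  show "H v u = cnj (H u v)" by (rule laws[THEN conjunct2, THEN conjunct2, THEN conjunct1, rule_format])
  show "u \<noteq> 0 \<Longrightarrow> 0 < Re (H u u)" by (rule laws[THEN conjunct2, THEN conjunct2, THEN conjunct2, rule_format])
qed

lemma H_scale_right: "H v (c *s u) = cnj c * H v u"
  unfolding H_cnj[of v] H_scale_left complex_cnj_mult ..

lemma H_zero_left: "H 0 v = 0"
  using H_scale_left[of 0 0 v] by simp

lemma H_sum_left: "H (\<Sum>i\<in>A. f i) v = (\<Sum>i\<in>A. H (f i) v)"
  by (induction A rule: infinite_finite_induct) (simp_all add: H_zero_left H_add_left)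

lemma \<nu>_pos: "\<nu> > 0" using H_pos[OF \<omega>_nonzero] by (simp add: H_\<omega>\<omega>)

lemma H_b_b: "H (b i) (b j) = (if i = j then of_real \<nu> else 0)"
  using adapted unfolding adapted_basis_def by blast

lemma span_b: "vec.span (range b) = {u. H u \<omega> = 0}"
  using adapted unfolding adapted_basis_def by blast

lemma H_b_\<omega>: "H (b i) \<omega> = 0"
  using vec.span_base[of "b i" "range b"] unfolding span_b by simp

lemma H_\<omega>_b: "H \<omega> (b i) = 0"
  unfolding H_cnj[of \<omega> "b i"] H_b_\<omega> by simp

lemma pt_eq: "pt (z, w) = z *s \<omega> + (\<Sum>i\<in>UNIV. w $ i *s b i)"
  by (simp add: point_of_coords_def)

lemma H_pt_\<omega>: "H (pt p) \<omega> = of_real \<nu> * fst p"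
  by (cases p) (simp add: pt_eq H_add_left H_scale_left H_sum_left H_\<omega>\<omega> H_b_\<omega>)

lemma H_pt_b: "H (pt p) (b i) = of_real \<nu> * snd p $ i"
  by (cases p) (simp add: pt_eq H_add_left H_scale_left H_sum_left H_\<omega>_b H_b_b if_distrib cong: if_cong)

lemma H_pt_pt: "H (pt p) (pt q) = of_real \<nu> * (fst p * cnj (fst q) + (\<Sum>i\<in>UNIV. snd p $ i * cnj (snd q $ i)))"
proof -
  have "H (pt p) (pt q) = cnj (H (pt q) (pt p))" by (rule H_cnj)
  also have "H (pt q) (pt p) = fst q * H \<omega> (pt p) + (\<Sum>i\<in>UNIV. snd q $ i * H (b i) (pt p))"
    by (cases q) (simp add: pt_eq[of "fst q"] H_add_left H_scale_left H_sum_left pt_eq)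
  also have "\<dots> = fst q * cnj (H (pt p) \<omega>) + (\<Sum>i\<in>UNIV. snd q $ i * cnj (H (pt p) (b i)))"
    by (simp only: H_cnj[of \<omega> "pt p"] H_cnj[of "b _" "pt p"])
  finally show ?thesis by (simp add: H_pt_\<omega> H_pt_b sum_distrib_left algebra_simps)
qed

text \<open>The adapted basis turns \<open>H\<close> into \<open>\<nu>\<close> times the Euclidean inner product of the coordinates, so the
  weight \<open>exp (- H u u)\<close> is a Gaussian that is invariant under rotations.\<close>

lemma H_pt_self: "H (pt p) (pt p) = of_real (\<nu> * (norm p)\<^sup>2)"
  unfolding H_pt_pt norm_coords_square by (simp only: of_real_mult of_real_add of_real_sum complex_norm_square)

lemma linear_pt: "linear pt"
proof (rule linearI)
  show "pt (p + q) = pt p + pt q" for p q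
    by (cases p; cases q) (simp add: pt_eq vec.scale_left_distrib sum.distrib)
  show "pt (r *\<^sub>R p) = r *\<^sub>R pt p" for r p
    by (cases p) (simp add: vec_scaleR_eq pt_eq scaleR_conv_of_real vec.scale_right_distrib vec.scale_sum_right)
qed

lemma pt_scale: "pt (c * z, c *s w) = c *s pt (z, w)"
  by (simp add: pt_eq vec.scale_right_distrib vec.scale_sum_right)

lemma pt_add: "pt (p + q) = pt p + pt q" by (rule linear_add[OF linear_pt])

lemma continuous_on_pt: "continuous_on A pt"
  by (rule linear_continuous_on[OF linear_pt[THEN linear_conv_bounded_linear[THEN iffD1]]])

lemma bij_pt: "bij pt"
proof (rule bijI)
  show "inj pt"
    unfolding linear_injective_0[OF linear_pt]
  proof (intro allI impI)
    fix p assume "pt p = 0"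
    then have "complex_of_real (\<nu> * (norm p)\<^sup>2) = 0" using H_pt_self[of p] by (simp add: H_zero_left)
    then show "p = 0" using \<nu>_pos by simp
  qed
  show "surj pt"
    unfolding surj_def
  proof
    fix u
    define z where "z = H u \<omega> / of_real \<nu>"
    have "H (u + (- z) *s \<omega>) \<omega> = 0"
      unfolding H_add_left H_scale_left H_\<omega>\<omega> z_def using \<nu>_pos by simp
    then have "u + (- z) *s \<omega> \<in> vec.span (range b)" unfolding span_b by simp
    then obtain c where c: "u + (- z) *s \<omega> = (\<Sum>v\<in>range b. c v *s v)"
      unfolding vec.span_finite[OF finite_imageI[OF finite]] by auto
    have "inj b" using adapted unfolding adapted_basis_def by blast
    then have "(\<Sum>v\<in>range b. c v *s v) = (\<Sum>i\<in>UNIV. c (b i) *s b i)" by (simp add: sum.reindex)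
    moreover have "u = z *s \<omega> + (u + (- z) *s \<omega>)" by simp
    ultimately have "u = z *s \<omega> + (\<Sum>i\<in>UNIV. c (b i) *s b i)" using c by (simp only:)
    then have "u = pt (z, \<chi> i. c (b i))" by (simp add: pt_eq)
    then show "\<exists>p. u = pt p" by blast
  qed
qed

lemma coords_pt: "coords_of_point \<omega> b (pt p) = p"
  unfolding coords_of_point_def by (rule inv_f_f[OF bij_is_inj[OF bij_pt]])

lemma pt_coords: "pt (coords_of_point \<omega> b u) = u"
  unfolding coords_of_point_def by (rule surj_f_inv_f[OF bij_is_surj[OF bij_pt]])

lemma coords_eq: "coords_of_point \<omega> b u = (H u \<omega> / of_real \<nu>, \<chi> i. H u (b i) / of_real \<nu>)"
proof -
  obtain p where u: "u = pt p" using bij_is_surj[OF bij_pt] by (metis surjD)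
  show ?thesis using \<nu>_pos unfolding u coords_pt by (simp add: H_pt_\<omega> H_pt_b prod_eq_iff vec_eq_iff)
qed

definition weight :: "complex \<times> (complex^'m) \<Rightarrow> real" where
  "weight p = exp (- \<nu> * (norm p)\<^sup>2)"

lemma weight_pos: "weight p > 0" by (simp add: weight_def)

lemma theta_integrand_eq: "theta_integrand H \<omega> b f h p = f (pt p) * cnj (h (pt p)) * of_real (weight p)"
  unfolding theta_integrand_def Let_def H_pt_self weight_def of_real_exp by simp

definition sq_dens :: "(complex^'g \<Rightarrow> complex) \<Rightarrow> complex \<times> (complex^'m) \<Rightarrow> real" where
  "sq_dens f p = (cmod (f (pt p)))\<^sup>2 * weight p"

lemma sq_dens_nonneg: "0 \<le> sq_dens f p" by (simp add: sq_dens_def weight_def)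

lemma theta_integrand_self: "theta_integrand H \<omega> b f f p = of_real (sq_dens f p)"
  unfolding theta_integrand_eq sq_dens_def by (simp only: of_real_mult complex_norm_square)

lemma norm_theta_integrand_le:
  "norm (theta_integrand H \<omega> b f h p) \<le> sq_dens f p + sq_dens h p"
proof -
  have "cmod (f (pt p)) * cmod (h (pt p)) \<le> (cmod (f (pt p)))\<^sup>2 + (cmod (h (pt p)))\<^sup>2"
    using sum_squares_bound[of "cmod (f (pt p))" "cmod (h (pt p))"]
      mult_nonneg_nonneg[OF norm_ge_zero[of "f (pt p)"] norm_ge_zero[of "h (pt p)"]] by linarith
  then show ?thesis
    unfolding theta_integrand_eq sq_dens_def distrib_right[symmetric] using weight_pos[of p]
    by (simp add: norm_mult)
qed

lemma indicator_theta_domain: "indicator theta_domain p = indicator {0..1} (Re (fst p))"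
  by (cases p) (auto simp: theta_domain_def indicator_def)

lemma theta_domain_measurable [measurable]: "(theta_domain :: (complex \<times> (complex^'m)) set) \<in> sets borel"
proof -
  have "(theta_domain :: (complex \<times> (complex^'m)) set) = {p. 0 \<le> Re (fst p)} \<inter> {p. Re (fst p) \<le> 1}"
    by (auto simp: theta_domain_def)
  moreover have "closed \<dots>"
    by (intro closed_Int closed_Collect_le continuous_intros)
  ultimately show ?thesis by simp
qed

lemma continuous_weight: "continuous_on A weight"
  unfolding weight_def by (intro continuous_intros)

lemma continuous_compose_pt:
  assumes "holomorphic_several f" shows "continuous_on A (\<lambda>p. f (pt p))"
  by (rule continuous_on_compose2[OF holomorphic_several_continuous[OF assms] continuous_on_pt]) simp

lemma measurable_sq_dens:
  assumes "holomorphic_several f" shows "sq_dens f \<in> borel_measurable borel"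
  unfolding sq_dens_def
  by (intro borel_measurable_continuous_onI continuous_intros continuous_compose_pt assms continuous_weight)

lemma measurable_theta_integrand:
  assumes "holomorphic_several f" "holomorphic_several h"
  shows "theta_integrand H \<omega> b f h \<in> borel_measurable borel"
proof -
  have "theta_integrand H \<omega> b f h = (\<lambda>p. f (pt p) * cnj (h (pt p)) * of_real (weight p))"
    by (rule ext) (rule theta_integrand_eq)
  also have "\<dots> \<in> borel_measurable borel"
    by (intro borel_measurable_continuous_onI continuous_intros continuous_compose_pt assms continuous_weight)
  finally show ?thesis .
qed

text \<open>The squared norm as an extended real number, which has its correct value \<open>\<infinity>\<close> for functions
  that are not square integrable.\<close>

definition nn_sq :: "(complex^'g \<Rightarrow> complex) \<Rightarrow> ennreal" where
  "nn_sq f = (\<integral>\<^sup>+p. indicator theta_domain p * ennreal (sq_dens f p) \<partial>lborel)"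

lemma indicator_scaleR_ennreal: "ennreal (norm (indicator A p *\<^sub>R (x::'z::real_normed_vector))) = indicator A p * ennreal (norm x)"
  by (simp add: indicator_def)

lemma set_integrable_self_iff:
  assumes f: "holomorphic_several f"
  shows "set_integrable lborel theta_domain (theta_integrand H \<omega> b f f) \<longleftrightarrow> nn_sq f < \<infinity>"
proof -
  note [measurable] = measurable_theta_integrand[OF f f]
  have "(\<integral>\<^sup>+p. ennreal (norm (indicator theta_domain p *\<^sub>R theta_integrand H \<omega> b f f p)) \<partial>lborel) = nn_sq f"
    unfolding nn_sq_def indicator_scaleR_ennreal theta_integrand_self by (simp add: sq_dens_nonneg)
  then show ?thesis unfolding set_integrable_def integrable_iff_bounded by simp
qed

definition quasi_periodic :: "(complex^'g \<Rightarrow> complex) \<Rightarrow> bool" where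
  "quasi_periodic f \<longleftrightarrow> (\<forall>u. \<forall>\<gamma>\<in>rank_one_lattice \<omega>. f (u + \<gamma>) = chi \<gamma> * exp (H (u + (1/2) *s \<gamma>) \<gamma>) * f u)"

lemma mem_F_iff: "f \<in> F \<longleftrightarrow> holomorphic_several f \<and> quasi_periodic f \<and> nn_sq f < \<infinity>"
  unfolding theta_FB_space_def quasi_periodic_def using set_integrable_self_iff by blast

lemma holomorphic_F: "f \<in> F \<Longrightarrow> holomorphic_several f" by (simp add: mem_F_iff)

lemma set_integrable_F:
  assumes "f \<in> F" "h \<in> F"
  shows "set_integrable lborel theta_domain (theta_integrand H \<omega> b f h)"
proof -
  have f: "holomorphic_several f" and h: "holomorphic_several h" using assms by (auto simp: mem_F_iff)
  note [measurable] = measurable_sq_dens[OF f] measurable_sq_dens[OF h] measurable_theta_integrand[OF f h]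
  have "(\<integral>\<^sup>+p. ennreal (norm (indicator theta_domain p *\<^sub>R theta_integrand H \<omega> b f h p)) \<partial>lborel)
      \<le> (\<integral>\<^sup>+p. (indicator theta_domain p * ennreal (sq_dens f p) + indicator theta_domain p * ennreal (sq_dens h p)) \<partial>lborel)"
    unfolding indicator_scaleR_ennreal distrib_left[symmetric]
    by (intro nn_integral_mono mult_left_mono)
      (simp_all add: ennreal_plus[symmetric] sq_dens_nonneg norm_theta_integrand_le del: ennreal_plus)
  also have "\<dots> = nn_sq f + nn_sq h"
    unfolding nn_sq_def by (rule nn_integral_add) measurable
  also have "\<dots> < \<infinity>" using assms by (simp add: mem_F_iff)
  finally show ?thesis unfolding set_integrable_def integrable_iff_bounded by simp
qed

lemma ip_self_eq:
  assumes "f \<in> F"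
  shows "Re (ip f f) \<ge> 0" and "ennreal (Re (ip f f)) = nn_sq f"
proof -
  have f: "holomorphic_several f" using assms by (simp add: mem_F_iff)
  note [measurable] = measurable_sq_dens[OF f]
  have i: "integrable lborel (\<lambda>p. indicator theta_domain p * sq_dens f p)"
    unfolding integrable_iff_bounded
  proof
    have "(\<integral>\<^sup>+p. ennreal (norm (indicator theta_domain p * sq_dens f p)) \<partial>lborel) = nn_sq f"
      unfolding nn_sq_def by (intro nn_integral_cong) (simp add: indicator_def sq_dens_nonneg)
    then show "(\<integral>\<^sup>+p. ennreal (norm (indicator theta_domain p * sq_dens f p)) \<partial>lborel) < \<infinity>"
      using assms by (simp add: mem_F_iff)
  qed measurable
  have "ip f f = (LINT p|lborel. complex_of_real (indicator theta_domain p * sq_dens f p))"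
    unfolding theta_inner_def set_lebesgue_integral_def theta_integrand_self
    by (simp add: scaleR_conv_of_real)
  also have "\<dots> = of_real (LINT p|lborel. indicator theta_domain p * sq_dens f p)"
    by (rule integral_complex_of_real)
  finally have e: "Re (ip f f) = (LINT p|lborel. indicator theta_domain p * sq_dens f p)" by simp
  then show "Re (ip f f) \<ge> 0" by (simp add: sq_dens_nonneg)
  have "nn_sq f = (\<integral>\<^sup>+p. ennreal (indicator theta_domain p * sq_dens f p) \<partial>lborel)"
    unfolding nn_sq_def by (intro nn_integral_cong) (simp add: indicator_def)
  also have "\<dots> = ennreal (LINT p|lborel. indicator theta_domain p * sq_dens f p)"
    by (rule nn_integral_eq_integral[OF i]) (simp add: sq_dens_nonneg)
  finally show "ennreal (Re (ip f f)) = nn_sq f" using e by simp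
qed

end

section \<open>Point evaluations are bounded\<close>

lemma measurable_coordinate_rotation:
  fixes a :: "real \<Rightarrow> complex" and c :: "'m::finite \<Rightarrow> real \<Rightarrow> complex"
  assumes "continuous_on UNIV a" "\<And>i. continuous_on UNIV (c i)"
  shows "(\<lambda>(t, p). coordinate_rotation (a t) (\<lambda>i. c i t) p) \<in> borel \<Otimes>\<^sub>M borel \<rightarrow>\<^sub>M borel"
proof -
  have "(\<lambda>(t, p). coordinate_rotation (a t) (\<lambda>i. c i t) p)
      = (\<lambda>q. (a (fst q) * fst (snd q), \<chi> i. c i (fst q) * snd (snd q) $ i))"
    by (auto simp: coordinate_rotation_def fun_eq_iff)
  moreover have "continuous_on UNIV (\<lambda>q :: real \<times> complex \<times> (complex^'m). a (fst q))"
    by (rule continuous_on_compose2[OF assms(1) continuous_on_fst[OF continuous_on_id]]) simp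
  moreover have "continuous_on UNIV (\<lambda>q :: real \<times> complex \<times> (complex^'m). c i (fst q))" for i
    by (rule continuous_on_compose2[OF assms(2) continuous_on_fst[OF continuous_on_id]]) simp
  ultimately show ?thesis
    unfolding borel_prod
    by (simp only:) (intro borel_measurable_continuous_onI continuous_intros continuous_on_vec_lambda; assumption)
qed

context theta_setting
begin

lemma linear_coords: "linear (coords_of_point \<omega> b)"
proof (rule linearI)
  show "coords_of_point \<omega> b (u + v) = coords_of_point \<omega> b u + coords_of_point \<omega> b v" for u v
    by (metis coords_pt pt_coords pt_add)
  show "coords_of_point \<omega> b (r *\<^sub>R u) = r *\<^sub>R coords_of_point \<omega> b u" for r u
    by (metis coords_pt pt_coords linear_cmul[OF linear_pt])
qed

text \<open>The automorphy factor in coordinates; it does not involve \<open>w\<close> because \<open>w\<close> belongs to the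
  orthogonal complement of \<open>\<omega>\<close>.\<close>

lemma quasi_periodicD:
  assumes "quasi_periodic f"
  shows "f (pt (z + of_int m, w)) = exp (2 * \<i> * of_real pi * of_real \<alpha> * of_int m)
    * exp (of_real \<nu> * (of_int m * z + (of_int m)\<^sup>2 / 2)) * f (pt (z, w))"
proof -
  have p: "pt (z, w) + (1/2) *s (of_int m *s \<omega>) = pt (z + of_int m / 2, w)"
    "pt (z, w) + of_int m *s \<omega> = pt (z + of_int m, w)"
    by (simp_all add: pt_eq vec.scale_left_distrib)
  have "of_int m *s \<omega> \<in> rank_one_lattice \<omega>"
    unfolding rank_one_lattice_def by (rule range_eqI[where x=m]) simp
  then have "f (pt (z, w) + of_int m *s \<omega>)
      = chi (of_int m *s \<omega>) * exp (H (pt (z, w) + (1/2) *s (of_int m *s \<omega>)) (of_int m *s \<omega>)) * f (pt (z, w))"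
    using assms unfolding quasi_periodic_def by blast
  moreover have "H (pt (z + of_int m / 2, w)) (of_int m *s \<omega>) = of_real \<nu> * (of_int m * z + (of_int m)\<^sup>2 / 2)"
    by (simp add: H_scale_right H_pt_\<omega> power2_eq_square algebra_simps)
  ultimately show ?thesis unfolding p chi_eq by simp
qed

text \<open>The absolute value of the automorphy factor is exactly compensated by the change of the weight.\<close>

lemma sq_dens_periodic:
  assumes "quasi_periodic f"
  shows "sq_dens f ((of_int m, 0) + p) = sq_dens f p"
proof -
  obtain z w where p: "p = (z, w)" by (cases p)
  have "cmod (f (pt (z + of_int m, w))) = exp (\<nu> * (m * Re z + (of_int m)\<^sup>2 / 2)) * cmod (f (pt (z, w)))"
    unfolding quasi_periodicD[OF assms] by (simp add: norm_mult)
  then have "(cmod (f (pt (z + of_int m, w))))\<^sup>2 = exp (2 * (\<nu> * (m * Re z + (of_int m)\<^sup>2 / 2))) * (cmod (f (pt (z, w))))\<^sup>2"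
    by (simp add: power_mult_distrib exp_double)
  moreover have "weight (z + of_int m, w) * exp (2 * (\<nu> * (m * Re z + (of_int m)\<^sup>2 / 2))) = weight (z, w)"
    unfolding weight_def norm_coords_square exp_add[symmetric] cmod_power2
    by (simp add: power2_eq_square algebra_simps)
  ultimately show ?thesis by (simp add: sq_dens_def p add.commute mult_ac)
qed

lemma nn_sq_shifted_strip:
  assumes f: "holomorphic_several f" "quasi_periodic f"
  shows "(\<integral>\<^sup>+p. indicator {of_int m..of_int m + 1} (Re (fst p)) * ennreal (sq_dens f p) \<partial>lborel) = nn_sq f"
proof -
  note [measurable] = measurable_sq_dens[OF f(1)]
  have "(\<integral>\<^sup>+p. indicator {of_int m..of_int m + 1} (Re (fst p)) * ennreal (sq_dens f p) \<partial>lborel)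
    = (\<integral>\<^sup>+p. indicator {of_int m..of_int m + 1} (Re (fst ((of_int m, 0) + p))) * ennreal (sq_dens f ((of_int m, 0) + p)) \<partial>lborel)"
    by (rule nn_integral_lborel_translate[symmetric]) measurable
  also have "\<dots> = nn_sq f"
    unfolding nn_sq_def indicator_theta_domain sq_dens_periodic[OF f(2)]
    by (intro nn_integral_cong) (auto simp: indicator_def)
  finally show ?thesis .
qed

text \<open>Averaging over \<open>v \<mapsto> cis \<theta> v\<close>, which preserves the ball, reduces the claim to the mean value
  property on the complex lines through \<open>u\<close>.\<close>

lemma holomorphic_ball_mean:
  assumes f: "holomorphic_several f"
  shows "integrable lborel (\<lambda>v. indicat_real (cball 0 r) v *\<^sub>R f (u + pt v))"
    and "(LINT v|lborel. indicat_real (cball 0 r) v *\<^sub>R f (u + pt v)) = measure lborel (cball (0 :: complex \<times> (complex^'m)) r) *\<^sub>R f u"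
proof -
  define G where "G = (\<lambda>v. indicat_real (cball 0 r) v *\<^sub>R f (u + pt v))"
  have cont: "continuous_on A (\<lambda>v. f (u + pt v))" for A
    by (rule continuous_on_compose2[OF holomorphic_several_continuous[OF f]])
      (auto intro!: continuous_intros continuous_on_pt)
  have G: "integrable lborel G"
    unfolding G_def by (intro borel_integrable_compact cont) auto
  then show "integrable lborel (\<lambda>v. indicat_real (cball 0 r) v *\<^sub>R f (u + pt v))" by (simp add: G_def)
  define R where "R = (\<lambda>t::real. coordinate_rotation (cis (2 * pi * t)) (\<lambda>_::'m. cis (2 * pi * t)))"
  have iso: "linear_isometry (R t)" for t
    unfolding R_def by (rule linear_isometry_coordinate_rotation) auto
  have meas: "(\<lambda>(t, v). R t v) \<in> borel \<Otimes>\<^sub>M borel \<rightarrow>\<^sub>M borel"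
    unfolding R_def by (rule measurable_coordinate_rotation) (intro continuous_intros)+
  have avg: "(LINT t:{0..1}|lborel. G (R t v)) = indicat_real (cball 0 r) v *\<^sub>R f u" for v
  proof -
    have pR: "pt (R t v) = cis (2 * pi * t) *s pt v" for t
      using pt_scale[of "cis (2 * pi * t)" "fst v" "snd v"]
      by (cases v) (simp add: R_def coordinate_rotation_def vector_scalar_mult_def)
    have "norm (R t v) = norm v" for t using iso[of t] unfolding linear_isometry_def by blast
    then have "G (R t v) = of_real (indicat_real (cball 0 r) v) * f (u + cis (2 * pi * t) *s pt v)" for t
      by (simp add: G_def pR indicator_def)
    then have "(LINT t:{0..1}|lborel. G (R t v)) =
        of_real (indicat_real (cball 0 r) v) * (LINT t:{0..1}|lborel. f (u + cis (2 * pi * t) *s pt v))"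
      by simp
    also have "(LINT t:{0..1}|lborel. f (u + cis (2 * pi * t) *s pt v)) = f u"
      using circle_mean_entire[OF holomorphic_several_line[OF f, of u "pt v"]] by simp
    finally show ?thesis by (simp add: scaleR_conv_of_real)
  qed
  have "(LINT v|lborel. G v) = (LINT v|lborel. indicat_real (cball (0 :: complex \<times> (complex^'m)) r) v *\<^sub>R f u)"
    by (rule integral_average_isometries(2)[OF G iso meas avg, symmetric])
  also have "\<dots> = measure lborel (cball (0 :: complex \<times> (complex^'m)) r) *\<^sub>R f u"
  proof -
    have "integrable lborel (indicat_real (cball (0 :: complex \<times> (complex^'m)) r))"
      by (rule integrable_real_indicator[OF _ emeasure_lborel_cball_finite]) simp
    then show ?thesis by (subst integral_scaleR_left) simp_all
  qed
  finally show "(LINT v|lborel. indicat_real (cball 0 r) v *\<^sub>R f (u + pt v))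
      = measure lborel (cball (0 :: complex \<times> (complex^'m)) r) *\<^sub>R f u" by (simp add: G_def)
qed

text \<open>Apply the mean value property to \<open>f\<^sup>2\<close> on a ball of radius \<open>1/2\<close>. On this ball the weight is at
  least \<open>exp (- \<nu> (\<parallel>p\<parallel> + 1)\<^sup>2)\<close>, and the ball is covered by two translates of the fundamental strip,
  each of which contributes at most the squared norm of \<open>f\<close>.\<close>

lemma pointwise_bound:
  assumes f: "holomorphic_several f" "quasi_periodic f"
  shows "ennreal (measure lborel (cball (0 :: complex \<times> (complex^'m)) (1/2)) * (cmod (f (pt p)))\<^sup>2)
    \<le> ennreal (2 * exp (\<nu> * (norm p + 1)\<^sup>2)) * nn_sq f"
proof -
  define B where "B = cball (0 :: complex \<times> (complex^'m)) (1/2)"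
  define K where "K = exp (\<nu> * (norm p + 1)\<^sup>2)"
  \<comment> \<open>The ball lies in the union of the strips \<open>m \<le> Re \<le> m + 1\<close> and \<open>m + 1 \<le> Re \<le> m + 2\<close>.\<close>
  define m where "m = \<lfloor>Re (fst p) - 1/2\<rfloor>"
  note [measurable] = measurable_sq_dens[OF f(1)]
  have K: "K > 0" by (simp add: K_def)
  have [measurable]: "B \<in> sets borel" by (simp add: B_def)
  have "ennreal (measure lborel B * (cmod (f (pt p)))\<^sup>2) = ennreal (norm (LINT v|lborel. indicat_real B v *\<^sub>R (f (pt p + pt v))\<^sup>2))"
    using holomorphic_ball_mean(2)[OF holomorphic_several_power[OF f(1), of 2], of "1/2" "pt p"]
    by (simp add: B_def norm_power)
  also have "\<dots> \<le> (\<integral>\<^sup>+v. ennreal (norm (indicat_real B v *\<^sub>R (f (pt p + pt v))\<^sup>2)) \<partial>lborel)"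
    unfolding B_def by (rule integral_norm_bound_ennreal[OF holomorphic_ball_mean(1)[OF holomorphic_several_power[OF f(1)]]])
  also have "\<dots> \<le> (\<integral>\<^sup>+v. (\<lambda>q. indicator {q. dist p q \<le> 1/2} q * (ennreal K * ennreal (sq_dens f q))) (p + v) \<partial>lborel)"
  proof (rule nn_integral_mono)
    fix v :: "complex \<times> (complex^'m)"
    show "ennreal (norm (indicat_real B v *\<^sub>R (f (pt p + pt v))\<^sup>2))
      \<le> indicator {q. dist p q \<le> 1/2} (p + v) * (ennreal K * ennreal (sq_dens f (p + v)))"
    proof (cases "v \<in> B")
      case True
      then have v: "norm v \<le> 1/2" by (simp add: B_def)
      then have "norm (p + v) \<le> norm p + 1" using norm_triangle_ineq[of p v] by linarith
      then have "\<nu> * (norm (p + v))\<^sup>2 \<le> \<nu> * (norm p + 1)\<^sup>2" using \<nu>_pos by (intro mult_left_mono power_mono) auto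
      then have "1 \<le> K * weight (p + v)" by (simp add: K_def weight_def exp_add[symmetric])
      then have "(cmod (f (pt (p + v))))\<^sup>2 * 1 \<le> (cmod (f (pt (p + v))))\<^sup>2 * (K * weight (p + v))"
        by (rule mult_left_mono) simp
      then have "(cmod (f (pt (p + v))))\<^sup>2 \<le> K * sq_dens f (p + v)" by (simp add: sq_dens_def mult_ac)
      then show ?thesis using True v K
        by (simp add: pt_add norm_power ennreal_mult[symmetric] sq_dens_nonneg dist_norm ennreal_leI)
    qed simp
  qed
  also have "\<dots> = (\<integral>\<^sup>+q. indicator {q. dist p q \<le> 1/2} q * (ennreal K * ennreal (sq_dens f q)) \<partial>lborel)"
    by (rule nn_integral_lborel_translate) measurable
  also have "\<dots> \<le> (\<integral>\<^sup>+q. ennreal K * (indicator {of_int m..of_int m + 1} (Re (fst q)) * ennreal (sq_dens f q)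
      + indicator {of_int (m + 1)..of_int (m + 1) + 1} (Re (fst q)) * ennreal (sq_dens f q)) \<partial>lborel)"
  proof (rule nn_integral_mono)
    fix q
    show "indicator {q. dist p q \<le> 1/2} q * (ennreal K * ennreal (sq_dens f q))
      \<le> ennreal K * (indicator {of_int m..of_int m + 1} (Re (fst q)) * ennreal (sq_dens f q)
      + indicator {of_int (m + 1)..of_int (m + 1) + 1} (Re (fst q)) * ennreal (sq_dens f q))"
    proof (cases "dist p q \<le> 1/2")
      case True
      have "\<bar>Re (fst p - fst q)\<bar> \<le> 1/2"
        using abs_Re_le_cmod[of "fst p - fst q"] dist_fst_le[of p q] True unfolding dist_norm by linarith
      then have "Re (fst p) - 1/2 \<le> Re (fst q)" "Re (fst q) \<le> Re (fst p) - 1/2 + 1"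
        unfolding minus_complex.simps abs_le_iff by linarith+
      then have "of_int m \<le> Re (fst q)" "Re (fst q) \<le> of_int m + 2" unfolding m_def by linarith+
      then have "Re (fst q) \<in> {of_int m..of_int m + 1} \<or> Re (fst q) \<in> {of_int (m + 1)..of_int (m + 1) + 1}"
        by auto
      then show ?thesis
      proof
        assume "Re (fst q) \<in> {of_int m..of_int m + 1}"
        then show ?thesis using True by (simp add: distrib_left)
      next
        assume "Re (fst q) \<in> {of_int (m + 1)..of_int (m + 1) + 1}"
        then show ?thesis using True by (simp add: distrib_left)
      qed
    qed simp
  qed
  also have "\<dots> = ennreal K * (\<integral>\<^sup>+q. (indicator {of_int m..of_int m + 1} (Re (fst q)) * ennreal (sq_dens f q) +
      indicator {of_int (m + 1)..of_int (m + 1) + 1} (Re (fst q)) * ennreal (sq_dens f q)) \<partial>lborel)"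
    by (rule nn_integral_cmult) measurable
  also have "(\<integral>\<^sup>+q. (indicator {of_int m..of_int m + 1} (Re (fst q)) * ennreal (sq_dens f q) +
      indicator {of_int (m + 1)..of_int (m + 1) + 1} (Re (fst q)) * ennreal (sq_dens f q)) \<partial>lborel) = nn_sq f + nn_sq f"
    by (subst nn_integral_add) (measurable, simp only: nn_sq_shifted_strip[OF f])
  also have "ennreal K * (nn_sq f + nn_sq f) = ennreal (2 * K) * nn_sq f"
  proof -
    have "ennreal (2 * K) = 2 * ennreal K" using K by (simp add: ennreal_mult)
    then show ?thesis by (simp only: mult_2 distrib_left distrib_right)
  qed
  finally show ?thesis by (simp add: B_def K_def)
qed

end

section \<open>Completeness\<close>

context theta_setting
begin

lemma quasi_periodic_add:
  assumes "quasi_periodic f" "quasi_periodic h" shows "quasi_periodic (\<lambda>u. f u + c * h u)"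
  using assms unfolding quasi_periodic_def by (simp add: algebra_simps)

lemma quasi_periodic_zero: "quasi_periodic (\<lambda>_. 0)"
  unfolding quasi_periodic_def by simp

lemma holomorphic_several_add_scale:
  "holomorphic_several f \<Longrightarrow> holomorphic_several h \<Longrightarrow> holomorphic_several (\<lambda>u. f u + c * h u)"
  by (intro holomorphic_several_add holomorphic_several_mult holomorphic_several_const)

lemma nn_sq_le:
  assumes "\<And>p. sq_dens f p \<le> 2 * sq_dens h p + 2 * sq_dens k p"
    and h: "holomorphic_several h" and k: "holomorphic_several k"
  shows "nn_sq f \<le> 2 * nn_sq h + 2 * nn_sq k"
proof -
  note [measurable] = measurable_sq_dens[OF h] measurable_sq_dens[OF k]
  have "nn_sq f \<le> (\<integral>\<^sup>+p. (2 * (indicator theta_domain p * ennreal (sq_dens h p)) + 2 * (indicator theta_domain p * ennreal (sq_dens k p))) \<partial>lborel)"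
    unfolding nn_sq_def
  proof (rule nn_integral_mono)
    fix p
    have "ennreal (sq_dens f p) \<le> ennreal (2 * sq_dens h p + 2 * sq_dens k p)"
      by (rule ennreal_leI[OF assms(1)])
    also have "\<dots> = 2 * ennreal (sq_dens h p) + 2 * ennreal (sq_dens k p)"
      by (simp add: ennreal_plus ennreal_mult sq_dens_nonneg)
    finally show "indicator theta_domain p * ennreal (sq_dens f p)
        \<le> 2 * (indicator theta_domain p * ennreal (sq_dens h p)) + 2 * (indicator theta_domain p * ennreal (sq_dens k p))"
      by (cases "p \<in> theta_domain") simp_all
  qed
  also have "\<dots> = 2 * nn_sq h + 2 * nn_sq k"
    unfolding nn_sq_def by (subst nn_integral_add, measurable, subst (1 2) nn_integral_cmult, measurable)
  finally show ?thesis .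
qed

lemma sq_dens_add_le: "sq_dens (\<lambda>u. f u + c * h u) p \<le> 2 * sq_dens f p + 2 * sq_dens (\<lambda>u. c * h u) p"
proof -
  have "(cmod (x + y))\<^sup>2 \<le> 2 * (cmod x)\<^sup>2 + 2 * (cmod y)\<^sup>2" for x y :: complex
  proof -
    have "(cmod (x + y))\<^sup>2 \<le> (cmod x + cmod y)\<^sup>2" by (intro power_mono norm_triangle_ineq) simp
    also have "\<dots> \<le> 2 * (cmod x)\<^sup>2 + 2 * (cmod y)\<^sup>2"
      using sum_squares_bound[of "cmod x" "cmod y"] by (simp add: power2_sum)
    finally show ?thesis .
  qed
  from mult_right_mono[OF this, of "weight p" "f (pt p)" "c * h (pt p)"] show ?thesis
    using weight_pos[of p] by (simp add: sq_dens_def distrib_right)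
qed

lemma nn_sq_scale: 
  assumes h: "holomorphic_several h"
  shows "nn_sq (\<lambda>u. c * h u) = ennreal ((cmod c)\<^sup>2) * nn_sq h"
proof -
  note [measurable] = measurable_sq_dens[OF h]
  have "sq_dens (\<lambda>u. c * h u) p = (cmod c)\<^sup>2 * sq_dens h p" for p
    by (simp add: sq_dens_def norm_mult power_mult_distrib)
  then have "nn_sq (\<lambda>u. c * h u) = (\<integral>\<^sup>+p. ennreal ((cmod c)\<^sup>2) * (indicator theta_domain p * ennreal (sq_dens h p)) \<partial>lborel)"
    unfolding nn_sq_def by (simp add: ennreal_mult sq_dens_nonneg mult_ac)
  then show ?thesis unfolding nn_sq_def by (simp add: nn_integral_cmult)
qed

lemma add_scale_F:
  assumes "f \<in> F" "h \<in> F" shows "(\<lambda>u. f u + c * h u) \<in> F"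
proof -
  have f: "holomorphic_several f" "quasi_periodic f" "nn_sq f < \<infinity>"
    and h: "holomorphic_several h" "quasi_periodic h" "nn_sq h < \<infinity>"
    using assms by (auto simp: mem_F_iff)
  have ch: "holomorphic_several (\<lambda>u. c * h u)"
    by (intro holomorphic_several_mult holomorphic_several_const h)
  have "nn_sq (\<lambda>u. f u + c * h u) \<le> 2 * nn_sq f + 2 * nn_sq (\<lambda>u. c * h u)"
    by (rule nn_sq_le[OF sq_dens_add_le f(1) ch])
  also have "\<dots> < \<infinity>" using f(3) h(3) by (simp add: nn_sq_scale[OF h(1)] ennreal_mult_less_top)
  finally show ?thesis
    using holomorphic_several_add_scale[OF f(1) h(1)] quasi_periodic_add[OF f(2) h(2)] by (simp add: mem_F_iff)
qed

lemma zero_F: "(\<lambda>_. 0) \<in> F"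
  unfolding mem_F_iff using holomorphic_several_const quasi_periodic_zero by (simp add: nn_sq_def sq_dens_def)

lemma ip_add_scale:
  assumes "f \<in> F" "h \<in> F" "k \<in> F"
  shows "ip (\<lambda>u. f u + c * h u) k = ip f k + c * ip h k"
proof -
  have "theta_integrand H \<omega> b (\<lambda>u. f u + c * h u) k p =
      theta_integrand H \<omega> b f k p + c * theta_integrand H \<omega> b h k p" for p
    by (simp add: theta_integrand_eq algebra_simps)
  then have "ip (\<lambda>u. f u + c * h u) k =
      (LINT p:theta_domain|lborel. theta_integrand H \<omega> b f k p + c * theta_integrand H \<omega> b h k p)"
    by (simp add: theta_inner_def)
  also have "\<dots> = ip f k + c * ip h k"
    unfolding theta_inner_def set_integral_mult_right[symmetric]
    by (intro set_integral_add(2) set_integrable_mult_right impI set_integrable_F assms)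
  finally show ?thesis .
qed

lemma ip_cnj_F: "ip h f = cnj (ip f h)"
proof -
  have "cnj (ip f h) = (LINT p|lborel. cnj (indicator theta_domain p *\<^sub>R theta_integrand H \<omega> b f h p))"
    unfolding theta_inner_def set_lebesgue_integral_def by (rule Bochner_Integration.integral_cnj[symmetric])
  also have "\<dots> = ip h f"
    unfolding theta_inner_def set_lebesgue_integral_def
    by (intro Bochner_Integration.integral_cong refl) (simp add: theta_integrand_eq mult_ac)
  finally show ?thesis ..
qed

lemma pointwise_bound_norm:
  assumes f: "f \<in> F"
  shows "cmod (f (pt p)) \<le> sqrt (2 * exp (\<nu> * (norm p + 1)\<^sup>2) / measure lborel (cball (0 :: complex \<times> (complex^'m)) (1/2))) * ip_norm ip f"
proof -
  let ?V = "measure lborel (cball (0 :: complex \<times> (complex^'m)) (1/2))" and ?E = "2 * exp (\<nu> * (norm p + 1)\<^sup>2)"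
  have V: "?V > 0" using content_cball_pos[of "1/2" "0 :: complex \<times> (complex^'m)"] by simp
  have hf: "holomorphic_several f" "quasi_periodic f" using f by (auto simp: mem_F_iff)
  have "ennreal (?V * (cmod (f (pt p)))\<^sup>2) \<le> ennreal ?E * ennreal (Re (ip f f))"
    unfolding ip_self_eq(2)[OF f] by (rule pointwise_bound[OF hf])
  then have "?V * (cmod (f (pt p)))\<^sup>2 \<le> ?E * Re (ip f f)"
    using ip_self_eq(1)[OF f] by (simp add: ennreal_mult[symmetric])
  then have "(cmod (f (pt p)))\<^sup>2 \<le> ?E / ?V * Re (ip f f)" using V by (simp add: field_simps)
  then have "sqrt ((cmod (f (pt p)))\<^sup>2) \<le> sqrt (?E / ?V * Re (ip f f))" by (rule real_sqrt_le_mono)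
  then show ?thesis unfolding ip_norm_def real_sqrt_mult[symmetric] by simp
qed

lemma fun_inner_product_space_F: "fun_inner_product_space F ip"
  unfolding fun_inner_product_space_def
proof (intro conjI allI ballI impI)
  show "(\<lambda>_. 0) \<in> F" by (rule zero_F)
  show "(\<lambda>u. f u + h u) \<in> F" if "f \<in> F" "h \<in> F" for f h using add_scale_F[OF that, of 1] by simp
  show "(\<lambda>u. c * f u) \<in> F" if "f \<in> F" for c f using add_scale_F[OF zero_F that, of c] by simp
  show "ip (\<lambda>u. f u + h u) k = ip f k + ip h k" if "f \<in> F" "h \<in> F" "k \<in> F" for f h k
    using ip_add_scale[OF that, of 1] by simp
  show "ip (\<lambda>u. c * f u) h = c * ip f h" if "f \<in> F" "h \<in> F" for c f h
    using ip_add_scale[OF zero_F that, of c] ip_add_scale[OF zero_F zero_F that(2), of 1] by simp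
  show "ip h f = cnj (ip f h)" for f h by (rule ip_cnj_F)
  fix f assume f: "f \<in> F" "f \<noteq> (\<lambda>_. 0)"
  show "0 < Re (ip f f)"
  proof (rule ccontr)
    assume "\<not> 0 < Re (ip f f)"
    then have "ip_norm ip f = 0" using ip_self_eq(1)[OF f(1)] by (simp add: ip_norm_def)
    then have "f (pt p) = 0" for p using pointwise_bound_norm[OF f(1), of p] by simp
    then have "f u = 0" for u using pt_coords[of u] by metis
    with f(2) show False by auto
  qed
qed

sublocale F: fun_ips F ip
  by (unfold_locales) (rule fun_inner_product_space_F)

text \<open>The coordinates of a point are a linear, hence bounded, function of the point.\<close>

lemma local_bound: "\<exists>C. \<forall>f\<in>F. \<forall>u. norm u \<le> R \<longrightarrow> cmod (f u) \<le> C * ip_norm ip f"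
proof -
  let ?V = "measure lborel (cball (0 :: complex \<times> (complex^'m)) (1/2))"
  have V: "?V > 0" using content_cball_pos[of "1/2" "0 :: complex \<times> (complex^'m)"] by simp
  obtain K where K: "\<And>u. norm (coords_of_point \<omega> b u) \<le> K * norm u" "K > 0"
    using linear_bounded_pos[OF linear_coords] by blast
  define C where "C = sqrt (2 * exp (\<nu> * (K * R + 1)\<^sup>2) / ?V)"
  have "cmod (f u) \<le> C * ip_norm ip f" if f: "f \<in> F" and u: "norm u \<le> R" for f u
  proof -
    let ?p = "coords_of_point \<omega> b u"
    have "norm ?p \<le> K * R" using K(1)[of u] mult_left_mono[OF u, of K] K(2) by linarith
    then have "\<nu> * (norm ?p + 1)\<^sup>2 \<le> \<nu> * (K * R + 1)\<^sup>2" using \<nu>_pos by (intro mult_left_mono power_mono) auto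
    then have "sqrt (2 * exp (\<nu> * (norm ?p + 1)\<^sup>2) / ?V) \<le> C"
      unfolding C_def using V by (simp add: divide_right_mono)
    then have "sqrt (2 * exp (\<nu> * (norm ?p + 1)\<^sup>2) / ?V) * ip_norm ip f \<le> C * ip_norm ip f"
      by (rule mult_right_mono) (rule F.ip_norm_nonneg[OF f])
    then show ?thesis using pointwise_bound_norm[OF f, of ?p] by (simp add: pt_coords)
  qed
  then show ?thesis by blast
qed

text \<open>The pointwise bound makes a Cauchy sequence locally uniformly Cauchy, so it has a holomorphic
  limit, which inherits quasi-periodicity. Fatou's lemma for fixed \<open>m\<close> and \<open>n \<rightarrow> \<infinity>\<close> bounds the
  norm of \<open>X m - f\<close>.\<close>

lemma fun_hilbert_space_F: "fun_hilbert_space F ip"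
  unfolding fun_hilbert_space_def
proof (intro conjI allI impI)
  show "fun_inner_product_space F ip" by (rule fun_inner_product_space_F)
  fix X :: "nat \<Rightarrow> complex^'g \<Rightarrow> complex" assume "\<forall>n. X n \<in> F"
  then have X: "X n \<in> F" for n by blast
  assume Cauchy: "\<forall>\<epsilon>>0. \<exists>N. \<forall>m\<ge>N. \<forall>n\<ge>N. ip_norm ip (\<lambda>u. X m u - X n u) < \<epsilon>"
  have holX: "holomorphic_several (X n)" for n using X by (simp add: mem_F_iff)
  have "\<exists>f. holomorphic_several f \<and> (\<forall>u. (\<lambda>n. X n u) \<longlonglongrightarrow> f u)"
  proof (rule holomorphic_several_limit[OF holX])
    fix R \<epsilon> :: real assume "\<epsilon> > 0"
    obtain C where C: "\<And>f u. f \<in> F \<Longrightarrow> norm u \<le> R \<Longrightarrow> cmod (f u) \<le> C * ip_norm ip f" using local_bound by blast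
    have "\<epsilon> / (\<bar>C\<bar> + 1) > 0" using \<open>\<epsilon> > 0\<close> by (simp add: add_nonneg_pos)
    then obtain N where N: "\<And>m n. m \<ge> N \<Longrightarrow> n \<ge> N \<Longrightarrow> ip_norm ip (\<lambda>u. X m u - X n u) < \<epsilon> / (\<bar>C\<bar> + 1)"
      using Cauchy by blast
    have "cmod (X m u - X n u) \<le> \<epsilon>" if mn: "m \<ge> N" "n \<ge> N" and u: "norm u \<le> R" for m n u
    proof -
      let ?n = "ip_norm ip (\<lambda>u. X m u - X n u)"
      have "cmod (X m u - X n u) \<le> C * ?n" by (rule C[OF F.diff_mem[OF X X] u])
      also have "\<dots> \<le> (\<bar>C\<bar> + 1) * ?n" by (intro mult_right_mono F.ip_norm_nonneg F.diff_mem X) auto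
      also have "\<dots> \<le> (\<bar>C\<bar> + 1) * (\<epsilon> / (\<bar>C\<bar> + 1))" by (intro mult_left_mono less_imp_le[OF N[OF mn]]) auto
      also have "\<dots> = \<epsilon>" by (simp add: field_simps) 
      finally show ?thesis .
    qed
    then show "\<exists>N. \<forall>m\<ge>N. \<forall>n\<ge>N. \<forall>u. norm u \<le> R \<longrightarrow> cmod (X m u - X n u) \<le> \<epsilon>" by blast
  qed
  then obtain f where holf: "holomorphic_several f" and lim: "\<And>u. (\<lambda>n. X n u) \<longlonglongrightarrow> f u" by blast
  have qpf: "quasi_periodic f"
    unfolding quasi_periodic_def
  proof (intro allI ballI)
    fix u \<gamma> assume \<gamma>: "\<gamma> \<in> rank_one_lattice \<omega>"
    let ?c = "chi \<gamma> * exp (H (u + (1/2) *s \<gamma>) \<gamma>)"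
    have "quasi_periodic (X n)" for n using X by (simp add: mem_F_iff)
    then have "X n (u + \<gamma>) = ?c * X n u" for n using \<gamma> unfolding quasi_periodic_def by blast
    then have "(\<lambda>n. X n (u + \<gamma>)) \<longlonglongrightarrow> ?c * f u" by (simp add: tendsto_mult_left lim)
    then show "f (u + \<gamma>) = ?c * f u" using LIMSEQ_unique[OF lim] by blast
  qed
  have hold: "holomorphic_several (\<lambda>u. X m u - f u)" for m
    using holomorphic_several_add_scale[OF holX holf, of m "-1"] by simp
  have qpd: "quasi_periodic (\<lambda>u. X m u - f u)" for m
    using quasi_periodic_add[OF _ qpf, of "X m" "-1"] X[of m] by (simp add: mem_F_iff)
  have est: "\<exists>N. \<forall>m\<ge>N. nn_sq (\<lambda>u. X m u - f u) \<le> ennreal (\<epsilon>\<^sup>2)" if "\<epsilon> > 0" for \<epsilon> :: real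
  proof -
    obtain N where N: "\<And>m n. m \<ge> N \<Longrightarrow> n \<ge> N \<Longrightarrow> ip_norm ip (\<lambda>u. X m u - X n u) < \<epsilon>"
      using Cauchy \<open>\<epsilon> > 0\<close> by blast
    have "nn_sq (\<lambda>u. X m u - f u) \<le> ennreal (\<epsilon>\<^sup>2)" if m: "m \<ge> N" for m
    proof -
      define g where "g = (\<lambda>n p. indicator theta_domain p * ennreal (sq_dens (\<lambda>u. X m u - X n u) p))"
      have [measurable]: "g n \<in> borel_measurable lborel" for n
        unfolding g_def using measurable_sq_dens[OF holomorphic_F[OF F.diff_mem[OF X X]], of m n] by measurable
      have "(\<lambda>n. sq_dens (\<lambda>u. X m u - X n u) p) \<longlonglongrightarrow> sq_dens (\<lambda>u. X m u - f u) p" for p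
        unfolding sq_dens_def by (intro tendsto_intros lim)
      then have "(\<lambda>n. g n p) \<longlonglongrightarrow> indicator theta_domain p * ennreal (sq_dens (\<lambda>u. X m u - f u) p)" for p
        unfolding g_def by (cases "p \<in> theta_domain") (simp_all add: tendsto_ennrealI)
      then have "liminf (\<lambda>n. g n p) = indicator theta_domain p * ennreal (sq_dens (\<lambda>u. X m u - f u) p)" for p
        by (intro lim_imp_Liminf) simp_all
      then have "nn_sq (\<lambda>u. X m u - f u) = (\<integral>\<^sup>+p. liminf (\<lambda>n. g n p) \<partial>lborel)"
        by (simp add: nn_sq_def)
      also have "\<dots> \<le> liminf (\<lambda>n. \<integral>\<^sup>+p. g n p \<partial>lborel)"
        by (rule nn_integral_liminf) measurable
      also have "\<dots> \<le> ennreal (\<epsilon>\<^sup>2)"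
      proof (rule Liminf_le)
        show "\<forall>\<^sub>F n in sequentially. (\<integral>\<^sup>+p. g n p \<partial>lborel) \<le> ennreal (\<epsilon>\<^sup>2)"
          using eventually_ge_at_top[of N]
        proof eventually_elim
          case (elim n)
          have "(\<integral>\<^sup>+p. g n p \<partial>lborel) = ennreal (Re (ip (\<lambda>u. X m u - X n u) (\<lambda>u. X m u - X n u)))"
            using ip_self_eq(2)[OF F.diff_mem[OF X X], of m n] by (simp add: nn_sq_def g_def)
          also have "\<dots> = ennreal ((ip_norm ip (\<lambda>u. X m u - X n u))\<^sup>2)"
            by (simp add: F.ip_norm_square F.diff_mem X)
          also have "\<dots> \<le> ennreal (\<epsilon>\<^sup>2)"
            by (intro ennreal_leI power_mono less_imp_le[OF N[OF m elim]] F.ip_norm_nonneg F.diff_mem X)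
          finally show ?case .
        qed
      qed simp
      finally show ?thesis .
    qed
    then show ?thesis by blast
  qed
  have memd: "(\<lambda>u. X m u - f u) \<in> F" if "nn_sq (\<lambda>u. X m u - f u) \<le> ennreal c" for m c
    using that hold[of m] qpd[of m] by (simp add: mem_F_iff le_less_trans)
  obtain N where "nn_sq (\<lambda>u. X N u - f u) \<le> ennreal (1\<^sup>2)" using est[of 1] by auto
  from F.diff_mem[OF X memd[OF this], of N] have fF: "f \<in> F" by simp
  have "(\<lambda>n. ip_norm ip (\<lambda>u. X n u - f u)) \<longlonglongrightarrow> 0"
  proof (rule LIMSEQ_I)
    fix \<epsilon> :: real assume "\<epsilon> > 0"
    then obtain N where N: "\<And>m. m \<ge> N \<Longrightarrow> nn_sq (\<lambda>u. X m u - f u) \<le> ennreal ((\<epsilon>/2)\<^sup>2)"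
      using est[of "\<epsilon>/2"] by auto
    have "norm (ip_norm ip (\<lambda>u. X m u - f u) - 0) < \<epsilon>" if m: "m \<ge> N" for m
    proof -
      have d: "(\<lambda>u. X m u - f u) \<in> F" by (rule F.diff_mem[OF X fF])
      have "ennreal ((ip_norm ip (\<lambda>u. X m u - f u))\<^sup>2) \<le> ennreal ((\<epsilon>/2)\<^sup>2)"
        using N[OF m] unfolding F.ip_norm_square[OF d] ip_self_eq(2)[OF d] .
      then have "(ip_norm ip (\<lambda>u. X m u - f u))\<^sup>2 \<le> (\<epsilon>/2)\<^sup>2"
        by (subst (asm) ennreal_le_iff) auto
      then have "ip_norm ip (\<lambda>u. X m u - f u) \<le> \<epsilon>/2"
        by (rule power2_le_imp_le) (use \<open>\<epsilon> > 0\<close> in simp)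
      then show ?thesis using F.ip_norm_nonneg[OF d] \<open>\<epsilon> > 0\<close> by simp
    qed
    then show "\<exists>N. \<forall>m\<ge>N. norm (ip_norm ip (\<lambda>u. X m u - f u) - 0) < \<epsilon>" by blast
  qed
  with fF show "\<exists>f\<in>F. (\<lambda>n. ip_norm ip (\<lambda>u. X n u - f u)) \<longlonglongrightarrow> 0" by blast
qed

end

section \<open>The basis functions: norms and orthogonality\<close>

lemma exp_2pi_int: "exp ((2 * of_int j * of_real pi) * \<i>) = 1"
proof -
  have "exp ((2 * of_int j * of_real pi) * \<i>) = cis (2 * pi * of_int j)"
    by (simp add: cis_conv_exp mult_ac)
  then show ?thesis by (simp add: cis_multiple_2pi)
qed

lemma ennreal_mult_prod:
  "0 \<le> A \<Longrightarrow> (\<And>i. 0 \<le> f i) \<Longrightarrow> ennreal (A * (\<Prod>i\<in>I. f i)) = ennreal A * (\<Prod>i\<in>I. ennreal (f i))"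
  by (subst ennreal_mult) (simp_all add: prod_nonneg prod_ennreal)

context theta_setting
begin

abbreviation "e \<equiv> theta_basis \<omega> b \<alpha> \<nu>"

definition z_factor :: "int \<Rightarrow> complex \<Rightarrow> complex" where
  "z_factor n z = exp (of_real (\<nu> / 2) * z\<^sup>2 + 2 * \<i> * of_real pi * of_real (\<alpha> + of_int n) * z)"

lemma e_pt: "e (n, k) (pt p) = z_factor n (fst p) * (\<Prod>i\<in>UNIV. (snd p $ i) ^ k i)"
  by (simp add: theta_basis_def coords_pt z_factor_def split_beta)

text \<open>The quadratic terms of the two factors add up to \<open>\<nu> (x\<^sup>2 - y\<^sup>2)\<close>, so together with the weight the
  \<open>x\<close>-dependence is only a character.\<close>

lemma z_factor_mult_cnj:
  "z_factor n z * cnj (z_factor n' z) * of_real (exp (- \<nu> * (cmod z)\<^sup>2)) =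
    cis (2 * pi * of_int (n - n') * Re z) * of_real (exp (- 2 * \<nu> * (Im z)\<^sup>2 - 2 * pi * (2 * \<alpha> + n + n') * Im z))"
proof -
  have exps: "exp A * cnj (exp A') * of_real (exp r) = exp (A + cnj A' + of_real r)" for A A' :: complex and r
    by (simp only: exp_add exp_cnj of_real_exp)
  have "z_factor n z * cnj (z_factor n' z) * of_real (exp (- \<nu> * (cmod z)\<^sup>2)) =
    exp (of_real (\<nu> / 2) * z\<^sup>2 + 2 * \<i> * of_real pi * of_real (\<alpha> + of_int n) * z
      + cnj (of_real (\<nu> / 2) * z\<^sup>2 + 2 * \<i> * of_real pi * of_real (\<alpha> + of_int n') * z) + of_real (- \<nu> * (cmod z)\<^sup>2))"
    unfolding z_factor_def by (rule exps)
  also have "\<dots> = exp (\<i> * of_real (2 * pi * of_int (n - n') * Re z) + of_real (- 2 * \<nu> * (Im z)\<^sup>2 - 2 * pi * (2 * \<alpha> + n + n') * Im z))"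
    unfolding cmod_power2
    by (rule arg_cong[where f=exp]) (simp add: complex_eq_iff power2_eq_square algebra_simps)
  also have "\<dots> = cis (2 * pi * of_int (n - n') * Re z) * of_real (exp (- 2 * \<nu> * (Im z)\<^sup>2 - 2 * pi * (2 * \<alpha> + n + n') * Im z))"
    unfolding exp_add cis_conv_exp of_real_exp ..
  finally show ?thesis .
qed

lemma cmod_z_factor_square:
  "(cmod (z_factor n z))\<^sup>2 * exp (- \<nu> * (cmod z)\<^sup>2) = exp (2 * (- 2 * pi * (\<alpha> + n)) * Im z - (2 * \<nu>) * (Im z)\<^sup>2)"
proof -
  have "complex_of_real ((cmod (z_factor n z))\<^sup>2 * exp (- \<nu> * (cmod z)\<^sup>2)) =
      of_real (exp (- 2 * \<nu> * (Im z)\<^sup>2 - 2 * pi * (2 * \<alpha> + n + n) * Im z))"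
    unfolding of_real_mult complex_norm_square z_factor_mult_cnj by simp
  then have "(cmod (z_factor n z))\<^sup>2 * exp (- \<nu> * (cmod z)\<^sup>2) = exp (- 2 * \<nu> * (Im z)\<^sup>2 - 2 * pi * (2 * \<alpha> + n + n) * Im z)"
    by (simp only: of_real_eq_iff)
  also have "- 2 * \<nu> * (Im z)\<^sup>2 - 2 * pi * (2 * \<alpha> + n + n) * Im z = 2 * (- 2 * pi * (\<alpha> + n)) * Im z - (2 * \<nu>) * (Im z)\<^sup>2"
    by (simp add: algebra_simps)
  finally show ?thesis .
qed

lemma weight_split: "weight p = exp (- \<nu> * (cmod (fst p))\<^sup>2) * (\<Prod>i\<in>UNIV. exp (- \<nu> * (cmod (snd p $ i))\<^sup>2))"
  unfolding weight_def norm_coords_square exp_sum[OF finite, symmetric] exp_add[symmetric]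
  by (simp add: sum_distrib_left distrib_left sum_negf)

lemma holomorphic_e: "holomorphic_several (e (n, k))"
proof -
  have eq: "e (n, k) = (\<lambda>u. exp (of_real (\<nu> / 2) * (H u \<omega> / of_real \<nu>) ^ 2 + 2 * \<i> * of_real pi * of_real (\<alpha> + of_int n) * (H u \<omega> / of_real \<nu>))
      * (\<Prod>i\<in>UNIV. (H u (b i) / of_real \<nu>) ^ k i))"
    by (rule ext) (simp only: theta_basis_def coords_eq Let_def prod.case vec_lambda_beta)
  have lin: "holomorphic_several (\<lambda>u. H u v / of_real \<nu>)" for v
    by (rule holomorphic_several_linear) (simp_all add: H_add_left H_scale_left add_divide_distrib)
  show ?thesis
    unfolding eq by (intro lin holomorphic_several_mult holomorphic_several_exp holomorphic_several_add
        holomorphic_several_power holomorphic_several_prod holomorphic_several_const finite)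
qed

lemma quasi_periodicI:
  assumes "\<And>m z w. f (pt (z + of_int m, w)) = exp (2 * \<i> * of_real pi * of_real \<alpha> * of_int m)
    * exp (of_real \<nu> * (of_int m * z + (of_int m)\<^sup>2 / 2)) * f (pt (z, w))"
  shows "quasi_periodic f"
  unfolding quasi_periodic_def
proof (intro allI ballI)
  fix u \<gamma> assume "\<gamma> \<in> rank_one_lattice \<omega>"
  then obtain m :: int where \<gamma>: "\<gamma> = of_int m *s \<omega>" by (auto simp: rank_one_lattice_def)
  obtain z w where u: "u = pt (z, w)" using pt_coords[of u] by (metis surj_pair)
  have p: "pt (z, w) + (1/2) *s (of_int m *s \<omega>) = pt (z + of_int m / 2, w)"
    "pt (z, w) + of_int m *s \<omega> = pt (z + of_int m, w)"
    by (simp_all add: pt_eq vec.scale_left_distrib)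
  have "H (pt (z + of_int m / 2, w)) (of_int m *s \<omega>) = of_real \<nu> * (of_int m * z + (of_int m)\<^sup>2 / 2)"
    by (simp add: H_scale_right H_pt_\<omega> power2_eq_square algebra_simps)
  then show "f (u + \<gamma>) = chi \<gamma> * exp (H (u + (1/2) *s \<gamma>) \<gamma>) * f u"
    unfolding u \<gamma> p chi_eq assms by simp
qed

lemma quasi_periodic_e: "quasi_periodic (e (n, k))"
proof (rule quasi_periodicI)
  fix m :: int and z w
  have "of_real (\<nu> / 2) * (z + of_int m)\<^sup>2 + 2 * \<i> * of_real pi * of_real (\<alpha> + of_int n) * (z + of_int m)
    = 2 * \<i> * of_real pi * of_real \<alpha> * of_int m + of_real \<nu> * (of_int m * z + (of_int m)\<^sup>2 / 2)
      + (of_real (\<nu> / 2) * z\<^sup>2 + 2 * \<i> * of_real pi * of_real (\<alpha> + of_int n) * z) + (2 * of_int (n * m) * of_real pi) * \<i>"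
    by (simp add: power2_eq_square field_simps)
  then have "z_factor n (z + of_int m) = exp (2 * \<i> * of_real pi * of_real \<alpha> * of_int m)
    * exp (of_real \<nu> * (of_int m * z + (of_int m)\<^sup>2 / 2)) * z_factor n z * exp ((2 * of_int (n * m) * of_real pi) * \<i>)"
    unfolding z_factor_def by (simp only: exp_add)
  then show "e (n, k) (pt (z + of_int m, w)) = exp (2 * \<i> * of_real pi * of_real \<alpha> * of_int m)
    * exp (of_real \<nu> * (of_int m * z + (of_int m)\<^sup>2 / 2)) * e (n, k) (pt (z, w))"
    unfolding e_pt exp_2pi_int by (simp only: fst_conv snd_conv mult_1_right mult_1_left mult_ac)
qed

lemma sq_dens_e:
  "sq_dens (e (n, k)) p = exp (2 * (- 2 * pi * (\<alpha> + n)) * Im (fst p) - (2 * \<nu>) * (Im (fst p))\<^sup>2)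
     * (\<Prod>i\<in>UNIV. (cmod (snd p $ i) ^ k i)\<^sup>2 * exp (- \<nu> * (cmod (snd p $ i))\<^sup>2))"
  unfolding cmod_z_factor_square[symmetric] prod.distrib sq_dens_def e_pt weight_split
  by (simp add: norm_mult prod_norm[symmetric] norm_power power_mult_distrib prod_power_distrib mult_ac)

lemma nn_sq_e:
  "nn_sq (e (n, k)) = ennreal (sqrt (pi / (2 * \<nu>)) * exp ((- 2 * pi * (\<alpha> + n))\<^sup>2 / (2 * \<nu>)) * (\<Prod>i\<in>UNIV. pi * fact (k i) / \<nu> ^ (k i + 1)))"
proof -
  define g where "g = (\<lambda>i z. ennreal ((cmod z ^ k i)\<^sup>2 * exp (- \<nu> * (cmod z)\<^sup>2)))"
  have [measurable]: "g i \<in> borel_measurable borel" for i unfolding g_def by measurable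
  have "nn_sq (e (n, k)) = (\<integral>\<^sup>+p. indicator {0..1} (Re (fst p)) *
      (ennreal (exp (2 * (- 2 * pi * (\<alpha> + n)) * Im (fst p) - (2 * \<nu>) * (Im (fst p))\<^sup>2))
        * (\<Prod>i\<in>UNIV. g i (snd p $ i))) \<partial>lborel)"
    unfolding nn_sq_def sq_dens_e indicator_theta_domain g_def
    by (intro nn_integral_cong, subst ennreal_mult_prod) simp_all
  also have "\<dots> = ennreal (sqrt (pi / (2 * \<nu>)) * exp ((- 2 * pi * (\<alpha> + n))\<^sup>2 / (2 * \<nu>))) * (\<Prod>i\<in>UNIV. \<integral>\<^sup>+z. g i z \<partial>lborel)"
    by (rule nn_integral_strip_Gaussian) (use \<nu>_pos in simp, measurable)
  also have "\<dots> = ennreal (sqrt (pi / (2 * \<nu>)) * exp ((- 2 * pi * (\<alpha> + n))\<^sup>2 / (2 * \<nu>))) * (\<Prod>i\<in>UNIV. ennreal (pi * fact (k i) / \<nu> ^ (k i + 1)))"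
    unfolding g_def nn_integral_complex_Gaussian_moment[OF \<nu>_pos] ..
  also have "\<dots> = ennreal (sqrt (pi / (2 * \<nu>)) * exp ((- 2 * pi * (\<alpha> + n))\<^sup>2 / (2 * \<nu>)) * (\<Prod>i\<in>UNIV. pi * fact (k i) / \<nu> ^ (k i + 1)))"
    by (rule ennreal_mult_prod[symmetric]) (use \<nu>_pos in auto)
  finally show ?thesis .
qed

lemma e_F: "e (n, k) \<in> F"
  unfolding mem_F_iff using holomorphic_e quasi_periodic_e by (simp add: nn_sq_e)

lemma ip_e_self:
  "ip (e (n, k)) (e (n, k)) = of_real (sqrt (pi / (2 * \<nu>)) * exp ((- 2 * pi * (\<alpha> + n))\<^sup>2 / (2 * \<nu>)) * (\<Prod>i\<in>UNIV. pi * fact (k i) / \<nu> ^ (k i + 1)))"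
    (is "_ = of_real ?N")
proof -
  have "?N \<ge> 0" using \<nu>_pos by (intro mult_nonneg_nonneg prod_nonneg) auto
  moreover have "ennreal (Re (ip (e (n, k)) (e (n, k)))) = ennreal ?N"
    unfolding ip_self_eq(2)[OF e_F] nn_sq_e ..
  ultimately have "Re (ip (e (n, k)) (e (n, k))) = ?N"
    using ip_self_eq(1)[OF e_F[of n k]] by (simp add: ennreal_inj)
  then show ?thesis using F.ip_self[OF e_F[of n k]] by metis
qed

text \<open>Each coordinate of \<open>w\<close> contributes \<open>\<pi> / \<nu> = 2 \<pi> (1 / (2 \<nu>))\<close>, and the integral over \<open>y\<close> contributes
  \<open>sqrt (\<pi> / (2 \<nu>)) = sqrt (2 \<pi> \<nu>) (1 / (2 \<nu>))\<close>, which explains the exponents of \<open>2 \<pi>\<close> and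
  \<open>1 / (2 \<nu>)\<close>.\<close>

lemma norm_e_formula:
  assumes "CARD('g) = CARD('m) + 1"
  shows "ip (e (n, k)) (e (n, k)) = of_real ((2 * pi) ^ (CARD('g) - 1) *
          (sqrt (2 * pi * \<nu>) * (1 / (2 * \<nu>)) ^ CARD('g) * (1 / \<nu>) ^ multi_degree k *
           real (multi_fact k) * exp (2 * pi^2 / \<nu> * (of_int n + \<alpha>)^2)))"
proof -
  have 1: "sqrt (pi / (2 * \<nu>)) = sqrt (2 * pi * \<nu>) / (2 * \<nu>)"
  proof (rule real_sqrt_unique)
    show "(sqrt (2 * pi * \<nu>) / (2 * \<nu>))\<^sup>2 = pi / (2 * \<nu>)"
      using \<nu>_pos by (simp add: power_divide) (simp add: power2_eq_square field_simps)
  qed (use \<nu>_pos in auto)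
  have 2: "(- 2 * pi * (\<alpha> + n))\<^sup>2 / (2 * \<nu>) = 2 * pi^2 / \<nu> * (of_int n + \<alpha>)^2"
    using \<nu>_pos by (simp add: power2_eq_square field_simps)
  have 3: "(\<Prod>i\<in>UNIV. pi * fact (k i) / \<nu> ^ (k i + 1)) = (pi / \<nu>) ^ CARD('m) * (1 / \<nu>) ^ multi_degree k * real (multi_fact k)"
  proof -
    have "(\<Prod>i\<in>UNIV. pi * fact (k i) / \<nu> ^ (k i + 1)) = (\<Prod>i\<in>UNIV. (pi / \<nu>) * (1 / \<nu>) ^ k i * fact (k i))"
      by (intro prod.cong refl) (simp add: power_one_over field_simps)
    also have "\<dots> = (pi / \<nu>) ^ CARD('m) * (1 / \<nu>) ^ multi_degree k * real (multi_fact k)"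
      unfolding prod.distrib prod_constant multi_degree_def multi_fact_def power_sum of_nat_prod of_nat_fact ..
    finally show ?thesis .
  qed
  have 4: "(pi / \<nu>) ^ CARD('m) * (1 / (2 * \<nu>)) = (2 * pi) ^ (CARD('g) - 1) * (1 / (2 * \<nu>)) ^ CARD('g)"
    unfolding assms using \<nu>_pos by (simp add: power_mult_distrib power_divide power_one_over)
  have "sqrt (pi / (2 * \<nu>)) * exp ((- 2 * pi * (\<alpha> + n))\<^sup>2 / (2 * \<nu>)) * (\<Prod>i\<in>UNIV. pi * fact (k i) / \<nu> ^ (k i + 1))
    = ((pi / \<nu>) ^ CARD('m) * (1 / (2 * \<nu>))) * (sqrt (2 * pi * \<nu>) * (1 / \<nu>) ^ multi_degree k *
           real (multi_fact k) * exp (2 * pi^2 / \<nu> * (of_int n + \<alpha>)^2))"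
    unfolding 1 2 3 by simp
  also have "\<dots> = (2 * pi) ^ (CARD('g) - 1) *
          (sqrt (2 * pi * \<nu>) * (1 / (2 * \<nu>)) ^ CARD('g) * (1 / \<nu>) ^ multi_degree k *
           real (multi_fact k) * exp (2 * pi^2 / \<nu> * (of_int n + \<alpha>)^2))"
    unfolding 4 by (simp only: mult_ac)
  finally show ?thesis unfolding ip_e_self by (rule arg_cong)
qed

text \<open>If \<open>k i \<noteq> k' i\<close>, the rotation of the \<open>i\<close>-th coordinate of \<open>w\<close> by \<open>\<pi> / (k i - k' i)\<close> changes the sign
  of the integrand. If \<open>n \<noteq> n'\<close>, the integral over \<open>x\<close> vanishes for all \<open>y\<close> and \<open>w\<close>.\<close>

lemma e_orthogonal:
  assumes "(n, k) \<noteq> (n', k')"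
  shows "ip (e (n, k)) (e (n', k')) = 0"
proof -
  define Q where "Q = (\<lambda>p. indicator theta_domain p *\<^sub>R theta_integrand H \<omega> b (e (n, k)) (e (n', k')) p)"
  have Q: "integrable lborel Q"
    using set_integrable_F[OF e_F e_F] unfolding set_integrable_def Q_def .
  have ipQ: "ip (e (n, k)) (e (n', k')) = (LINT p|lborel. Q p)"
    by (simp add: theta_inner_def set_lebesgue_integral_def Q_def)
  show ?thesis
  proof (cases "k = k'")
    case False
    then obtain i where i: "k i \<noteq> k' i" by auto
    define \<theta> where "\<theta> = pi / (real (k i) - real (k' i))"
    define c where "c = (\<lambda>j. if j = i then cis \<theta> else 1)"
    define R where "R = coordinate_rotation 1 c"
    have R: "linear_isometry R" unfolding R_def c_def by (rule linear_isometry_coordinate_rotation) auto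
    have pow: "(\<Prod>j\<in>UNIV. (c j) ^ l j) = cis (\<theta> * l i)" for l :: "'m \<Rightarrow> nat"
      by (simp add: c_def if_distrib[of "\<lambda>x. x ^ _"] Complex.DeMoivre mult.commute cong: if_cong)
    have eR: "e (n, l) (pt (R p)) = cis (\<theta> * l i) * e (n, l) (pt p)" for n l p
      unfolding e_pt by (cases p) (simp add: R_def coordinate_rotation_def power_mult_distrib prod.distrib pow)
    have "norm (R p) = norm p" for p using R unfolding linear_isometry_def by blast
    then have wR: "weight (R p) = weight p" for p by (simp add: weight_def)
    have "\<theta> * (real (k i) - real (k' i)) = pi" using i by (simp add: \<theta>_def)
    then have "\<theta> * k i - \<theta> * k' i = pi" by (simp only: right_diff_distrib)
    then have m1: "cis (\<theta> * k i) * cnj (cis (\<theta> * k' i)) = -1" by (simp add: cis_cnj cis_mult)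
    have "Q (R p) = - Q p" for p
    proof -
      have "indicat_real theta_domain (R p) = indicator theta_domain p"
        unfolding indicator_theta_domain by (cases p) (simp add: R_def coordinate_rotation_def)
      moreover have "theta_integrand H \<omega> b (e (n, k)) (e (n', k')) (R p)
        = (cis (\<theta> * k i) * cnj (cis (\<theta> * k' i))) * theta_integrand H \<omega> b (e (n, k)) (e (n', k')) p"
        unfolding theta_integrand_eq eR wR by (simp only: complex_cnj_mult mult_ac)
      ultimately show ?thesis unfolding Q_def m1 by simp
    qed
    then have "(LINT p|lborel. Q p) = - (LINT p|lborel. Q p)"
      using integrable_linear_isometry(2)[OF R Q] by simp
    then show ?thesis unfolding ipQ by simp
  next
    case True
    then have n: "n \<noteq> n'" using assms by simp
    have slice: "(LINT x|lborel. Q (Complex x y, w)) = 0" for y w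
    proof -
      define A where "A = (\<Prod>i\<in>UNIV. (w $ i) ^ k i) * cnj (\<Prod>i\<in>UNIV. (w $ i) ^ k' i)
        * of_real (\<Prod>i\<in>UNIV. exp (- \<nu> * (cmod (w $ i))\<^sup>2))
        * of_real (exp (- 2 * \<nu> * y\<^sup>2 - 2 * pi * (2 * \<alpha> + n + n') * y))"
      have "theta_integrand H \<omega> b (e (n, k)) (e (n', k')) (Complex x y, w) = A * cis (2 * pi * of_int (n - n') * x)" for x
      proof -
        have "theta_integrand H \<omega> b (e (n, k)) (e (n', k')) (Complex x y, w) =
          (\<Prod>i\<in>UNIV. (w $ i) ^ k i) * cnj (\<Prod>i\<in>UNIV. (w $ i) ^ k' i)
          * of_real (\<Prod>i\<in>UNIV. exp (- \<nu> * (cmod (w $ i))\<^sup>2)) *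
          (z_factor n (Complex x y) * cnj (z_factor n' (Complex x y)) * of_real (exp (- \<nu> * (cmod (Complex x y))\<^sup>2)))"
          unfolding theta_integrand_eq e_pt weight_split fst_conv snd_conv of_real_mult complex_cnj_mult by (simp only: mult_ac)
        then show ?thesis unfolding z_factor_mult_cnj A_def by (simp add: mult_ac)
      qed
      then have "(LINT x|lborel. Q (Complex x y, w)) = (LINT x:{0..1}|lborel. A * cis (2 * pi * of_int (n - n') * x))"
        unfolding Q_def set_lebesgue_integral_def indicator_theta_domain by simp
      also have "\<dots> = A * 0"
        unfolding set_integral_mult_right using circle_character_integral[of "n - n'"] n by simp
      finally show ?thesis by simp
    qed
    show ?thesis unfolding ipQ integral_slice(2)[where c="\<lambda>_. 0", OF Q slice] by simp
  qed
qed

end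

section \<open>Totality of the basis functions\<close>

definition exp_partial :: "nat \<Rightarrow> complex \<Rightarrow> complex" where
  "exp_partial N x = (\<Sum>j<N. x ^ j / fact j)"

lemma exp_partial_tendsto: "(\<lambda>N. exp_partial N x) \<longlonglongrightarrow> exp x"
  using exp_converges[of x] unfolding sums_def exp_partial_def
  by (simp add: scaleR_conv_of_real divide_inverse mult.commute)

lemma cmod_exp_partial_le: "cmod (exp_partial N x) \<le> exp (cmod x)"
proof -
  have "cmod (exp_partial N x) \<le> (\<Sum>j<N. cmod x ^ j / fact j)"
    unfolding exp_partial_def by (rule sum_norm_le) (simp add: norm_divide norm_power)
  also have "\<dots> \<le> exp (cmod x)"
  proof -
    have s: "(\<lambda>j. cmod x ^ j / fact j) sums exp (cmod x)"
      using exp_converges[of "cmod x"] by (simp add: divide_inverse mult.commute)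
    show ?thesis
      unfolding sums_unique[OF s] by (rule sum_le_suminf[OF sums_summable[OF s]]) auto
  qed
  finally show ?thesis .
qed

context theta_setting
begin

text \<open>The periodic part of \<open>z \<mapsto> f (pt (z, a))\<close>.\<close>

definition reduced :: "(complex^'g \<Rightarrow> complex) \<Rightarrow> complex^'m \<Rightarrow> complex \<Rightarrow> complex" where
  "reduced f a z = f (pt (z, a)) * exp (- (of_real (\<nu> / 2) * z\<^sup>2 + 2 * \<i> * of_real pi * of_real \<alpha> * z))"

lemma reduced_z_factor: "f (pt (z, a)) = reduced f a z * z_factor 0 z"
  unfolding reduced_def z_factor_def by (simp add: mult.assoc exp_add[symmetric])

lemma reduced_holomorphic:
  assumes "holomorphic_several f" shows "reduced f a holomorphic_on UNIV"
proof -
  have p: "pt (z, a) = pt (0, a) + z *s \<omega>" for z by (simp add: pt_eq)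
  have eq: "reduced f a = (\<lambda>z. f (pt (0, a) + z *s \<omega>) * exp (- (of_real (\<nu> / 2) * z\<^sup>2 + 2 * \<i> * of_real pi * of_real \<alpha> * z)))"
    by (rule ext) (unfold reduced_def, subst p, rule refl)
  show ?thesis unfolding eq by (intro holomorphic_intros holomorphic_several_line assms)
qed

lemma reduced_periodic:
  assumes "quasi_periodic f" shows "reduced f a (z + 1) = reduced f a z"
proof -
  have "2 * \<i> * of_real pi * of_real \<alpha> + of_real \<nu> * (z + 1 / 2)
      + - (of_real (\<nu> / 2) * (z + 1)\<^sup>2 + 2 * \<i> * of_real pi * of_real \<alpha> * (z + 1))
    = - (of_real (\<nu> / 2) * z\<^sup>2 + 2 * \<i> * of_real pi * of_real \<alpha> * z)"
    by (simp add: power2_eq_square field_simps)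
  then have E: "exp (2 * \<i> * of_real pi * of_real \<alpha>) * exp (of_real \<nu> * (z + 1 / 2))
      * exp (- (of_real (\<nu> / 2) * (z + 1)\<^sup>2 + 2 * \<i> * of_real pi * of_real \<alpha> * (z + 1)))
    = exp (- (of_real (\<nu> / 2) * z\<^sup>2 + 2 * \<i> * of_real pi * of_real \<alpha> * z))"
    unfolding exp_add[symmetric] by simp
  have "f (pt (z + 1, a)) = exp (2 * \<i> * of_real pi * of_real \<alpha>) * exp (of_real \<nu> * (z + 1 / 2)) * f (pt (z, a))"
    using quasi_periodicD[OF assms, of z 1 a] by simp
  then show ?thesis unfolding reduced_def E[symmetric] by (simp only: mult_ac)
qed

text \<open>On the horizontal line at height \<open>y\<close>, the function \<open>exp (- 2 \<pi> i n z)\<close> is a character of \<open>x\<close> times a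
  nonzero constant, so the hypothesis is about ordinary Fourier coefficients.\<close>

lemma reduced_zero:
  assumes f: "holomorphic_several f" "quasi_periodic f"
    and coeff: "\<And>n::int. (LINT x:{0..1}|lborel. reduced f a (Complex x 0 + \<i> * of_real y) * exp (- 2 * \<i> * of_real pi * of_int n * (Complex x 0 + \<i> * of_real y))) = 0"
  shows "reduced f a (Complex x 0 + \<i> * of_real y) = 0"
proof -
  define \<phi> where "\<phi> = (\<lambda>x. reduced f a (Complex x 0 + \<i> * of_real y))"
  have cx: "Complex x 0 = of_real x" for x by (simp add: complex_eq_iff)
  have cont: "continuous_on UNIV \<phi>"
    unfolding \<phi>_def cx
    by (rule continuous_on_compose2[OF holomorphic_on_imp_continuous_on[OF reduced_holomorphic[OF f(1)]]])
      (auto intro!: continuous_intros)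
  have per: "\<phi> (x + 1) = \<phi> x" for x
    using reduced_periodic[OF f(2), of a "of_real x + \<i> * of_real y"] by (simp add: \<phi>_def cx add_ac)
  have zero: "(LINT x:{0..1}|lborel. \<phi> x * cis (2 * pi * of_int n * x)) = 0" for n :: int
  proof -
    have "reduced f a (Complex x 0 + \<i> * of_real y) * exp (- 2 * \<i> * of_real pi * of_int (- n) * (Complex x 0 + \<i> * of_real y))
      = exp (- 2 * of_real pi * of_int n * of_real y) * (\<phi> x * cis (2 * pi * of_int n * x))" for x
    proof -
      have "- 2 * \<i> * of_real pi * of_int (- n) * (Complex x 0 + \<i> * of_real y)
        = - 2 * of_real pi * of_int n * of_real y + \<i> * of_real (2 * pi * of_int n * x)"
        unfolding cx by (simp add: algebra_simps)
      then show ?thesis unfolding \<phi>_def cis_conv_exp by (simp only: exp_add mult_ac)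
    qed
    then have "exp (- 2 * of_real pi * of_int n * of_real y) * (LINT x:{0..1}|lborel. \<phi> x * cis (2 * pi * of_int n * x)) = 0"
      using coeff[of "- n"] by (simp only: set_integral_mult_right)
    then show ?thesis by simp
  qed
  have "\<phi> x = 0" by (rule Fourier_coefficients_zero[OF cont per zero])
  then show ?thesis by (simp add: \<phi>_def)
qed

text \<open>The reproducing kernel \<open>exp (\<nu> \<langle>w, a\<rangle>)\<close> of the classical Fock space in the variable \<open>w\<close>, written
  as a product because its Taylor polynomials are taken in each coordinate separately.\<close>

definition fock_kernel :: "complex^'m \<Rightarrow> complex^'m \<Rightarrow> complex" where
  "fock_kernel a w = (\<Prod>i\<in>UNIV. exp (of_real \<nu> * cnj (a $ i) * w $ i))"

text \<open>Replace every factor of the kernel by a Taylor polynomial: the integral becomes a linear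
  combination of inner products of \<open>f\<close> with basis functions, hence zero. The Taylor polynomials are
  bounded by \<open>exp (\<nu> \<bar>a\<^sub>i\<bar> \<bar>w\<^sub>i\<bar>)\<close>, and \<open>2 s t \<le> s\<^sup>2 + t\<^sup>2\<close> separates this bound from \<open>f\<close>; what
  remains is integrable, as \<open>2 \<bar>a\<^sub>i\<bar> \<bar>w\<^sub>i\<bar> \<le> 2 \<bar>a\<^sub>i\<bar>\<^sup>2 + \<bar>w\<^sub>i\<bar>\<^sup>2 / 2\<close> keeps half of the Gaussian.\<close>

lemma kernel_test_integral:
  fixes f :: "complex^'g \<Rightarrow> complex" and a :: "complex^'m" and n :: int
  assumes f: "f \<in> F" and orth: "\<And>k. ip f (e (n, k)) = 0"
  defines "P \<equiv> \<lambda>p. indicator theta_domain p *\<^sub>R (f (pt p) * cnj (z_factor n (fst p) * fock_kernel a (snd p)) * of_real (weight p))"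
  shows "integrable lborel P" and "(LINT p|lborel. P p) = 0"
proof -
  have holf: "holomorphic_several f" by (rule holomorphic_F[OF f])
  note [measurable] = measurable_sq_dens[OF holf]
  define S where "S = (\<lambda>N w. \<Prod>i\<in>UNIV. exp_partial N (of_real \<nu> * cnj (a $ i) * w $ i))"
  define s where "s = (\<lambda>N p. indicator theta_domain p *\<^sub>R (f (pt p) * cnj (z_factor n (fst p) * S N (snd p)) * of_real (weight p)))"
  define coef where "coef = (\<lambda>k. \<Prod>i\<in>UNIV. (of_real \<nu> * cnj (a $ i)) ^ k i / fact (k i))"
  define I where "I = (\<lambda>N::nat. PiE (UNIV :: 'm set) (\<lambda>_. {..<N}))"
  have finI: "finite (I N)" for N unfolding I_def by (intro finite_PiE) auto
  have S_expand: "S N w = (\<Sum>k\<in>I N. coef k * (\<Prod>i\<in>UNIV. (w $ i) ^ k i))" for N w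
    unfolding S_def exp_partial_def coef_def I_def
    by (subst prod_sum_PiE) (simp_all add: power_mult_distrib prod.distrib[symmetric])
  have s_expand: "s N p = (\<Sum>k\<in>I N. cnj (coef k) * (indicator theta_domain p *\<^sub>R theta_integrand H \<omega> b f (e (n, k)) p))" for N p
    unfolding s_def S_expand theta_integrand_eq e_pt
    by (simp add: sum_distrib_left sum_distrib_right scaleR_sum_right scaleR_conv_of_real mult_ac)
  have int_term: "integrable lborel (\<lambda>p. cnj (coef k) * (indicator theta_domain p *\<^sub>R theta_integrand H \<omega> b f (e (n, k)) p))" for k
    using set_integrable_F[OF f e_F, of n k] unfolding set_integrable_def by (rule integrable_mult_right)
  have s_int: "integrable lborel (s N)" for N
    unfolding s_expand by (intro Bochner_Integration.integrable_sum int_term)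
  have s_zero: "(LINT p|lborel. s N p) = 0" for N
  proof -
    have "(LINT p|lborel. s N p) = (\<Sum>k\<in>I N. LINT p|lborel. cnj (coef k) * (indicator theta_domain p *\<^sub>R theta_integrand H \<omega> b f (e (n, k)) p))"
      unfolding s_expand by (rule Bochner_Integration.integral_sum) (rule int_term)
    also have "\<dots> = (\<Sum>k\<in>I N. cnj (coef k) * ip f (e (n, k)))"
      unfolding theta_inner_def set_lebesgue_integral_def integral_mult_right_zero ..
    finally show ?thesis by (simp add: orth)
  qed
  define G where "G = (\<lambda>p::complex \<times> (complex^'m). exp (2 * (- 2 * pi * (\<alpha> + n)) * Im (fst p) - (2 * \<nu>) * (Im (fst p))\<^sup>2)
     * (\<Prod>i\<in>UNIV. exp (2 * \<nu> * (cmod (a $ i))\<^sup>2) * exp (- (\<nu> / 2) * (cmod (snd p $ i))\<^sup>2)))"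
  have G_nonneg: "G p \<ge> 0" for p unfolding G_def by (intro mult_nonneg_nonneg prod_nonneg) auto
  have [measurable]: "G \<in> borel_measurable borel"
    unfolding G_def by (intro borel_measurable_continuous_onI continuous_intros)
  have G_int: "(\<integral>\<^sup>+p. indicator theta_domain p * ennreal (G p) \<partial>lborel) < \<infinity>"
  proof -
    define g where "g = (\<lambda>i z. ennreal (exp (2 * \<nu> * (cmod (a $ i))\<^sup>2)) * ennreal ((cmod z ^ 0)\<^sup>2 * exp (- (\<nu> / 2) * (cmod z)\<^sup>2)))"
    have [measurable]: "g i \<in> borel_measurable borel" for i unfolding g_def by measurable
    have "(\<integral>\<^sup>+p. indicator theta_domain p * ennreal (G p) \<partial>lborel)
      = (\<integral>\<^sup>+p. indicator {0..1} (Re (fst p)) *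
      (ennreal (exp (2 * (- 2 * pi * (\<alpha> + n)) * Im (fst p) - (2 * \<nu>) * (Im (fst p))\<^sup>2))
        * (\<Prod>i\<in>UNIV. g i (snd p $ i))) \<partial>lborel)"
      unfolding G_def indicator_theta_domain g_def
      by (intro nn_integral_cong, subst ennreal_mult_prod) (simp_all add: ennreal_mult)
    also have "\<dots> = ennreal (sqrt (pi / (2 * \<nu>)) * exp ((- 2 * pi * (\<alpha> + n))\<^sup>2 / (2 * \<nu>))) * (\<Prod>i\<in>UNIV. \<integral>\<^sup>+z. g i z \<partial>lborel)"
      by (rule nn_integral_strip_Gaussian) (use \<nu>_pos in simp, measurable)
    also have "\<dots> < \<infinity>"
    proof -
      have "(\<integral>\<^sup>+z. g i z \<partial>lborel) = ennreal (exp (2 * \<nu> * (cmod (a $ i))\<^sup>2)) * ennreal (pi * fact 0 / (\<nu> / 2) ^ (0 + 1))" for i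
        unfolding g_def nn_integral_complex_Gaussian_moment[OF half_gt_zero[OF \<nu>_pos], of 0, symmetric]
        by (rule nn_integral_cmult) measurable
      then have "(\<integral>\<^sup>+z. g i z \<partial>lborel) = ennreal (exp (2 * \<nu> * (cmod (a $ i))\<^sup>2) * (pi * fact 0 / (\<nu> / 2) ^ (0 + 1)))" for i
        using \<nu>_pos by (simp only: ennreal_mult'[symmetric] exp_ge_zero)
      then have "(\<Prod>i\<in>UNIV. \<integral>\<^sup>+z. g i z \<partial>lborel) = ennreal (\<Prod>i\<in>UNIV. exp (2 * \<nu> * (cmod (a $ i))\<^sup>2) * (pi * fact 0 / (\<nu> / 2) ^ (0 + 1)))"
        using \<nu>_pos by (simp only:) (rule prod_ennreal, simp)
      then show ?thesis by (simp only:) (simp add: ennreal_mult_less_top)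
    qed
    finally show ?thesis .
  qed
  define w where "w = (\<lambda>p. indicat_real theta_domain p * (sq_dens f p + G p))"
  have w_int: "integrable lborel w"
  proof (rule integrableI_nonneg)
    show "w \<in> borel_measurable lborel" unfolding w_def by measurable
    show "AE p in lborel. 0 \<le> w p" unfolding w_def by (simp add: sq_dens_nonneg G_nonneg)
    have "(\<integral>\<^sup>+p. ennreal (w p) \<partial>lborel) = (\<integral>\<^sup>+p. (indicator theta_domain p * ennreal (sq_dens f p) + indicator theta_domain p * ennreal (G p)) \<partial>lborel)"
      unfolding w_def by (intro nn_integral_cong) (simp add: indicator_def ennreal_plus sq_dens_nonneg G_nonneg)
    also have "\<dots> = nn_sq f + (\<integral>\<^sup>+p. indicator theta_domain p * ennreal (G p) \<partial>lborel)"
      unfolding nn_sq_def by (rule nn_integral_add) measurable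
    also have "\<dots> < \<infinity>" using f G_int by (simp add: mem_F_iff)
    finally show "(\<integral>\<^sup>+p. ennreal (w p) \<partial>lborel) < \<infinity>" .
  qed
  have s_bound: "norm (s N p) \<le> w p" for N p
  proof (cases "p \<in> theta_domain")
    case True
    define E where "E = (\<Prod>i\<in>UNIV. exp (\<nu> * cmod (a $ i) * cmod (snd p $ i)))"
    have E: "E \<ge> 0" unfolding E_def by (intro prod_nonneg) simp
    have "cmod (S N (snd p)) \<le> E"
      unfolding S_def E_def prod_norm[symmetric]
    proof (rule prod_mono, rule conjI)
      fix i
      show "cmod (exp_partial N (of_real \<nu> * cnj (a $ i) * snd p $ i)) \<le> exp (\<nu> * cmod (a $ i) * cmod (snd p $ i))"
        using cmod_exp_partial_le[of N "of_real \<nu> * cnj (a $ i) * snd p $ i"] \<nu>_pos by (simp add: norm_mult)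
    qed simp
    then have "norm (s N p) \<le> cmod (f (pt p)) * (cmod (z_factor n (fst p)) * E) * weight p"
      using True weight_pos[of p] by (simp add: s_def norm_mult mult_left_mono mult_right_mono)
    also have "\<dots> \<le> ((cmod (f (pt p)))\<^sup>2 + (cmod (z_factor n (fst p)) * E)\<^sup>2) * weight p"
    proof (rule mult_right_mono)
      show "cmod (f (pt p)) * (cmod (z_factor n (fst p)) * E) \<le> (cmod (f (pt p)))\<^sup>2 + (cmod (z_factor n (fst p)) * E)\<^sup>2"
        using sum_squares_bound[of "cmod (f (pt p))" "cmod (z_factor n (fst p)) * E"]
          mult_nonneg_nonneg[OF norm_ge_zero[of "f (pt p)"] mult_nonneg_nonneg[OF norm_ge_zero[of "z_factor n (fst p)"] E]]
        by linarith
    qed (simp add: less_imp_le[OF weight_pos])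
    also have "\<dots> = sq_dens f p + ((cmod (z_factor n (fst p)))\<^sup>2 * exp (- \<nu> * (cmod (fst p))\<^sup>2)) * (E\<^sup>2 * (\<Prod>i\<in>UNIV. exp (- \<nu> * (cmod (snd p $ i))\<^sup>2)))"
      by (simp only: sq_dens_def distrib_left distrib_right power_mult_distrib weight_split[of p] mult_ac)
    finally have 1: "norm (s N p) \<le> sq_dens f p + ((cmod (z_factor n (fst p)))\<^sup>2 * exp (- \<nu> * (cmod (fst p))\<^sup>2)) * (E\<^sup>2 * (\<Prod>i\<in>UNIV. exp (- \<nu> * (cmod (snd p $ i))\<^sup>2)))" .
    have 2: "E\<^sup>2 * (\<Prod>i\<in>UNIV. exp (- \<nu> * (cmod (snd p $ i))\<^sup>2)) \<le> (\<Prod>i\<in>UNIV. exp (2 * \<nu> * (cmod (a $ i))\<^sup>2) * exp (- (\<nu> / 2) * (cmod (snd p $ i))\<^sup>2))"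
      unfolding E_def prod_power_distrib prod.distrib[symmetric]
    proof (rule prod_mono, rule conjI)
      fix i
      have "0 \<le> \<nu> / 2 * (2 * cmod (a $ i) - cmod (snd p $ i))\<^sup>2" using \<nu>_pos by simp
      then have "2 * (\<nu> * cmod (a $ i) * cmod (snd p $ i)) - \<nu> * (cmod (snd p $ i))\<^sup>2
          \<le> 2 * \<nu> * (cmod (a $ i))\<^sup>2 - (\<nu> / 2) * (cmod (snd p $ i))\<^sup>2"
        by (simp add: power2_eq_square algebra_simps)
      then show "(exp (\<nu> * cmod (a $ i) * cmod (snd p $ i)))\<^sup>2 * exp (- \<nu> * (cmod (snd p $ i))\<^sup>2)
        \<le> exp (2 * \<nu> * (cmod (a $ i))\<^sup>2) * exp (- (\<nu> / 2) * (cmod (snd p $ i))\<^sup>2)"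
        by (simp add: exp_double[symmetric] exp_add[symmetric])
    qed simp
    have "norm (s N p) \<le> sq_dens f p + G p"
      unfolding G_def cmod_z_factor_square[symmetric]
      by (rule order_trans[OF 1 add_left_mono[OF mult_left_mono[OF 2]]]) simp
    then show ?thesis using True by (simp add: w_def)
  qed (simp add: s_def w_def)
  have lim: "(\<lambda>N. s N p) \<longlonglongrightarrow> P p" for p
    unfolding s_def P_def S_def fock_kernel_def by (intro tendsto_intros exp_partial_tendsto)
  have contP: "continuous_on UNIV (\<lambda>p. f (pt p) * cnj (z_factor n (fst p) * fock_kernel a (snd p)) * of_real (weight p))"
    unfolding z_factor_def fock_kernel_def by (intro continuous_intros continuous_compose_pt holf continuous_weight)
  have measP: "P \<in> borel_measurable lborel"
    unfolding P_def using borel_measurable_continuous_onI[OF contP] by measurable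
  have s_meas: "s N \<in> borel_measurable lborel" for N using s_int by (rule borel_measurable_integrable)
  show "integrable lborel P"
    by (rule integrable_dominated_convergence[where s=s, OF measP s_meas w_int]) (simp_all add: lim s_bound)
  have "(\<lambda>N. LINT p|lborel. s N p) \<longlonglongrightarrow> (LINT p|lborel. P p)"
    by (rule integral_dominated_convergence[where s=s, OF measP s_meas w_int]) (simp_all add: lim s_bound)
  then show "(LINT p|lborel. P p) = 0"
    using LIMSEQ_unique[OF _ tendsto_const[of 0]] by (simp add: s_zero)
qed

text \<open>The point of the substitution \<open>w = v + a\<close>: the factor that accompanies the Gaussian in \<open>v\<close> is now
  holomorphic in \<open>v\<close> and equals 1 at \<open>v = 0\<close>, so the mean value property applies.\<close>

lemma kernel_weight_shift:
  "cnj (fock_kernel a (v + a)) * of_real (weight (z, v + a)) =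
    of_real (weight (z, v)) * exp (- of_real \<nu> * (\<Sum>i\<in>UNIV. v $ i * cnj (a $ i)))"
proof -
  have "of_real (exp (- \<nu> * (cmod (v $ i + a $ i))\<^sup>2)) * cnj (exp (of_real \<nu> * cnj (a $ i) * (v $ i + a $ i)))
      = of_real (exp (- \<nu> * (cmod (v $ i))\<^sup>2)) * exp (- of_real \<nu> * (v $ i * cnj (a $ i)))" for i
  proof -
    have exps: "of_real (exp r) * cnj (exp B) = exp (of_real r + cnj B)" for r and B :: complex
      by (simp only: exp_add exp_cnj of_real_exp)
    have "of_real (- \<nu> * (cmod (v $ i + a $ i))\<^sup>2) + cnj (of_real \<nu> * cnj (a $ i) * (v $ i + a $ i))
      = of_real (- \<nu> * (cmod (v $ i))\<^sup>2) + - of_real \<nu> * (v $ i * cnj (a $ i))"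
      unfolding of_real_mult complex_norm_square by (simp add: algebra_simps)
    then show ?thesis unfolding exps by (simp only: exp_add of_real_exp)
  qed
  then have "(\<Prod>i\<in>UNIV. of_real (exp (- \<nu> * (cmod (v $ i + a $ i))\<^sup>2)) * cnj (exp (of_real \<nu> * cnj (a $ i) * (v $ i + a $ i))))
      = (\<Prod>i\<in>UNIV. of_real (exp (- \<nu> * (cmod (v $ i))\<^sup>2))) * exp (- of_real \<nu> * (\<Sum>i\<in>UNIV. v $ i * cnj (a $ i)))"
    by (simp add: prod.distrib sum_distrib_left exp_sum sum_negf[symmetric])
  then show ?thesis
    unfolding fock_kernel_def weight_split by (simp add: prod.distrib cnj_prod mult_ac)
qed

text \<open>The vanishing integral over strip and \<open>w\<close> is translated by \<open>a\<close>, averaged over rotations of the second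
  coordinate, and then sliced in \<open>x\<close>. The result is the Fourier coefficient \<open>C\<close>, a constant, times
  the integral of a positive function.\<close>

lemma orthogonal_e_coefficient:
  assumes f: "f \<in> F" and orth: "\<And>k. ip f (e (n, k)) = 0"
  shows "(LINT x:{0..1}|lborel. reduced f a (Complex x y) * exp (- 2 * \<i> * of_real pi * of_int n * Complex x y)) = 0"
proof -
  have holf: "holomorphic_several f" and qpf: "quasi_periodic f" using f by (auto simp: mem_F_iff)
  define h where "h = (\<lambda>z. reduced f a z * exp (- 2 * \<i> * of_real pi * of_int n * z))"
  have h_hol: "h holomorphic_on UNIV"
    unfolding h_def by (intro holomorphic_intros reduced_holomorphic holf)
  have h_per: "h (z + 1) = h z" for z
  proof -
    have "exp (- 2 * \<i> * of_real pi * of_int n * (z + 1)) = exp (- 2 * \<i> * of_real pi * of_int n * z) * exp ((2 * of_int (- n) * of_real pi) * \<i>)"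
      unfolding exp_add[symmetric] by (rule arg_cong[where f=exp]) (simp add: algebra_simps)
    also have "exp ((2 * of_int (- n) * of_real pi) * \<i>) = (1 :: complex)"
      by (rule exp_2pi_int)
    finally show ?thesis unfolding h_def reduced_periodic[OF qpf] by simp
  qed
  obtain C where C: "\<And>y. (LINT x:{0..1}|lborel. h (Complex x y)) = C"
    using periodic_entire_segment_integral[OF h_hol h_per] by blast
  define P where "P = (\<lambda>p. indicator theta_domain p *\<^sub>R (f (pt p) * cnj (z_factor n (fst p) * fock_kernel a (snd p)) * of_real (weight p)))"
  have P: "integrable lborel P" "(LINT p|lborel. P p) = 0"
    unfolding P_def by (rule kernel_test_integral[OF f orth])+
  define P' where "P' = (\<lambda>p. P ((0, a) + p))"
  have P': "integrable lborel P'" "(LINT p|lborel. P' p) = 0"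
    unfolding P'_def using integral_lborel_translate[OF P(1), of "(0, a)"] P(2) by simp_all
  have P'_eq: "P' (z, v) = indicator theta_domain (z, v) *\<^sub>R (cnj (z_factor n z) * of_real (weight (z, v)) *
      (f (pt (z, v + a)) * exp (- of_real \<nu> * (\<Sum>i\<in>UNIV. v $ i * cnj (a $ i)))))" for z v
  proof -
    have "P' (z, v) = indicator theta_domain (z, v) *\<^sub>R (f (pt (z, v + a)) * cnj (z_factor n z) * (cnj (fock_kernel a (v + a)) * of_real (weight (z, v + a))))"
      by (simp add: P'_def P_def add.commute indicator_theta_domain mult_ac)
    then show ?thesis unfolding kernel_weight_shift by (simp add: mult_ac)
  qed
  define c where "c = (\<lambda>p. indicator theta_domain p *\<^sub>R (cnj (z_factor n (fst p)) * of_real (weight p) * f (pt (fst p, a))))"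
  define R where "R = (\<lambda>t::real. coordinate_rotation 1 (\<lambda>_::'m. cis (2 * pi * t)))"
  have iso: "linear_isometry (R t)" for t
    unfolding R_def by (rule linear_isometry_coordinate_rotation) auto
  have meas: "(\<lambda>(t, v). R t v) \<in> borel \<Otimes>\<^sub>M borel \<rightarrow>\<^sub>M borel"
    unfolding R_def by (rule measurable_coordinate_rotation) (intro continuous_intros)+
  have avg: "(LINT t:{0..1}|lborel. P' (R t p)) = c p" for p
  proof -
    obtain z v where p: "p = (z, v)" by (cases p)
    define \<psi> where "\<psi> = (\<lambda>s. f (pt (z, a) + s *s pt (0, v)) * exp (- of_real \<nu> * (\<Sum>i\<in>UNIV. s * v $ i * cnj (a $ i))))"
    define A where "A = of_real (indicator theta_domain p) * (cnj (z_factor n z) * of_real (weight p))"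
    have Rp: "R t p = (z, cis (2 * pi * t) *s v)" for t
      by (simp add: p R_def coordinate_rotation_def vector_scalar_mult_def)
    have "norm (R t p) = norm p" for t using iso[of t] unfolding linear_isometry_def by blast
    then have wR: "weight (z, cis (2 * pi * t) *s v) = weight p" for t by (simp add: weight_def Rp[symmetric])
    have "pt (z, s *s v + a) = pt (z, a) + s *s pt (0, v)" for s
      using pt_add[of "(z, a)" "(0, s *s v)"] pt_scale[of s 0 v] by (simp add: add.commute)
    then have "P' (R t p) = A * \<psi> (cis (2 * pi * t))" for t
      unfolding Rp P'_eq wR A_def \<psi>_def by (simp add: indicator_theta_domain p scaleR_conv_of_real mult_ac)
    then have "(LINT t:{0..1}|lborel. P' (R t p)) = A * (LINT t:{0..1}|lborel. \<psi> (cis (2 * pi * t)))" by simp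
    also have "(LINT t:{0..1}|lborel. \<psi> (cis (2 * pi * t))) = \<psi> 0"
      by (rule circle_mean_entire) (unfold \<psi>_def, intro holomorphic_intros holomorphic_several_line holf)
    finally show ?thesis by (simp add: A_def \<psi>_def c_def p scaleR_conv_of_real)
  qed
  have c: "integrable lborel c" "(LINT p|lborel. c p) = 0"
    using integral_average_isometries[where c=c, OF P'(1) iso meas avg] P'(2) by simp_all
  define g where "g = (\<lambda>(y, v :: complex^'m). exp (- 2 * \<nu> * y\<^sup>2 - 4 * pi * (\<alpha> + n) * y) * (\<Prod>i\<in>UNIV. exp (- \<nu> * (cmod (v $ i))\<^sup>2)))"
  have slice: "(LINT x|lborel. c (Complex x y, v)) = C * of_real (g (y, v))" for y v
  proof -
    have "cnj (z_factor n z) * of_real (weight (z, v)) * f (pt (z, a)) = of_real (g (Im z, v)) * h z" for z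
    proof -
      have "cnj (z_factor n z) * of_real (weight (z, v)) * f (pt (z, a)) =
        reduced f a z * of_real (\<Prod>i\<in>UNIV. exp (- \<nu> * (cmod (v $ i))\<^sup>2)) *
          (z_factor 0 z * cnj (z_factor n z) * of_real (exp (- \<nu> * (cmod z)\<^sup>2)))"
        unfolding weight_split reduced_z_factor[of f z a] fst_conv snd_conv of_real_mult by (simp only: mult_ac)
      moreover have "cis (2 * pi * of_int (0 - n) * Re z) * of_real (exp (- 2 * \<nu> * (Im z)\<^sup>2 - 2 * pi * (2 * \<alpha> + of_int 0 + n) * Im z))
        = exp (- 2 * \<i> * of_real pi * of_int n * z) * of_real (exp (- 2 * \<nu> * (Im z)\<^sup>2 - 4 * pi * (\<alpha> + n) * Im z))"
        unfolding cis_conv_exp of_real_exp exp_add[symmetric]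
        by (rule arg_cong[where f=exp]) (simp add: complex_eq_iff algebra_simps)
      ultimately show ?thesis unfolding z_factor_mult_cnj h_def g_def by (simp add: mult_ac)
    qed
    then have "c (Complex x y, v) = indicat_real {0..1} x *\<^sub>R (of_real (g (y, v)) * h (Complex x y))" for x
      unfolding c_def indicator_theta_domain by simp
    then have "(LINT x|lborel. c (Complex x y, v)) = (LINT x:{0..1}|lborel. of_real (g (y, v)) * h (Complex x y))"
      unfolding set_lebesgue_integral_def by (simp only:)
    also have "\<dots> = C * of_real (g (y, v))" unfolding set_integral_mult_right C by (rule mult.commute)
    finally show ?thesis .
  qed
  have int: "integrable lborel (\<lambda>q. C * of_real (g q))" and zero: "(LINT q|lborel. C * of_real (g q)) = 0"
    using integral_slice[where c="\<lambda>q. C * of_real (g q)", OF c(1) slice] c(2) by simp_all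
  have "C = 0"
  proof (rule ccontr)
    assume "C \<noteq> 0"
    have gpos: "g q > 0" for q unfolding g_def by (cases q) (auto intro!: mult_pos_pos prod_pos)
    have "integrable lborel (\<lambda>q. Re (1 / C * (C * of_real (g q))))"
      by (intro integrable_Re integrable_mult_right int)
    then have gi: "integrable lborel g" using \<open>C \<noteq> 0\<close> by simp
    have "(LINT q|lborel. g q) = 0" using zero \<open>C \<noteq> 0\<close> by simp
    then have "AE q in lborel. g q = 0"
      using integral_nonneg_eq_0_iff_AE[OF gi] gpos by (simp add: less_imp_le)
    then have "AE q in (lborel :: (real \<times> (complex^'m)) measure). False"
      by eventually_elim (use gpos in \<open>metis less_irrefl\<close>)
    then have "emeasure (lborel :: (real \<times> (complex^'m)) measure) UNIV = 0"
      by (simp add: AE_iff_null null_sets_def)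
    then show False by simp
  qed
  then show ?thesis using C[of y] by (simp add: h_def)
qed

lemma e_total:
  assumes f: "f \<in> F" and orth: "\<And>i. ip f (e i) = 0"
  shows "f = (\<lambda>_. 0)"
proof
  fix u
  have holf: "holomorphic_several f" and qpf: "quasi_periodic f" using f by (auto simp: mem_F_iff)
  obtain z a where u: "u = pt (z, a)" using pt_coords[of u] by (metis surj_pair)
  have z: "z = Complex (Re z) 0 + \<i> * of_real (Im z)" by (simp add: complex_eq_iff)
  have cx: "Complex x 0 + \<i> * of_real y = Complex x y" for x y by (simp add: complex_eq_iff)
  have "reduced f a (Complex (Re z) 0 + \<i> * of_real (Im z)) = 0"
    by (rule reduced_zero[OF holf qpf]) (unfold cx, rule orthogonal_e_coefficient[OF f orth])
  then show "f u = 0" unfolding u reduced_z_factor z[symmetric] by simp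
qed

sublocale basis: orthogonal_family F ip e
proof unfold_locales
  show "fun_hilbert_space F ip" by (rule fun_hilbert_space_F)
  fix i j :: "int \<times> ('m \<Rightarrow> nat)"
  obtain n k where i: "i = (n, k)" by (cases i)
  obtain n' k' where j: "j = (n', k')" by (cases j)
  show "e i \<in> F" unfolding i by (rule e_F)
  show "ip (e i) (e j) = 0" if "i \<noteq> j" using that unfolding i j by (rule e_orthogonal)
  have "e (n, k) (pt (0, \<chi> i. 1)) \<noteq> 0" unfolding e_pt by (simp add: z_factor_def)
  then show "e i \<noteq> (\<lambda>_. 0)" unfolding i by metis
qed

lemma eval_bounded: "\<exists>C. \<forall>f\<in>F. cmod (f u) \<le> C * ip_norm ip f"
  using local_bound[of "norm u"] by blast

lemmas rkhs_F = basis.rkhs_and_basis(1)[OF e_total eval_bounded]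
  and basis_F = basis.rkhs_and_basis(2)[OF e_total eval_bounded]

end

theorem theorem3p3:
  fixes H :: "complex^'g \<Rightarrow> complex^'g \<Rightarrow> complex"
    and \<omega> :: "complex^'g"
    and b :: "'m::finite \<Rightarrow> complex^'g"
    and chi :: "complex^'g \<Rightarrow> complex"
    and \<nu> \<alpha> :: real
  assumes "CARD('g) \<ge> 2"
    and "CARD('m) = CARD('g) - 1"
    and "positive_definite_hermitian H"
    and "\<omega> \<noteq> 0"
    and "H \<omega> \<omega> = of_real \<nu>"
    and "adapted_basis H \<omega> \<nu> b"
    and "unitary_character (rank_one_lattice \<omega>) chi"
    and "\<And>m::int. chi (of_int m *s \<omega>) = exp (2 * \<i> * of_real pi * of_real \<alpha> * of_int m)"
  shows "reproducing_kernel_hilbert_space (theta_FB_space H \<omega> b chi) (theta_inner H \<omega> b) \<and>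
     fun_orthogonal_basis (theta_FB_space H \<omega> b chi) (theta_inner H \<omega> b) (theta_basis \<omega> b \<alpha> \<nu>) \<and>
     (\<forall>(n::int) (k::'m \<Rightarrow> nat).
        theta_inner H \<omega> b (theta_basis \<omega> b \<alpha> \<nu> (n, k)) (theta_basis \<omega> b \<alpha> \<nu> (n, k)) =
        of_real ((2 * pi) ^ (CARD('g) - 1) *
          (sqrt (2 * pi * \<nu>) * (1 / (2 * \<nu>)) ^ CARD('g) * (1 / \<nu>) ^ multi_degree k *
           real (multi_fact k) * exp (2 * pi^2 / \<nu> * (of_int n + \<alpha>)^2))))"
proof -
  interpret theta_setting H \<omega> b chi \<nu> \<alpha>
    by unfold_locales (rule assms)+
  have "CARD('g) = CARD('m) + 1" using assms(1,2) by simp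
  then show ?thesis by (intro conjI allI rkhs_F basis_F norm_e_formula)
qed

end
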